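(* Let $\alpha\in(0,1)$. Assume that the heat kernel satisfies, for some constant $C>0$, $$0<p_s(x,y)\lesssim \frac{1}{\mu(B(x,\sqrt s))}e^{-C d(x,y)^2/s}\qquad\text{for all } s>0,\ x,y\in\mathbb M,$$ and that the measure $\mu$ satisfies $$\inf_{(x,r)\in\mathbb M\times(0,\infty)}\frac{\mu(B(x,r))}{r^{\beta^\star}}>0 .$$ Write $I=[0,T)$. (i) Let $(q,p,r)$ be any admissible triplet and let $\varphi\in L^r(\mathbb M)$. Then for $0<T\le\infty$, $e^{-t\mathcal L^\alpha}(\varphi)\in L^q(I;L^p)\cap C_b(I;L^r)$ with the estimate $$\|e^{-t\mathcal L^\alpha}(\varphi)\|_{L^q(I;L^p)}\lesssim\|\varphi\|_{L^r(\mathbb M)} .$$ (ii) Let $(q,p,r)$ be any generalized admissible triplet and let $\varphi\in L^r(\mathbb M)$. Then for $0<T\le\infty$, $e^{-t\mathcal L^\alpha}(\varphi)\in C_q(I;L^p)\cap C_b(I;L^r)$ with the estimate $$\|e^{-t\mathcal L^\alpha}(\varphi)\|_{C_q(I;L^p)}\lesssim\|\varphi\|_{L^r(\mathbb M)} .$$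
   Context: Setting: $(\mathbb M,d,\mu)$ is a metric measure space, i.e. $(\mathbb M,d)$ is a non-empty, locally compact, separable metric space and $\mu$ is a Borel measure on $\mathbb M$; $B(x,r)=\{y\in\mathbb M: d(x,y)<r\}$. $\beta^\star$ is a positive constant less than or equal to the Hausdorff dimension of $\mathbb M$. $L^p=L^p(\mathbb M)=L^p(\mathbb M,\mu)$. Heat kernel: a family $\{p_t\}_{t>0}$ of measurable functions on $\mathbb M\times\mathbb M$ such that for almost all $x,y\in\mathbb M$ and all $s,t>0$: (i) $p_t(x,y)\ge0$; (ii) $\int_{\mathbb M}p_t(x,y)\,d\mu(y)\le1$; (iii) $p_t(x,y)=p_t(y,x)$; (iv) $p_{s+t}(x,y)=\int_{\mathbb M}p_s(x,z)p_t(z,y)\,d\mu(z)$; (v) $\lim_{t\to0^+}\int_{\mathbb M}p_t(x,y)f(y)\,d\mu(y)=f(x)$ for all $f\in L^2(\mathbb M,\mu)$. It generates the semigroup $P_tf(x)=\int_{\mathbb M}p_t(x,y)f(y)\,d\mu(y)$ on $L^2(\mathbb M,\mu)$, with generator $\mathcal Lf=\lim_{t\to0}(f-P_tf)/t$ (limit in $L^2$), a self-adjoint, positive definite operator, so $P_t=e^{-t\mathcal L}$. Fractional heat semigroup: for $0<\alpha<1$, $e^{-t\mathcal L^\alpha}f(x)=\int_{\mathbb M}K^{\mathcal L}_{\alpha,t}(x,y)f(y)\,d\mu(y)$ with $K^{\mathcal L}_{\alpha,t}(x,y)=\int_0^\infty\eta^\alpha_t(s)p_s(x,y)\,ds$,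 where $\eta^\alpha_t$ is the non-negative continuous subordination density, satisfying $\eta^\alpha_t(s)=t^{-1/\alpha}\eta^\alpha_1(s/t^{1/\alpha})$; $\eta^\alpha_t(s)\lesssim t/s^{1+\alpha}$ for all $s,t>0$; $\int_0^\infty s^{-\gamma}\eta^\alpha_1(s)\,ds<\infty$ for $\gamma>0$; $\eta^\alpha_t(s)\simeq t/s^{1+\alpha}$ for $s\ge t^{1/\alpha}>0$. Admissible triplet: $(q,p,r)$ is admissible if $\frac1q=\frac{\beta^\star}{2\alpha}\big(\frac1r-\frac1p\big)$ where $1<r\le p<\frac{\beta^\star r}{\beta^\star-2\alpha}$ if $\beta^\star>2r\alpha$, and $1<r\le p<\infty$ if $\beta^\star\le2r\alpha$. It is generalized admissible if $\frac1q=\frac{\beta^\star}{2\alpha}\big(\frac1r-\frac1p\big)$ where $1<r\le p<\frac{\beta^\star r}{\beta^\star-2\alpha r}$ if $\beta^\star>2r\alpha$, and $1<r\le p<\infty$ if $\beta^\star\le2r\alpha$. (If $p=r$ then $q=\infty$.) Function spaces: for a Banach space $\mathbb X$ and $I=[0,T)$, $L^q(I;\mathbb X)$ is the usual Lebesgue space in time with values in $\mathbb X$; $C(I;\mathbb X)$ is the space of continuous functions $I\to\mathbb X$ and $C_b(I;\mathbb X)$ the space of bounded continuous functions $I\to\mathbb X$; $C_\sigma(I;\mathbb X)=\{f\in C(I;\mathbb X):\ \|f\|_{C_\sigma(I;\mathbb X)}=\sup_{t\in I}t^{1/\sigma}\|f(t)\|_{\mathbb X}<\infty\}$ (with $t^{1/\infty}=1$).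 $X\lesssim Y$ means $X\le cY$ with a constant $c>0$ independent of the main parameters; $X\simeq Y$ means $X\lesssim Y\lesssim X$.
   Formalization: In (i) the L^q(I;L^p) membership and estimate are claimed only when r ≤ q (false for some admissible triplets with q<r, e.g. R^2, α=1/2, r=2, p=8); in (ii), if φ is not in L^p, C_q is taken on (0,T) instead of [0,T), since the value at t=0 is φ. *)

theory Defs
  imports "HOL-Analysis.Analysis" "HOL-Probability.Essential_Supremum"
begin

section \<open>Hausdorff dimension\<close>

text \<open>Covers are by bounded sets because \<^const>\<open>diameter\<close> is 0 on unbounded sets. Finite covers are
  included by padding with empty sets.\<close>

definition hausdorff_premeasure :: "real \<Rightarrow> real \<Rightarrow> 'a::metric_space set \<Rightarrow> ennreal" where
  "hausdorff_premeasure \<delta> s E =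
     (INF U \<in> {U :: nat \<Rightarrow> 'a set. E \<subseteq> (\<Union>n. U n) \<and> (\<forall>n. bounded (U n) \<and> diameter (U n) \<le> \<delta>)}.
        \<Sum>n. ennreal (diameter (U n) powr s))"

definition hausdorff_measure :: "real \<Rightarrow> 'a::metric_space set \<Rightarrow> ennreal" where
  "hausdorff_measure s E = (SUP \<delta> \<in> {0<..}. hausdorff_premeasure \<delta> s E)"

text \<open>Only exponents \<open>s > 0\<close> are considered, since \<open>0 powr 0 = 0\<close>. For nonempty sets this does not
  change the infimum.\<close>

definition hausdorff_dimension :: "'a::metric_space set \<Rightarrow> ennreal" where
  "hausdorff_dimension E = Inf {ennreal s | s. s > 0 \<and> hausdorff_measure s E = 0}"


section \<open>Lebesgue spaces\<close>

text \<open>Real-valued functions, with measurability up to null sets (hence the completion): an integral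
  against a kernel which is determined only almost everywhere is in general only measurable in this
  sense. Equality in these spaces is equality almost everywhere, that is, \<open>Lp_norm \<mu> p (f - g) = 0\<close>.
  The exponent is finite.\<close>

definition Lp_space :: "'a measure \<Rightarrow> real \<Rightarrow> ('a \<Rightarrow> real) set" where
  "Lp_space \<mu> p = {f \<in> borel_measurable (completion \<mu>).
                       integrable (completion \<mu>) (\<lambda>x. \<bar>f x\<bar> powr p)}"

definition Lp_norm :: "'a measure \<Rightarrow> real \<Rightarrow> ('a \<Rightarrow> real) \<Rightarrow> real" where
  "Lp_norm \<mu> p f = (\<integral>x. \<bar>f x\<bar> powr p \<partial>completion \<mu>) powr (1 / p)"


section \<open>Spaces of Banach space valued functions of time\<close>

text \<open>A space of values is given by its carrier \<open>X\<close> (of representatives) and its norm \<open>N\<close>; it is used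
  with \<open>X = Lp_space \<mu> p\<close> and \<open>N = Lp_norm \<mu> p\<close>. Time exponents range over \<open>(0,\<infinity>]\<close>.\<close>

definition time_interval :: "ennreal \<Rightarrow> real set" where
  "time_interval T = {t. 0 \<le> t \<and> ennreal t < T}"

definition strongly_measurable_on ::
    "real set \<Rightarrow> 'v::minus set \<Rightarrow> ('v \<Rightarrow> real) \<Rightarrow> (real \<Rightarrow> 'v) \<Rightarrow> bool" where
  "strongly_measurable_on I X N f \<longleftrightarrow>
     (\<exists>g :: nat \<Rightarrow> real \<Rightarrow> 'v.
        (\<forall>n. finite (g n ` I) \<and> g n ` I \<subseteq> X \<and> (\<forall>v. {t \<in> I. g n t = v} \<in> sets lebesgue)) \<and>
        (AE t in lebesgue_on I. (\<lambda>n. N (g n t - f t)) \<longlonglongrightarrow> 0))"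

definition Lq_space ::
    "ennreal \<Rightarrow> real set \<Rightarrow> 'v::minus set \<Rightarrow> ('v \<Rightarrow> real) \<Rightarrow> (real \<Rightarrow> 'v) set" where
  "Lq_space q I X N =
     {f. (AE t in lebesgue_on I. f t \<in> X) \<and> strongly_measurable_on I X N f \<and>
         (if q = \<infinity> then esssup (lebesgue_on I) (\<lambda>t. ennreal (N (f t))) < \<infinity>
          else integrable (lebesgue_on I) (\<lambda>t. N (f t) powr enn2real q))}"

definition Lq_norm :: "ennreal \<Rightarrow> real set \<Rightarrow> ('v \<Rightarrow> real) \<Rightarrow> (real \<Rightarrow> 'v) \<Rightarrow> real" where
  "Lq_norm q I N f =
     (if q = \<infinity> then enn2real (esssup (lebesgue_on I) (\<lambda>t. ennreal (N (f t))))
      else (\<integral>t. N (f t) powr enn2real q \<partial>lebesgue_on I) powr (1 / enn2real q))"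

definition C_space ::
    "real set \<Rightarrow> 'v::minus set \<Rightarrow> ('v \<Rightarrow> real) \<Rightarrow> (real \<Rightarrow> 'v) set" where
  "C_space I X N =
     {f. \<forall>t\<in>I. f t \<in> X \<and> ((\<lambda>s. N (f s - f t)) \<longlongrightarrow> 0) (at t within I)}"

definition Cb_space ::
    "real set \<Rightarrow> 'v::minus set \<Rightarrow> ('v \<Rightarrow> real) \<Rightarrow> (real \<Rightarrow> 'v) set" where
  "Cb_space I X N = {f \<in> C_space I X N. \<exists>B. \<forall>t\<in>I. N (f t) \<le> B}"

text \<open>For a semigroup orbit \<open>u\<close> the spaces below are used on \<open>[0,T)\<close> if \<open>u 0 \<in> X\<close> and on \<open>(0,T)\<close>
  otherwise. The weight \<open>t\<^sup>1\<^sup>/\<^sup>\<sigma>\<close>. The case \<open>\<sigma> = \<infinity>\<close> is separate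
  because \<open>0 powr 0 = 0\<close>.\<close>

definition time_weight :: "ennreal \<Rightarrow> real \<Rightarrow> real" where
  "time_weight \<sigma> t = (if \<sigma> = \<infinity> then 1 else t powr (1 / enn2real \<sigma>))"

definition Csigma_space ::
    "ennreal \<Rightarrow> real set \<Rightarrow> 'v::minus set \<Rightarrow> ('v \<Rightarrow> real) \<Rightarrow> (real \<Rightarrow> 'v) set" where
  "Csigma_space \<sigma> I X N =
     {f \<in> C_space I X N. bdd_above ((\<lambda>t. time_weight \<sigma> t * N (f t)) ` I)}"

definition Csigma_norm :: "ennreal \<Rightarrow> real set \<Rightarrow> ('v \<Rightarrow> real) \<Rightarrow> (real \<Rightarrow> 'v) \<Rightarrow> real" where
  "Csigma_norm \<sigma> I N f = (SUP t\<in>I. time_weight \<sigma> t * N (f t))"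


section \<open>Heat kernels and the fractional heat semigroup\<close>

definition heat_semigroup ::
    "'a measure \<Rightarrow> (real \<Rightarrow> 'a \<Rightarrow> 'a \<Rightarrow> real) \<Rightarrow> real \<Rightarrow> ('a \<Rightarrow> real) \<Rightarrow> 'a \<Rightarrow> real" where
  "heat_semigroup \<mu> k t f x = (\<integral>y. k t x y * f y \<partial>completion \<mu>)"

text \<open>``For almost all \<open>x\<close>, \<open>y\<close>'' is an iterated quantifier, so that it makes sense for every \<open>\<mu>\<close>; if
  \<open>\<mu>\<close> is sigma-finite, it follows from the same condition almost everywhere for the product measure.
  The exceptional set does not depend on the times. The approximation of the identity is in the sense
  of \<open>L\<^sup>2\<close>, as is the limit defining the generator; for a bounded semigroup with symmetric kernel
  it is implied by convergence almost everywhere.\<close>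

definition heat_kernel :: "'a measure \<Rightarrow> (real \<Rightarrow> 'a \<Rightarrow> 'a \<Rightarrow> real) \<Rightarrow> bool" where
  "heat_kernel \<mu> k \<longleftrightarrow>
     (\<forall>t>0. (\<lambda>(x, y). k t x y) \<in> borel_measurable (\<mu> \<Otimes>\<^sub>M \<mu>)) \<and>
     (AE x in \<mu>. AE y in \<mu>. \<forall>s>0. \<forall>t>0.
        0 \<le> k t x y \<and>
        (\<integral>\<^sup>+ z. ennreal (k t x z) \<partial>\<mu>) \<le> 1 \<and>
        k t x y = k t y x \<and>
        ennreal (k (s + t) x y) = (\<integral>\<^sup>+ z. ennreal (k s x z * k t z y) \<partial>\<mu>)) \<and>
     (\<forall>f \<in> Lp_space \<mu> 2.
        ((\<lambda>t. Lp_norm \<mu> 2 (heat_semigroup \<mu> k t f - f)) \<longlongrightarrow> 0) (at_right 0))"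

text \<open>\<open>\<eta> t s\<close> is the density at \<open>s\<close> of the \<open>\<alpha>\<close>-stable subordinator at time \<open>t\<close>. The Laplace transform
  condition is the scalar form of the subordination formula
  \<open>exp (- t L\<^sup>\<alpha>) = \<integral> \<eta> t s exp (- s L) ds\<close> and, with continuity, determines \<open>\<eta>\<close> on \<open>(0,\<infinity>)\<close>; the
  remaining conditions are the standard properties of this density.\<close>

definition subordination_density :: "real \<Rightarrow> (real \<Rightarrow> real \<Rightarrow> real) \<Rightarrow> bool" where
  "subordination_density \<alpha> \<eta> \<longleftrightarrow>
     (\<forall>t>0. continuous_on {0<..} (\<eta> t)) \<and>
     (\<forall>t>0. \<forall>s>0. 0 \<le> \<eta> t s) \<and>
     (\<forall>t>0. \<forall>\<xi>\<ge>0. (\<integral>\<^sup>+ s \<in> {0<..}. ennreal (exp (- \<xi> * s) * \<eta> t s) \<partial>lborel)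
                     = ennreal (exp (- t * \<xi> powr \<alpha>))) \<and>
     (\<forall>t>0. \<forall>s>0. \<eta> t s = t powr (- 1 / \<alpha>) * \<eta> 1 (s / t powr (1 / \<alpha>))) \<and>
     (\<exists>c>0. \<forall>t>0. \<forall>s>0. \<eta> t s \<le> c * (t / s powr (1 + \<alpha>))) \<and>
     (\<forall>\<gamma>>0. (\<integral>\<^sup>+ s \<in> {0<..}. ennreal (s powr (- \<gamma>) * \<eta> 1 s) \<partial>lborel) < \<infinity>) \<and>
     (\<exists>c>0. \<exists>c'>0. \<forall>t>0. \<forall>s \<ge> t powr (1 / \<alpha>).
        c * (t / s powr (1 + \<alpha>)) \<le> \<eta> t s \<and> \<eta> t s \<le> c' * (t / s powr (1 + \<alpha>)))"

definition fractional_kernel ::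
    "(real \<Rightarrow> real \<Rightarrow> real) \<Rightarrow> (real \<Rightarrow> 'a \<Rightarrow> 'a \<Rightarrow> real) \<Rightarrow> real \<Rightarrow> 'a \<Rightarrow> 'a \<Rightarrow> real" where
  "fractional_kernel \<eta> k t x y = (LBINT s:{0<..}. \<eta> t s * k s x y)"

text \<open>At \<open>t = 0\<close> the operator is the identity.\<close>

definition fractional_heat_semigroup ::
    "'a measure \<Rightarrow> (real \<Rightarrow> real \<Rightarrow> real) \<Rightarrow> (real \<Rightarrow> 'a \<Rightarrow> 'a \<Rightarrow> real) \<Rightarrow> real \<Rightarrow> ('a \<Rightarrow> real)
       \<Rightarrow> 'a \<Rightarrow> real" where
  "fractional_heat_semigroup \<mu> \<eta> k t f =
     (if t = 0 then f else (\<lambda>x. \<integral>y. fractional_kernel \<eta> k t x y * f y \<partial>completion \<mu>))"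


section \<open>Admissible triplets\<close>

text \<open>\<open>q\<close> is extended, with \<open>1 / q = 0\<close> for \<open>q = \<infinity>\<close>, that is, for \<open>p = r\<close>. Admissible triplets
  satisfy \<open>r < q\<close> if \<open>\<beta> > 2 * r * \<alpha>\<close> or \<open>\<beta> \<le> 2 * \<alpha>\<close>, but not for intermediate \<open>\<beta>\<close>; the
  \<open>L\<^sup>q\<close> estimate for the semigroup needs \<open>r \<le> q\<close>.\<close>

definition admissible :: "real \<Rightarrow> real \<Rightarrow> ennreal \<Rightarrow> real \<Rightarrow> real \<Rightarrow> bool" where
  "admissible \<beta> \<alpha> q p r \<longleftrightarrow>
     1 / q = ennreal (\<beta> / (2 * \<alpha>) * (1 / r - 1 / p)) \<and>
     1 < r \<and> r \<le> p \<and>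
     (\<beta> > 2 * r * \<alpha> \<longrightarrow> p < \<beta> * r / (\<beta> - 2 * \<alpha>))"

definition generalized_admissible :: "real \<Rightarrow> real \<Rightarrow> ennreal \<Rightarrow> real \<Rightarrow> real \<Rightarrow> bool" where
  "generalized_admissible \<beta> \<alpha> q p r \<longleftrightarrow>
     1 / q = ennreal (\<beta> / (2 * \<alpha>) * (1 / r - 1 / p)) \<and>
     1 < r \<and> r \<le> p \<and>
     (\<beta> > 2 * r * \<alpha> \<longrightarrow> p < \<beta> * r / (\<beta> - 2 * \<alpha> * r))"

end

theory Submission
  imports Defs "HOL-Probability.Probability_Measure"
begin

text \<open>The upper bound for the heat kernel at \<open>y = x\<close> forces every ball to have finite measure, so \<open>\<mu>\<close> is
sigma-finite, and with the volume lower bound it gives \<open>k s x y \<le> A s\<^sup>-\<^sup>\<gamma>\<close> with \<open>\<gamma> = \<beta> / 2\<close>. Apart from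
this bound the argument uses that the operators with kernel \<open>k s\<close> form a symmetric sub-Markovian
semigroup which is strongly continuous on \<open>L\<^sup>2\<close>. The fractional semigroup is the mixture
\<open>T \<tau> g = \<integral> P (\<tau> s) g d\<nu>(s)\<close> of the heat semigroup \<open>P\<close>, where \<open>\<nu>\<close> has the density \<open>\<eta> 1\<close> and
\<open>\<tau> = t\<close> to the power \<open>1/\<alpha>\<close>; it has again a sub-Markovian kernel, bounded by \<open>A D t\<^sup>-\<^sup>b\<close> with
\<open>b = \<beta> / (2 \<alpha>)\<close>, because \<open>\<nu>\<close> has a finite moment of order \<open>-\<gamma>\<close>.

For a kernel with row and column integrals at most 1 and values at most \<open>B\<close>, Jensen's inequality gives
both the contraction on \<open>L\<^sup>r\<close> and \<open>|K g|\<^sup>r \<le> B \<parallel>g\<parallel>\<^sup>r\<close> pointwise; together they bound the norm from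
\<open>L\<^sup>r\<close> to \<open>L\<^sup>p\<close> by \<open>B\<close> to the power \<open>1/r - 1/p\<close> (\<open>kernel_op_improves\<close>). With \<open>B = A D t\<^sup>-\<^sup>b\<close> this is
the weighted estimate in time.

The \<open>L\<^sup>q\<close> estimate in time does not follow by integrating that bound, since \<open>1/t\<close> is not integrable.
Instead \<open>g\<close> is cut into its superlevel sets. Each layer is estimated by the better of the contraction on
\<open>L\<^sup>p\<close> and the smoothing from \<open>L\<^sup>1\<close>, and summing the layers by Minkowski's inequality bounds
\<open>\<parallel>T g\<parallel>\<^sub>p\<close> by \<open>\<integral> g\<^sup>*(u) max(u, t\<^sup>b)\<^sup>1\<^sup>/\<^sup>p\<^sup>-\<^sup>1 du\<close> for the decreasing rearrangement \<open>g\<^sup>*\<close>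
(\<open>kernel_op_le_hardy_mean\<close>). The \<open>L\<^sup>q\<close> norm of this in \<open>t\<close> is controlled by a Hardy inequality
(\<open>hardy_inequality\<close>), which is where \<open>r \<le> q\<close> enters.

Continuity in time comes from the \<open>L\<^sup>2\<close> hypothesis. On bounded integrable functions, convergence in \<open>L\<^sup>2\<close>
together with boundedness in \<open>L\<^sup>1\<close> and \<open>L\<^sup>\<infinity>\<close> gives convergence in \<open>L\<^sup>r\<close>; density and contractivity extend
it to \<open>L\<^sup>r\<close> (\<open>P_strongly_continuous\<close>), and Jensen's inequality with dominated convergence transfers it to
the mixture (\<open>T_continuous\<close>). Continuity in \<open>L\<^sup>p\<close> at positive times follows since differences are bounded
uniformly.

Measurability of \<open>s \<mapsto> k s x y\<close>, without which the mixture makes no sense, is a theorem and not a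
hypothesis: the semigroup law turns the strong continuity on \<open>L\<^sup>2\<close> into continuity of \<open>s \<mapsto> k s x y\<close> for
almost all \<open>x\<close>, \<open>y\<close> (\<open>k_continuous_in_time\<close>), and then a jointly measurable version of the kernel exists.\<close>


section \<open>Convexity inequalities for powers\<close>

text \<open>Young's inequality in the form used below: the graph of \<open>y \<mapsto> y\<^sup>p\<close> lies above its tangent at \<open>a\<close>.\<close>

lemma powr_tangent:
  fixes a y p :: real
  assumes "1 \<le> p" "0 \<le> a" "0 \<le> y"
  shows "p * a powr (p - 1) * y \<le> y powr p + (p - 1) * a powr p"
proof (cases "a = 0 \<or> y = 0")
  case True
  then show ?thesis using assms by auto
next
  case False
  then have pos: "a > 0" "y > 0" using assms by auto
  have "(y powr p) powr (1/p) * (a powr p) powr (1 - 1/p) \<le> 1/p * y powr p + (1 - 1/p) * a powr p"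
    by (rule Youngs_inequality_0) (use assms pos in auto)
  moreover have "(y powr p) powr (1/p) = y"
    using pos assms by (simp add: powr_powr)
  moreover have "(a powr p) powr (1 - 1/p) = a powr (p - 1)"
    using assms by (simp add: powr_powr right_diff_distrib)
  ultimately have "y * a powr (p - 1) \<le> 1/p * y powr p + (1 - 1/p) * a powr p"
    by simp
  then have "p * (y * a powr (p - 1)) \<le> p * (1/p * y powr p + (1 - 1/p) * a powr p)"
    using assms by (intro mult_left_mono) auto
  also have "p * (1/p * y powr p + (1 - 1/p) * a powr p) = y powr p + (p - 1) * a powr p"
    using assms by (simp add: field_simps)
  finally show ?thesis by (simp add: mult_ac)
qed

lemma powr_abs_add_le:
  fixes a b p :: real
  assumes "0 \<le> p"
  shows "\<bar>a + b\<bar> powr p \<le> 2 powr p * (\<bar>a\<bar> powr p + \<bar>b\<bar> powr p)"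
proof -
  have "\<bar>a + b\<bar> powr p \<le> (2 * max \<bar>a\<bar> \<bar>b\<bar>) powr p"
    using assms by (intro powr_mono2) auto
  also have "\<dots> = 2 powr p * (max \<bar>a\<bar> \<bar>b\<bar>) powr p"
    by (simp add: powr_mult)
  also have "\<dots> \<le> 2 powr p * (\<bar>a\<bar> powr p + \<bar>b\<bar> powr p)"
    by (intro mult_left_mono) (auto simp: max_def)
  finally show ?thesis .
qed

lemma powr_abs_diff_le:
  fixes a b p :: real
  assumes "0 \<le> p"
  shows "\<bar>a - b\<bar> powr p \<le> 2 powr p * (\<bar>a\<bar> powr p + \<bar>b\<bar> powr p)"
  using powr_abs_add_le[OF assms, of a "- b"] by simp

text \<open>Integrating the tangent inequality at the mean value proves Jensen's inequality for a weight of total mass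
at most \<open>S\<close>; a Bochner integral that does not exist is 0, which is harmless on the left. The inequality
serves for the contraction property of kernels, for Minkowski's inequality over layers, for a Schur test and
for the comparison of subordinated operators.\<close>

lemma weighted_jensen:
  fixes w f :: "'a \<Rightarrow> real" and S p :: real
  assumes [measurable]: "w \<in> borel_measurable M" "f \<in> borel_measurable M"
    and w: "\<And>x. 0 \<le> w x" "(\<integral>\<^sup>+x. ennreal (w x) \<partial>M) \<le> ennreal S" and p: "1 \<le> p"
  shows "ennreal (\<bar>\<integral>x. w x * f x \<partial>M\<bar> powr p)
       \<le> ennreal (S powr (p - 1)) * (\<integral>\<^sup>+x. ennreal (w x * \<bar>f x\<bar> powr p) \<partial>M)"
proof (cases "integrable M (\<lambda>x. w x * f x) \<and> (\<integral>x. w x * f x \<partial>M) \<noteq> 0")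
  case False
  then have "(\<integral>x. w x * f x \<partial>M) = 0"
    using not_integrable_integral_eq by blast
  then show ?thesis using p by simp
next
  case True
  define J where "J = \<bar>\<integral>x. w x * f x \<partial>M\<bar>"
  have "J > 0" using True by (simp add: J_def)
  have S: "S > 0"
  proof (rule ccontr)
    assume "\<not> S > 0"
    then have "(\<integral>\<^sup>+x. ennreal (w x) \<partial>M) = 0" using w(2) by (simp add: ennreal_neg)
    then have "AE x in M. w x = 0"
      using w(1) by (subst (asm) nn_integral_0_iff_AE) (auto elim!: eventually_mono intro: antisym)
    then have "(\<integral>x. w x * f x \<partial>M) = (\<integral>x. 0 \<partial>M)"
      by (intro integral_cong_AE) auto
    then show False using True by simp
  qed
  define a where "a = J / S"
  have a: "a > 0" using S \<open>J > 0\<close> by (simp add: a_def)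
  define A where "A = p * a powr (p - 1)"
  have A: "A \<ge> 0" using p by (simp add: A_def)
  \<comment> \<open>integrate the tangent inequality at the mean value \<open>a\<close> against the weight\<close>
  have "ennreal (p * a powr p * S) = ennreal (A * J)"
    using a S p by (simp add: A_def a_def powr_diff field_simps)
  also have "\<dots> = ennreal A * ennreal J" using A \<open>J > 0\<close> by (simp add: ennreal_mult)
  also have "\<dots> \<le> ennreal A * (\<integral>\<^sup>+x. norm (w x * f x) \<partial>M)"
    unfolding J_def using integral_norm_bound_ennreal[of M "\<lambda>x. w x * f x"] True
    by (intro mult_left_mono) simp_all
  also have "ennreal A * (\<integral>\<^sup>+x. norm (w x * f x) \<partial>M) = (\<integral>\<^sup>+x. ennreal (w x * (A * \<bar>f x\<bar>)) \<partial>M)"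
    using A w by (subst nn_integral_cmult[symmetric]) (auto simp: ennreal_mult'[symmetric] abs_mult mult_ac)
  also have "\<dots> \<le> (\<integral>\<^sup>+x. ennreal (w x * (\<bar>f x\<bar> powr p + (p - 1) * a powr p)) \<partial>M)"
    using powr_tangent[OF p, of a] a w unfolding A_def
    by (intro nn_integral_mono ennreal_leI mult_left_mono) auto
  also have "\<dots> = (\<integral>\<^sup>+x. ennreal (w x * \<bar>f x\<bar> powr p) + ennreal ((p - 1) * a powr p) * ennreal (w x) \<partial>M)"
  proof (intro nn_integral_cong)
    fix x
    have "w x * (\<bar>f x\<bar> powr p + (p - 1) * a powr p) = w x * \<bar>f x\<bar> powr p + ((p - 1) * a powr p) * w x"
      by (simp add: distrib_left mult.commute)
    then show "ennreal (w x * (\<bar>f x\<bar> powr p + (p - 1) * a powr p))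
        = ennreal (w x * \<bar>f x\<bar> powr p) + ennreal ((p - 1) * a powr p) * ennreal (w x)"
      using w(1)[of x] p by (simp add: ennreal_plus ennreal_mult)
  qed
  also have "\<dots> = (\<integral>\<^sup>+x. ennreal (w x * \<bar>f x\<bar> powr p) \<partial>M) + ennreal ((p - 1) * a powr p) * (\<integral>\<^sup>+x. ennreal (w x) \<partial>M)"
    by (simp add: nn_integral_add nn_integral_cmult)
  also have "\<dots> \<le> (\<integral>\<^sup>+x. ennreal (w x * \<bar>f x\<bar> powr p) \<partial>M) + ennreal ((p - 1) * a powr p * S)"
    using w p by (auto simp: ennreal_mult' intro!: add_left_mono mult_left_mono)
  finally have *: "ennreal (p * a powr p * S) \<le> (\<integral>\<^sup>+x. ennreal (w x * \<bar>f x\<bar> powr p) \<partial>M) + ennreal ((p - 1) * a powr p * S)" .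
  have "p * a powr p * S = a powr p * S + (p - 1) * a powr p * S" by (simp add: algebra_simps)
  then have "ennreal (p * a powr p * S) = ennreal (a powr p * S) + ennreal ((p - 1) * a powr p * S)"
    using p S by (simp add: ennreal_plus[symmetric] del: ennreal_plus)
  with * have **: "ennreal (a powr p * S) \<le> (\<integral>\<^sup>+x. ennreal (w x * \<bar>f x\<bar> powr p) \<partial>M)"
    by (simp add: ennreal_add_left_cancel_le add.commute)
  have "J powr p = S powr (p - 1) * (a powr p * S)"
    using S \<open>J > 0\<close> by (simp add: a_def powr_diff powr_divide)
  then have "ennreal (J powr p) = ennreal (S powr (p - 1)) * ennreal (a powr p * S)"
    using S by (simp add: ennreal_mult)
  also have "\<dots> \<le> ennreal (S powr (p - 1)) * (\<integral>\<^sup>+x. ennreal (w x * \<bar>f x\<bar> powr p) \<partial>M)"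
    using ** by (intro mult_left_mono) auto
  finally show ?thesis unfolding J_def .
qed

section \<open>Contractive kernels on Lebesgue spaces\<close>

text \<open>The \<open>p\<close>-th power of the \<open>L\<^sup>p\<close> norm, with values in \<open>[0,\<infinity>]\<close>.\<close>

definition moment :: "'a measure \<Rightarrow> real \<Rightarrow> ('a \<Rightarrow> real) \<Rightarrow> ennreal" where
  "moment M p f = (\<integral>\<^sup>+x. ennreal (\<bar>f x\<bar> powr p) \<partial>M)"

lemma moment_mono:
  assumes "0 \<le> p" "\<And>x. \<bar>f x\<bar> \<le> \<bar>g x\<bar>"
  shows "moment M p f \<le> moment M p g"
  unfolding moment_def using assms by (intro nn_integral_mono ennreal_leI powr_mono2) auto

lemma moment_abs [simp]: "moment M p (\<lambda>x. \<bar>f x\<bar>) = moment M p f"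
  by (simp add: moment_def)

lemma moment_cong_AE: "AE x in M. f x = g x \<Longrightarrow> moment M p f = moment M p g"
  unfolding moment_def by (intro nn_integral_cong_AE) auto

lemma moment_diff_le:
  assumes [measurable]: "f \<in> borel_measurable M" "g \<in> borel_measurable M" and p: "0 \<le> p"
  shows "moment M p (\<lambda>x. f x - g x) \<le> ennreal (2 powr p) * (moment M p f + moment M p g)"
proof -
  have "moment M p (\<lambda>x. f x - g x) \<le> (\<integral>\<^sup>+x. ennreal (2 powr p * (\<bar>f x\<bar> powr p + \<bar>g x\<bar> powr p)) \<partial>M)"
    unfolding moment_def by (intro nn_integral_mono ennreal_leI powr_abs_diff_le p)
  also have "\<dots> = (\<integral>\<^sup>+x. ennreal (2 powr p) * (ennreal (\<bar>f x\<bar> powr p) + ennreal (\<bar>g x\<bar> powr p)) \<partial>M)"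
    by (intro nn_integral_cong) (simp add: ennreal_mult)
  also have "\<dots> = ennreal (2 powr p) * (moment M p f + moment M p g)"
    unfolding moment_def by (subst nn_integral_cmult) (auto simp: nn_integral_add)
  finally show ?thesis .
qed

lemma moment_triangle:
  assumes [measurable]: "f \<in> borel_measurable M" "g \<in> borel_measurable M" "h \<in> borel_measurable M"
    and p: "0 \<le> p"
  shows "moment M p (\<lambda>x. f x - h x)
    \<le> ennreal (2 powr p) * (moment M p (\<lambda>x. f x - g x) + moment M p (\<lambda>x. g x - h x))"
proof -
  have eq: "(\<lambda>x. f x - h x) = (\<lambda>x. (f x - g x) - (h x - g x))" by auto
  have "moment M p (\<lambda>x. h x - g x) = moment M p (\<lambda>x. g x - h x)"
    unfolding moment_def by (simp add: abs_minus_commute)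
  then show ?thesis
    unfolding eq using moment_diff_le[of "\<lambda>x. f x - g x" M "\<lambda>x. h x - g x" p] p by simp
qed

text \<open>The bound on columns is stated by duality, as a contraction on non-negative functions in \<open>L\<^sup>1\<close>. In this form
it passes to mixtures of kernels by Tonelli's theorem, with no discussion of exceptional points.\<close>

locale contractive_kernel = sigma_finite_measure M for M :: "'a measure" +
  fixes k :: "'a \<Rightarrow> 'a \<Rightarrow> real" and B :: real
  assumes space_UNIV: "space M = UNIV"
    and kernel_measurable: "(\<lambda>(x, y). k x y) \<in> borel_measurable (M \<Otimes>\<^sub>M M)"
    and kernel_nonneg: "0 \<le> k x y"
    and kernel_le: "k x y \<le> B"
    and row_le: "(\<integral>\<^sup>+y. ennreal (k x y) \<partial>M) \<le> 1"
    and column_le: "g \<in> borel_measurable M \<Longrightarrow>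
      (\<integral>\<^sup>+x. \<integral>\<^sup>+y. ennreal (k x y) * g y \<partial>M \<partial>M) \<le> (\<integral>\<^sup>+y. g y \<partial>M)"

definition kernel_op :: "'a measure \<Rightarrow> ('a \<Rightarrow> 'a \<Rightarrow> real) \<Rightarrow> ('a \<Rightarrow> real) \<Rightarrow> 'a \<Rightarrow> real" where
  "kernel_op M k f x = (\<integral>y. k x y * f y \<partial>M)"

context contractive_kernel
begin

lemma kernel_row_measurable [measurable]: "k x \<in> borel_measurable M"
  using measurable_compose[OF measurable_Pair1' kernel_measurable, of x] by (simp add: space_UNIV)

lemma kernel_compose_measurable [measurable (raw)]:
  assumes "x \<in> N \<rightarrow>\<^sub>M M" "y \<in> N \<rightarrow>\<^sub>M M"
  shows "(\<lambda>w. k (x w) (y w)) \<in> borel_measurable N"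
  using measurable_compose[OF measurable_Pair[OF assms] kernel_measurable] by simp

lemma kernel_bound_nonneg: "0 \<le> B"
  using kernel_nonneg[of undefined undefined] kernel_le[of undefined undefined] by linarith

lemma kernel_op_measurable [measurable]:
  assumes [measurable]: "f \<in> borel_measurable M"
  shows "kernel_op M k f \<in> borel_measurable M"
  unfolding kernel_op_def by measurable

lemma row_powr_le:
  assumes [measurable]: "f \<in> borel_measurable M"
  shows "(\<integral>\<^sup>+y. ennreal (k x y * \<bar>f y\<bar> powr r) \<partial>M) \<le> ennreal B * moment M r f"
proof -
  have "(\<integral>\<^sup>+y. ennreal (k x y * \<bar>f y\<bar> powr r) \<partial>M) \<le> (\<integral>\<^sup>+y. ennreal B * ennreal (\<bar>f y\<bar> powr r) \<partial>M)"
    using kernel_le kernel_nonneg kernel_bound_nonneg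
    by (intro nn_integral_mono) (auto simp: ennreal_mult[symmetric] intro!: ennreal_leI mult_right_mono)
  also have "\<dots> = ennreal B * moment M r f"
    unfolding moment_def by (intro nn_integral_cmult) auto
  finally show ?thesis .
qed

lemma kernel_integrable:
  assumes [measurable]: "f \<in> borel_measurable M" and r: "1 \<le> r" and fin: "moment M r f < \<infinity>"
  shows "integrable M (\<lambda>y. k x y * f y)"
proof (rule integrableI_bounded)
  show "(\<lambda>y. k x y * f y) \<in> borel_measurable M" by measurable
  have le: "\<bar>t\<bar> \<le> 1 + \<bar>t\<bar> powr r" for t :: real
  proof (cases "\<bar>t\<bar> \<le> 1")
    case False
    then have "\<bar>t\<bar> powr 1 \<le> \<bar>t\<bar> powr r" using r by (intro powr_mono) auto
    then show ?thesis by simp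
  qed (use powr_ge_zero[of "\<bar>t\<bar>" r] in linarith)
  have "(\<integral>\<^sup>+y. ennreal (norm (k x y * f y)) \<partial>M)
      \<le> (\<integral>\<^sup>+y. ennreal (k x y) + ennreal (k x y * \<bar>f y\<bar> powr r) \<partial>M)"
  proof (intro nn_integral_mono)
    fix y
    have "k x y * \<bar>f y\<bar> \<le> k x y * (1 + \<bar>f y\<bar> powr r)"
      using le kernel_nonneg by (intro mult_left_mono) auto
    then show "ennreal (norm (k x y * f y)) \<le> ennreal (k x y) + ennreal (k x y * \<bar>f y\<bar> powr r)"
      using kernel_nonneg[of x y]
      by (simp add: ennreal_plus[symmetric] abs_mult algebra_simps ennreal_leI del: ennreal_plus)
  qed
  also have "\<dots> = (\<integral>\<^sup>+y. ennreal (k x y) \<partial>M) + (\<integral>\<^sup>+y. ennreal (k x y * \<bar>f y\<bar> powr r) \<partial>M)"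
    by (simp add: nn_integral_add)
  also have "\<dots> \<le> 1 + ennreal B * moment M r f"
    by (intro add_mono row_le row_powr_le) auto
  also have "\<dots> < \<infinity>"
    using fin by (simp add: ennreal_mult_less_top)
  finally show "(\<integral>\<^sup>+y. ennreal (norm (k x y * f y)) \<partial>M) < \<infinity>" .
qed

lemma kernel_op_diff:
  assumes [measurable]: "f \<in> borel_measurable M" "g \<in> borel_measurable M"
    and r: "1 \<le> r" and fin: "moment M r f < \<infinity>" "moment M r g < \<infinity>"
  shows "kernel_op M k (\<lambda>y. f y - g y) x = kernel_op M k f x - kernel_op M k g x"
  unfolding kernel_op_def using kernel_integrable[OF _ r] fin
  by (simp add: right_diff_distrib)

lemma kernel_op_abs_le: "\<bar>kernel_op M k f x\<bar> \<le> kernel_op M k (\<lambda>y. \<bar>f y\<bar>) x"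
proof -
  have "norm (\<integral>y. k x y * f y \<partial>M) \<le> (\<integral>y. norm (k x y * f y) \<partial>M)"
    by (rule integral_norm_bound)
  also have "\<dots> = (\<integral>y. k x y * \<bar>f y\<bar> \<partial>M)"
    using kernel_nonneg by (simp add: abs_mult)
  finally show ?thesis by (simp add: kernel_op_def)
qed

lemma kernel_op_jensen:
  assumes [measurable]: "f \<in> borel_measurable M" and r: "1 \<le> r"
  shows "ennreal (\<bar>kernel_op M k f x\<bar> powr r) \<le> (\<integral>\<^sup>+y. ennreal (k x y * \<bar>f y\<bar> powr r) \<partial>M)"
  unfolding kernel_op_def
  using weighted_jensen[of "k x" M f 1 r] kernel_nonneg row_le r by simp

lemma kernel_op_moment_le:
  assumes [measurable]: "f \<in> borel_measurable M" and r: "1 \<le> r"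
  shows "moment M r (kernel_op M k f) \<le> moment M r f"
proof -
  have "moment M r (kernel_op M k f) \<le> (\<integral>\<^sup>+x. \<integral>\<^sup>+y. ennreal (k x y) * ennreal (\<bar>f y\<bar> powr r) \<partial>M \<partial>M)"
    unfolding moment_def using kernel_op_jensen[OF assms]
    by (intro nn_integral_mono) (simp add: ennreal_mult kernel_nonneg)
  also have "\<dots> \<le> moment M r f" unfolding moment_def by (intro column_le) auto
  finally show ?thesis .
qed

lemma kernel_op_sup_le:
  assumes [measurable]: "f \<in> borel_measurable M" and r: "1 \<le> r"
  shows "ennreal (\<bar>kernel_op M k f x\<bar> powr r) \<le> ennreal B * moment M r f"
  using kernel_op_jensen[OF assms, of x] row_powr_le[of f x r] by (meson assms(1) order_trans)

lemma kernel_op_bounded: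
  assumes [measurable]: "f \<in> borel_measurable M" and C: "\<And>y. \<bar>f y\<bar> \<le> C"
  shows "\<bar>kernel_op M k f x\<bar> \<le> C"
proof -
  have C0: "0 \<le> C" using C[of undefined] by linarith
  have int: "integrable M (k x)"
    using row_le[of x] kernel_nonneg by (intro integrableI_bounded) (auto simp: less_top[symmetric] top_unique)
  have "(\<integral>y. k x y \<partial>M) \<le> 1"
    using row_le[of x] kernel_nonneg int by (simp add: nn_integral_eq_integral)
  have "\<bar>kernel_op M k f x\<bar> \<le> kernel_op M k (\<lambda>y. \<bar>f y\<bar>) x" by (rule kernel_op_abs_le)
  also have "\<dots> \<le> (\<integral>y. k x y * C \<partial>M)"
    unfolding kernel_op_def using int C kernel_nonneg C0
    by (intro integral_mono_AE' ) (auto intro!: mult_left_mono)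
  also have "\<dots> \<le> 1 * C" using \<open>(\<integral>y. k x y \<partial>M) \<le> 1\<close> C0
    using mult_right_mono[of "\<integral>y. k x y \<partial>M" 1 C] by simp
  finally show ?thesis by simp
qed

end

text \<open>\<open>L\<^sup>p\<close> lies between \<open>L\<^sup>r\<close> and \<open>L\<^sup>\<infinity>\<close>; kernels with bounded values map \<open>L\<^sup>r\<close> into both.\<close>

lemma moment_interpolate:
  assumes [measurable]: "h \<in> borel_measurable M" and p: "0 < r" "r \<le> p"
    and sup: "\<And>x. \<bar>h x\<bar> \<le> S"
  shows "moment M p h \<le> ennreal (S powr (p - r)) * moment M r h"
proof -
  have "moment M p h \<le> (\<integral>\<^sup>+x. ennreal (S powr (p - r)) * ennreal (\<bar>h x\<bar> powr r) \<partial>M)"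
    unfolding moment_def
  proof (intro nn_integral_mono)
    fix x
    have "\<bar>h x\<bar> powr p = \<bar>h x\<bar> powr (p - r) * \<bar>h x\<bar> powr r"
      by (cases "h x = 0") (simp_all add: powr_add[symmetric])
    also have "\<dots> \<le> S powr (p - r) * \<bar>h x\<bar> powr r"
      using sup p by (intro mult_right_mono powr_mono2) auto
    finally show "ennreal (\<bar>h x\<bar> powr p) \<le> ennreal (S powr (p - r)) * ennreal (\<bar>h x\<bar> powr r)"
      by (simp add: ennreal_mult[symmetric] ennreal_leI)
  qed
  also have "\<dots> = ennreal (S powr (p - r)) * moment M r h"
    unfolding moment_def by (intro nn_integral_cmult) auto
  finally show ?thesis .
qed

lemma (in contractive_kernel) kernel_op_sup_real:
  assumes [measurable]: "f \<in> borel_measurable M" and r: "1 \<le> r"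
    and N: "moment M r f \<le> ennreal N" "0 \<le> N"
  shows "\<bar>kernel_op M k f x\<bar> \<le> (B * N) powr (1 / r)"
proof -
  have "ennreal (\<bar>kernel_op M k f x\<bar> powr r) \<le> ennreal B * ennreal N"
    using kernel_op_sup_le[OF assms(1) r] N(1) by (meson mult_left_mono order_trans zero_le)
  then have "\<bar>kernel_op M k f x\<bar> powr r \<le> B * N"
    using kernel_bound_nonneg N by (simp add: ennreal_mult[symmetric])
  then have "(\<bar>kernel_op M k f x\<bar> powr r) powr (1 / r) \<le> (B * N) powr (1 / r)"
    using r by (intro powr_mono2) auto
  then show ?thesis using r by (simp add: powr_powr)
qed

lemma (in contractive_kernel) kernel_op_improves:
  assumes [measurable]: "f \<in> borel_measurable M" and r: "1 \<le> r" "r \<le> p"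
    and N: "moment M r f \<le> ennreal N" "0 \<le> N"
  shows "moment M p (kernel_op M k f) \<le> ennreal (B powr ((p - r) / r) * N powr (p / r))"
proof -
  have "moment M p (kernel_op M k f) \<le> ennreal (((B * N) powr (1 / r)) powr (p - r)) * moment M r (kernel_op M k f)"
    using r by (intro moment_interpolate kernel_op_sup_real[OF _ r(1) N]) auto
  also have "\<dots> \<le> ennreal (((B * N) powr (1 / r)) powr (p - r)) * ennreal N"
    using kernel_op_moment_le[OF assms(1) r(1)] N(1) by (intro mult_left_mono) (auto intro: order_trans)
  also have "\<dots> = ennreal (((B * N) powr (1 / r)) powr (p - r) * N)"
    using N by (simp add: ennreal_mult)
  also have "((B * N) powr (1 / r)) powr (p - r) * N = B powr ((p - r) / r) * N powr (p / r)"
  proof (cases "N = 0")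
    case False
    then have "N powr (p / r) = N powr ((p - r) / r) * N"
      using N r by (simp add: powr_mult_base' diff_divide_distrib powr_diff)
    then show ?thesis using N kernel_bound_nonneg by (simp add: powr_powr powr_mult)
  qed simp
  finally show ?thesis .
qed

section \<open>A Hardy inequality\<close>

lemma nn_integral_le_two_powers:
  fixes F :: "real \<Rightarrow> real"
  assumes c: "0 < c" and K: "0 \<le> K1" "0 \<le> K2" and a: "-1 < a" and e: "e < -1"
    and near: "\<And>x. 0 < x \<Longrightarrow> x \<le> c \<Longrightarrow> F x \<le> K1 * x powr a"
    and far: "\<And>x. c \<le> x \<Longrightarrow> F x \<le> K2 * x powr e"
  shows "(\<integral>\<^sup>+x\<in>{0<..}. ennreal (F x) \<partial>lborel)
    \<le> ennreal (K1 * (c powr (a + 1) / (a + 1)) + K2 * (- (c powr (e + 1)) / (e + 1)))"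
proof -
  have "(\<integral>\<^sup>+x\<in>{0<..}. ennreal (F x) \<partial>lborel)
    \<le> (\<integral>\<^sup>+x. ennreal K1 * (ennreal (x powr a) * indicator {0..c} x)
          + ennreal K2 * (ennreal (x powr e) * indicator {c..} x) \<partial>lborel)"
  proof (intro nn_integral_mono)
    fix x :: real
    show "ennreal (F x) * indicator {0<..} x \<le> ennreal K1 * (ennreal (x powr a) * indicator {0..c} x)
          + ennreal K2 * (ennreal (x powr e) * indicator {c..} x)"
    proof (cases "x \<le> 0")
      case False
      show ?thesis
      proof (cases "x \<le> c")
        case True
        then have "ennreal (F x) \<le> ennreal K1 * ennreal (x powr a)"
          using near[of x] False K by (simp add: ennreal_mult[symmetric] ennreal_leI)
        then show ?thesis using True False by (auto simp: indicator_def intro: order_trans)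
      next
        case F: False
        then have "ennreal (F x) \<le> ennreal K2 * ennreal (x powr e)"
          using far[of x] K by (simp add: ennreal_mult[symmetric] ennreal_leI)
        then show ?thesis using F False by (auto simp: indicator_def)
      qed
    qed (auto simp: indicator_def)
  qed
  also have "\<dots> = ennreal K1 * (\<integral>\<^sup>+x. ennreal (x powr a) * indicator {0..c} x \<partial>lborel)
      + ennreal K2 * (\<integral>\<^sup>+x. ennreal (x powr e) * indicator {c..} x \<partial>lborel)"
    by (simp add: nn_integral_add nn_integral_cmult)
  also have "(\<integral>\<^sup>+x. ennreal (x powr a) * indicator {0..c} x \<partial>lborel) = ennreal (c powr (a + 1) / (a + 1))"
    using a c by (intro nn_integral_has_integral_lebesgue' has_integral_powr_from_0) auto
  also have "(\<integral>\<^sup>+x. ennreal (x powr e) * indicator {c..} x \<partial>lborel) = ennreal (- (c powr (e + 1)) / (e + 1))"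
    using e c by (intro nn_integral_has_integral_lebesgue' has_integral_powr_to_inf) auto
  also have "ennreal K1 * ennreal (c powr (a + 1) / (a + 1)) + ennreal K2 * ennreal (- (c powr (e + 1)) / (e + 1))
    = ennreal (K1 * (c powr (a + 1) / (a + 1)) + K2 * (- (c powr (e + 1)) / (e + 1)))"
  proof -
    have "0 \<le> c powr (a + 1) / (a + 1)" "0 \<le> - (c powr (e + 1)) / (e + 1)"
      using a e by (auto intro!: divide_nonneg_neg)
    then show ?thesis using K by (metis ennreal_mult ennreal_plus mult_nonneg_nonneg)
  qed
  finally show ?thesis .
qed

text \<open>The weight equals \<open>max(u, t\<^sup>b)\<close> to the power \<open>1/p - 1\<close>.\<close>

definition hardy_mean :: "real \<Rightarrow> real \<Rightarrow> (real \<Rightarrow> real) \<Rightarrow> real \<Rightarrow> ennreal" where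
  "hardy_mean p b f t =
     (\<integral>\<^sup>+u\<in>{0<..}. ennreal (f u * min (u powr (1/p - 1)) (t powr (- b * (1 - 1/p)))) \<partial>lborel)"

text \<open>Schur's test. The integral of \<open>u\<close> to the power \<open>-1/r\<close> against the weight of the mean is a multiple of
\<open>t\<close> to the power \<open>-b (1/r - 1/p) = -1/q\<close>, so that Jensen's inequality and Tonelli's theorem reduce the claim to
\<open>\<integral> f\<^sup>q u\<^sup>q\<^sup>/\<^sup>r\<^sup>-\<^sup>1 du\<close>. As \<open>r \<le> q\<close>, the excess power of \<open>f u\<^sup>1\<^sup>/\<^sup>r\<close> is bounded by the weak type hypothesis,
and \<open>\<integral> f\<^sup>r du\<close> remains.\<close>

lemma hardy_inequality:
  fixes p q r b :: real
  assumes r: "1 < r" "r < p" "r \<le> q" and b: "0 < b" and q: "1 / q = b * (1 / r - 1 / p)"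
  shows "\<exists>C>0. \<forall>f N. f \<in> borel_measurable borel \<longrightarrow> (\<forall>u. 0 \<le> f u) \<longrightarrow> 0 \<le> N \<longrightarrow>
     (\<forall>u>0. f u powr r * u \<le> N) \<longrightarrow>
     (\<integral>\<^sup>+u\<in>{0<..}. ennreal (f u powr r) \<partial>lborel) \<le> ennreal N \<longrightarrow>
     (\<forall>t>0. hardy_mean p b f t < \<infinity>) \<and>
     (\<integral>\<^sup>+t\<in>{0<..}. ennreal (enn2real (hardy_mean p b f t) powr q) \<partial>lborel)
       \<le> ennreal (C * N powr (q / r))"
proof -
  define \<delta> where "\<delta> = 1 / r - 1 / p"
  have \<delta>: "0 < \<delta>" using r by (simp add: \<delta>_def field_simps)
  have q1: "1 < q" using r by simp
  have b\<delta>q: "b * \<delta> * q = 1" using q q1 by (simp add: \<delta>_def field_simps)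
  have r': "0 < 1 - 1 / r" "0 < 1 - 1 / p" using r by (auto simp: field_simps)
  define w where "w t u = min (u powr (1/p - 1)) (t powr (- b * (1 - 1/p)))" for t u :: real
  have w0: "0 \<le> w t u" for t u by (simp add: w_def)
  have w1: "w t u = u powr (1/p - 1)" if "0 < t" "0 < u" "t powr b \<le> u" for t u
  proof -
    have "u powr (1/p - 1) \<le> (t powr b) powr (1/p - 1)"
      using that r by (intro powr_mono2') (auto simp: field_simps)
    also have "\<dots> = t powr (- b * (1 - 1/p))" by (simp add: powr_powr algebra_simps)
    finally show ?thesis by (simp add: w_def)
  qed
  have w2: "w t u = t powr (- b * (1 - 1/p))" if "0 < t" "0 < u" "u \<le> t powr b" for t u
  proof -
    have "t powr (- b * (1 - 1/p)) = (t powr b) powr (1/p - 1)" by (simp add: powr_powr algebra_simps)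
    also have "\<dots> \<le> u powr (1/p - 1)"
      using that r by (intro powr_mono2') (auto simp: field_simps)
    finally show ?thesis by (simp add: w_def)
  qed
  have [measurable]: "(\<lambda>(t, u). w t u) \<in> borel_measurable (borel \<Otimes>\<^sub>M borel)"
    unfolding w_def by measurable
  define c1 where "c1 = 1 / (1 - 1/r) + 1 / \<delta>"
  have c1: "0 < c1" using r' \<delta> by (simp add: c1_def add_pos_pos)
  define c2 where "c2 = 1 / (b * \<delta>) + 1 / (b * (1 - 1/r))"
  have c2: "0 < c2" using r' \<delta> b by (simp add: c2_def add_pos_pos)
  \<comment> \<open>Schur test with the weight \<open>u\<close> to the power \<open>-1/r\<close>: the integral in \<open>u\<close>\<close>
  have Z: "(\<integral>\<^sup>+u\<in>{0<..}. ennreal (u powr (-1/r) * w t u) \<partial>lborel) \<le> ennreal (c1 * t powr (- b * \<delta>))"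
    if t: "0 < t" for t
  proof -
    have "(\<integral>\<^sup>+u\<in>{0<..}. ennreal (u powr (-1/r) * w t u) \<partial>lborel)
       \<le> ennreal (t powr (- b * (1 - 1/p)) * ((t powr b) powr (-1/r + 1) / (-1/r + 1))
           + 1 * (- ((t powr b) powr ((-1/r + (1/p - 1)) + 1)) / ((-1/r + (1/p - 1)) + 1)))"
    proof (rule nn_integral_le_two_powers)
      show "u powr (-1/r) * w t u \<le> t powr (- b * (1 - 1/p)) * u powr (-1/r)"
        if "0 < u" "u \<le> t powr b" for u
        using w2[OF t that] by (simp add: mult.commute)
      show "u powr (-1/r) * w t u \<le> 1 * u powr (-1/r + (1/p - 1))" if "t powr b \<le> u" for u
      proof -
        have "0 < u" using that t by (smt (verit) powr_gt_zero)
        then show ?thesis unfolding w1[OF t \<open>0 < u\<close> that] powr_add by (metis mult_1 order_refl)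
      qed
    qed (use t r r' \<delta> in \<open>auto simp: \<delta>_def\<close>)
    also have "t powr (- b * (1 - 1/p)) * ((t powr b) powr (-1/r + 1) / (-1/r + 1)) = t powr (- b * \<delta>) * (1 / (1 - 1/r))"
      using t by (simp add: powr_powr powr_add[symmetric] \<delta>_def algebra_simps)
    also have "1 * (- ((t powr b) powr ((-1/r + (1/p - 1)) + 1)) / ((-1/r + (1/p - 1)) + 1)) = t powr (- b * \<delta>) * (1 / \<delta>)"
    proof -
      have "(-1/r + (1/p - 1)) + 1 = - \<delta>" by (simp add: \<delta>_def)
      then show ?thesis by (simp add: powr_powr)
    qed
    finally show ?thesis by (simp add: c1_def algebra_simps)
  qed
  \<comment> \<open>the integral in \<open>t\<close>, split at \<open>t\<^sup>b = u\<close>\<close>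
  have Y: "(\<integral>\<^sup>+t\<in>{0<..}. ennreal ((c1 * t powr (- b * \<delta>)) powr (q - 1) * w t u) \<partial>lborel)
      \<le> ennreal (c1 powr (q - 1) * c2 * u powr (1/r - 1))" if u: "0 < u" for u
  proof -
    define \<tau> where "\<tau> = u powr (1/b)"
    have \<tau>: "0 < \<tau>" using u by (simp add: \<tau>_def)
    have \<tau>b: "\<tau> powr b = u" using u b by (simp add: \<tau>_def powr_powr)
    have pw: "(c1 * t powr (- b * \<delta>)) powr (q - 1) = c1 powr (q - 1) * t powr (b * \<delta> - 1)" if "0 < t" for t
    proof -
      have "- b * \<delta> * (q - 1) = b * \<delta> - 1" using b\<delta>q by (simp add: algebra_simps)
      then show ?thesis by (simp add: powr_mult powr_powr)
    qed
    have "(\<integral>\<^sup>+t\<in>{0<..}. ennreal ((c1 * t powr (- b * \<delta>)) powr (q - 1) * w t u) \<partial>lborel)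
       \<le> ennreal (c1 powr (q - 1) * u powr (1/p - 1) * (\<tau> powr (b * \<delta> - 1 + 1) / (b * \<delta> - 1 + 1))
           + c1 powr (q - 1) * (- (\<tau> powr ((-1 - b * (1 - 1/r)) + 1)) / ((-1 - b * (1 - 1/r)) + 1)))"
    proof (rule nn_integral_le_two_powers)
      show "(c1 * t powr (- b * \<delta>)) powr (q - 1) * w t u \<le> c1 powr (q - 1) * u powr (1/p - 1) * t powr (b * \<delta> - 1)"
        if "0 < t" "t \<le> \<tau>" for t
      proof -
        have "t powr b \<le> u" using that b \<tau>b by (metis powr_mono2 less_imp_le)
        then show ?thesis using w1[OF that(1) u] pw[OF that(1)] by simp
      qed
      show "(c1 * t powr (- b * \<delta>)) powr (q - 1) * w t u \<le> c1 powr (q - 1) * t powr (-1 - b * (1 - 1/r))"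
        if "\<tau> \<le> t" for t
      proof -
        have t: "0 < t" using that \<tau> by simp
        have "u \<le> t powr b" using that b \<tau>b \<tau> by (metis powr_mono2 less_imp_le)
        moreover have "b * \<delta> - 1 + - b * (1 - 1/p) = -1 - b * (1 - 1/r)" by (simp add: \<delta>_def algebra_simps)
        then have "t powr (b * \<delta> - 1) * t powr (- b * (1 - 1/p)) = t powr (-1 - b * (1 - 1/r))"
          by (metis powr_add)
        ultimately show ?thesis using w2[OF t u] pw[OF t] by (simp add: mult.assoc)
      qed
    qed (use b r r' \<delta> \<tau> in auto)
    also have "c1 powr (q - 1) * u powr (1/p - 1) * (\<tau> powr (b * \<delta> - 1 + 1) / (b * \<delta> - 1 + 1))
        = c1 powr (q - 1) * u powr (1/r - 1) * (1 / (b * \<delta>))"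
    proof -
      have "u powr (1/p - 1) * \<tau> powr (b * \<delta>) = u powr (1/r - 1)"
        using b by (simp add: \<tau>_def powr_powr powr_add[symmetric] \<delta>_def)
      then show ?thesis by (simp add: field_simps)
    qed
    also have "c1 powr (q - 1) * (- (\<tau> powr ((-1 - b * (1 - 1/r)) + 1)) / ((-1 - b * (1 - 1/r)) + 1))
        = c1 powr (q - 1) * u powr (1/r - 1) * (1 / (b * (1 - 1/r)))"
    proof -
      have e: "(-1 - b * (1 - 1/r)) + 1 = - (b * (1 - 1/r))" by simp
      have "\<tau> powr (- (b * (1 - 1/r))) = u powr (1/r - 1)"
        using b by (simp add: \<tau>_def powr_powr)
      then show ?thesis unfolding e by simp
    qed
    finally show ?thesis by (simp add: c2_def algebra_simps)
  qed
  show ?thesis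
  proof (intro exI[of _ "c1 powr (q - 1) * c2"] conjI allI impI)
    show "0 < c1 powr (q - 1) * c2" using c1 c2 by simp
  next
    fix f :: "real \<Rightarrow> real" and N :: real
    assume [measurable]: "f \<in> borel_measurable borel" and f0': "\<forall>u. 0 \<le> f u" and N0: "0 \<le> N"
      and weak': "\<forall>u>0. f u powr r * u \<le> N"
      and strong: "(\<integral>\<^sup>+u\<in>{0<..}. ennreal (f u powr r) \<partial>lborel) \<le> ennreal N"
    have f0: "0 \<le> f u" for u using f0' by simp
    have weak: "f u powr r * u \<le> N" if "0 < u" for u using weak' that by simp
    define \<Phi> where "\<Phi> t u = (c1 * t powr (- b * \<delta>)) powr (q - 1) * w t u" for t u
    define \<psi> where "\<psi> u = N powr (q/r - 1) * u powr (1 - 1/r) * f u powr r" for u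
    have [measurable]: "(\<lambda>(t, u). \<Phi> t u) \<in> borel_measurable (borel \<Otimes>\<^sub>M borel)" "\<psi> \<in> borel_measurable borel"
      unfolding \<Phi>_def \<psi>_def[abs_def] by measurable
    define G where "G t = (\<integral>\<^sup>+u\<in>{0<..}. ennreal (f u * w t u) \<partial>lborel)" for t
    have scale: "f u * u powr (1/r) \<le> N powr (1/r)" if "0 < u" for u
    proof -
      have "(f u powr r * u) powr (1/r) \<le> N powr (1/r)" using weak[OF that] that r by (intro powr_mono2) auto
      then show ?thesis using that f0 r by (simp add: powr_mult powr_powr)
    qed
    have cancel: "f u = u powr (-1/r) * (f u * u powr (1/r))" if "0 < u" for u
      using that by (simp add: powr_minus)
    have Gfin: "G t < \<infinity>" if t: "0 < t" for t
    proof -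
      have "G t \<le> (\<integral>\<^sup>+u. ennreal (N powr (1/r)) * (ennreal (u powr (-1/r) * w t u) * indicator {0<..} u) \<partial>lborel)"
        unfolding G_def
      proof (intro nn_integral_mono)
        fix u :: real
        show "ennreal (f u * w t u) * indicator {0<..} u \<le> ennreal (N powr (1/r)) * (ennreal (u powr (-1/r) * w t u) * indicator {0<..} u)"
        proof (cases "0 < u")
          case True
          have "f u * w t u = (f u * u powr (1/r)) * (u powr (-1/r) * w t u)"
            using cancel[OF True] by (metis mult.assoc mult.commute)
          also have "\<dots> \<le> N powr (1/r) * (u powr (-1/r) * w t u)"
            using scale[OF True] w0 by (intro mult_right_mono) auto
          finally show ?thesis using True by (simp add: ennreal_mult''[symmetric] w0 ennreal_leI)
        qed simp
      qed
      also have "\<dots> = ennreal (N powr (1/r)) * (\<integral>\<^sup>+u\<in>{0<..}. ennreal (u powr (-1/r) * w t u) \<partial>lborel)"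
        by (intro nn_integral_cmult) auto
      also have "\<dots> \<le> ennreal (N powr (1/r)) * ennreal (c1 * t powr (- b * \<delta>))"
        by (intro mult_left_mono Z t) auto
      also have "\<dots> < \<infinity>" by (simp add: ennreal_mult_less_top)
      finally show ?thesis .
    qed
    have Gq: "ennreal (enn2real (G t) powr q) \<le> (\<integral>\<^sup>+u. ennreal (\<Phi> t u) *
        (ennreal (\<psi> u) * indicator {0<..} u) \<partial>lborel)"
      if t: "0 < t" for t
    proof -
      let ?W = "\<lambda>u. u powr (-1/r) * w t u * indicator {0<..} u"
      let ?F = "\<lambda>u. f u * u powr (1/r)"
      have "enn2real (G t) = (\<integral>u. ?W u * ?F u \<partial>lborel)"
      proof -
        have "(\<integral>u. ?W u * ?F u \<partial>lborel) = enn2real (\<integral>\<^sup>+u. ennreal (?W u * ?F u) \<partial>lborel)"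
          using f0 w0 by (intro integral_eq_nn_integral) auto
        also have "(\<integral>\<^sup>+u. ennreal (?W u * ?F u) \<partial>lborel) = G t"
          unfolding G_def
        proof (intro nn_integral_cong)
          fix u :: real
          show "ennreal (?W u * ?F u) = ennreal (f u * w t u) * indicator {0<..} u"
            using cancel[of u] by (cases "0 < u") (auto simp: mult_ac)
        qed
        finally show ?thesis ..
      qed
      then have "ennreal (enn2real (G t) powr q) = ennreal (\<bar>\<integral>u. ?W u * ?F u \<partial>lborel\<bar> powr q)" by (metis abs_of_nonneg enn2real_nonneg)
      also have "\<dots> \<le> ennreal ((c1 * t powr (- b * \<delta>)) powr (q - 1)) * (\<integral>\<^sup>+u. ennreal (?W u * \<bar>?F u\<bar> powr q) \<partial>lborel)"
      proof (rule weighted_jensen)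
        have "(\<integral>\<^sup>+u. ennreal (?W u) \<partial>lborel) = (\<integral>\<^sup>+u. ennreal (u powr (-1/r) * w t u) * indicator {0<..} u \<partial>lborel)"
          by (intro nn_integral_cong) (simp add: indicator_def)
        then show "(\<integral>\<^sup>+u. ennreal (?W u) \<partial>lborel) \<le> ennreal (c1 * t powr (- b * \<delta>))" using Z[OF t] by simp
      qed (use w0 q1 in auto)
      also have "\<dots> = (\<integral>\<^sup>+u. ennreal ((c1 * t powr (- b * \<delta>)) powr (q - 1)) * ennreal (?W u * \<bar>?F u\<bar> powr q) \<partial>lborel)"
        by (intro nn_integral_cmult[symmetric]) auto
      also have "\<dots> \<le> (\<integral>\<^sup>+u. ennreal (\<Phi> t u) *
        (ennreal (\<psi> u) * indicator {0<..} u) \<partial>lborel)"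
      proof (intro nn_integral_mono)
        fix u :: real
        show "ennreal ((c1 * t powr (- b * \<delta>)) powr (q - 1)) * ennreal (?W u * \<bar>?F u\<bar> powr q)
          \<le> ennreal (\<Phi> t u) *
        (ennreal (\<psi> u) * indicator {0<..} u)"
        proof (cases "0 < u")
          case True
          have "?F u powr q = ?F u powr (q - r) * ?F u powr r" by (simp add: powr_add[symmetric])
          also have "\<dots> \<le> (N powr (1/r)) powr (q - r) * ?F u powr r"
            using scale[OF True] f0 r by (intro mult_right_mono powr_mono2) auto
          also have "(N powr (1/r)) powr (q - r) = N powr (q/r - 1)"
            using r by (simp add: powr_powr diff_divide_distrib)
          also have "?F u powr r = f u powr r * u"
            using True r f0 by (simp add: powr_mult powr_powr)
          finally have 1: "?F u powr q \<le> N powr (q/r - 1) * (f u powr r * u)" .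
          have "?W u * \<bar>?F u\<bar> powr q = w t u * (u powr (-1/r) * ?F u powr q)"
            using True f0 by (simp add: mult_ac)
          also have "\<dots> \<le> w t u * (u powr (-1/r) * (N powr (q/r - 1) * (f u powr r * u)))"
            using 1 w0 by (intro mult_left_mono) auto
          also have "\<dots> = w t u * (N powr (q/r - 1) * (u powr (-1/r) * u) * f u powr r)" by (simp add: mult_ac)
          also have "u powr (-1/r) * u = u powr (1 - 1/r)" using True by (simp add: powr_diff powr_minus divide_inverse mult.commute)
          finally have 2: "?W u * \<bar>?F u\<bar> powr q \<le> w t u * (N powr (q/r - 1) * u powr (1 - 1/r) * f u powr r)" .
          have "(c1 * t powr (- b * \<delta>)) powr (q - 1) * (?W u * \<bar>?F u\<bar> powr q)
             \<le> (c1 * t powr (- b * \<delta>)) powr (q - 1) * (w t u * (N powr (q/r - 1) * u powr (1 - 1/r) * f u powr r))"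
            using 2 by (intro mult_left_mono) auto
          then show ?thesis using True w0
            by (simp add: \<Phi>_def \<psi>_def ennreal_mult[symmetric] ennreal_leI mult_ac)
        qed simp
      qed
      finally show ?thesis .
    qed
    have "(\<integral>\<^sup>+t\<in>{0<..}. ennreal (enn2real (G t) powr q) \<partial>lborel)
      \<le> (\<integral>\<^sup>+t. \<integral>\<^sup>+u. (ennreal (\<Phi> t u) * indicator {0<..} t) *
        (ennreal (\<psi> u) * indicator {0<..} u) \<partial>lborel \<partial>lborel)"
    proof (intro nn_integral_mono)
      fix t :: real
      show "ennreal (enn2real (G t) powr q) * indicator {0<..} t
        \<le> (\<integral>\<^sup>+u. (ennreal (\<Phi> t u) * indicator {0<..} t) *
        (ennreal (\<psi> u) * indicator {0<..} u) \<partial>lborel)"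
        using Gq[of t] by (cases "0 < t") simp_all
    qed
    also have "\<dots> = (\<integral>\<^sup>+u. \<integral>\<^sup>+t. (ennreal (\<Phi> t u) * indicator {0<..} t) *
        (ennreal (\<psi> u) * indicator {0<..} u) \<partial>lborel \<partial>lborel)"
      by (rule lborel_pair.Fubini') measurable
    also have "\<dots> = (\<integral>\<^sup>+u. (\<integral>\<^sup>+t\<in>{0<..}. ennreal (\<Phi> t u) \<partial>lborel) *
        (ennreal (\<psi> u) * indicator {0<..} u) \<partial>lborel)"
      by (intro nn_integral_cong nn_integral_multc) measurable
    also have "\<dots> \<le> (\<integral>\<^sup>+u. ennreal (c1 powr (q - 1) * c2 * N powr (q/r - 1)) * (ennreal (f u powr r) * indicator {0<..} u) \<partial>lborel)"
    proof (intro nn_integral_mono)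
      fix u :: real
      show "(\<integral>\<^sup>+t\<in>{0<..}. ennreal (\<Phi> t u) \<partial>lborel) *
        (ennreal (\<psi> u) * indicator {0<..} u)
        \<le> ennreal (c1 powr (q - 1) * c2 * N powr (q/r - 1)) * (ennreal (f u powr r) * indicator {0<..} u)"
      proof (cases "0 < u")
        case True
        have "(\<integral>\<^sup>+t\<in>{0<..}. ennreal (\<Phi> t u) \<partial>lborel) *
          ennreal (\<psi> u)
          \<le> ennreal (c1 powr (q - 1) * c2 * u powr (1/r - 1)) * ennreal (\<psi> u)"
          unfolding \<Phi>_def by (intro mult_right_mono Y True) auto
        also have "\<dots> = ennreal (c1 powr (q - 1) * c2 * N powr (q/r - 1) * (u powr (1/r - 1) * u powr (1 - 1/r)) * f u powr r)"
          using c2 by (simp add: \<psi>_def ennreal_mult[symmetric] mult_ac)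
        also have "u powr (1/r - 1) * u powr (1 - 1/r) = 1"
          using True by (simp add: powr_add[symmetric])
        finally show ?thesis using True c2 by (simp add: ennreal_mult)
      qed simp
    qed
    also have "\<dots> = ennreal (c1 powr (q - 1) * c2 * N powr (q/r - 1)) * (\<integral>\<^sup>+u\<in>{0<..}. ennreal (f u powr r) \<partial>lborel)"
      by (intro nn_integral_cmult) auto
    also have "\<dots> \<le> ennreal (c1 powr (q - 1) * c2 * N powr (q/r - 1)) * ennreal N"
      by (intro mult_left_mono strong) auto
    also have "\<dots> = ennreal (c1 powr (q - 1) * c2 * (N powr (q/r - 1) * N))"
      using c2 N0 by (simp add: ennreal_mult[symmetric] mult_ac)
    also have "N powr (q/r - 1) * N = N powr (q/r)"
      using N0 r by (cases "N = 0") (simp_all add: powr_diff)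
    finally show "(\<integral>\<^sup>+t\<in>{0<..}. ennreal (enn2real (hardy_mean p b f t) powr q) \<partial>lborel)
        \<le> ennreal (c1 powr (q - 1) * c2 * N powr (q / r))"
      unfolding G_def w_def hardy_mean_def .
    show "hardy_mean p b f t < \<infinity>" if "0 < t" for t
      using Gfin[OF that] unfolding G_def w_def hardy_mean_def .
  qed
qed

section \<open>Decreasing rearrangement\<close>

definition superlevel :: "'a measure \<Rightarrow> ('a \<Rightarrow> real) \<Rightarrow> real \<Rightarrow> ennreal" where
  "superlevel M g l = emeasure M {x \<in> space M. l < \<bar>g x\<bar>}"

text \<open>This set is an interval with left end point 0; its length is the value at \<open>u\<close> of the decreasing
rearrangement of \<open>g\<close>.\<close>

definition exceeding :: "'a measure \<Rightarrow> ('a \<Rightarrow> real) \<Rightarrow> real \<Rightarrow> real set" where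
  "exceeding M g u = {l. 0 < l \<and> ennreal u < superlevel M g l}"

definition rearrangement :: "'a measure \<Rightarrow> ('a \<Rightarrow> real) \<Rightarrow> real \<Rightarrow> real" where
  "rearrangement M g u = enn2real (emeasure lborel (exceeding M g u))"

lemma superlevel_antimono:
  assumes [measurable]: "g \<in> borel_measurable M" and "l \<le> l'"
  shows "superlevel M g l' \<le> superlevel M g l"
  unfolding superlevel_def using assms(2) by (intro emeasure_mono) auto

lemma (in sigma_finite_measure) superlevel_measurable [measurable]:
  assumes [measurable]: "g \<in> borel_measurable M"
  shows "superlevel M g \<in> borel_measurable borel"
proof -
  have "(\<lambda>l. \<integral>\<^sup>+x. (if l < \<bar>g x\<bar> then 1 else 0) \<partial>M) \<in> borel_measurable borel"
    by measurable
  also have "(\<lambda>l. \<integral>\<^sup>+x. (if l < \<bar>g x\<bar> then 1 else 0) \<partial>M) = superlevel M g"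
  proof
    fix l
    have "(\<integral>\<^sup>+x. (if l < \<bar>g x\<bar> then 1 else 0) \<partial>M) = (\<integral>\<^sup>+x. indicator {x \<in> space M. l < \<bar>g x\<bar>} x \<partial>M)"
      by (intro nn_integral_cong) (simp add: indicator_def)
    then show "(\<integral>\<^sup>+x. (if l < \<bar>g x\<bar> then 1 else 0) \<partial>M) = superlevel M g l"
      by (simp add: superlevel_def)
  qed
  finally show ?thesis .
qed

lemma superlevel_chebyshev:
  assumes [measurable]: "g \<in> borel_measurable M" and "0 < l" "0 < r"
  shows "ennreal (l powr r) * superlevel M g l \<le> moment M r g"
proof -
  have "ennreal (l powr r) * superlevel M g l
      = (\<integral>\<^sup>+x. ennreal (l powr r) * indicator {x \<in> space M. l < \<bar>g x\<bar>} x \<partial>M)"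
    unfolding superlevel_def by (subst nn_integral_cmult_indicator) auto
  also have "\<dots> \<le> moment M r g"
    unfolding moment_def using assms(2,3)
    by (intro nn_integral_mono) (auto simp: indicator_def intro!: ennreal_leI powr_mono2)
  finally show ?thesis .
qed

lemma nn_integral_powr_deriv:
  assumes "0 < r" "0 \<le> c"
  shows "(\<integral>\<^sup>+l. ennreal (r * l powr (r - 1)) * indicator {0<..<c} l \<partial>lborel) = ennreal (c powr r)"
proof -
  have "((\<lambda>l. r * l powr (r - 1)) has_integral r * (c powr (r - 1 + 1) / (r - 1 + 1))) {0..c}"
    using assms by (intro has_integral_mult_right has_integral_powr_from_0) auto
  then have "(\<integral>\<^sup>+l. ennreal (r * l powr (r - 1)) * indicator {0..c} l \<partial>lborel) = ennreal (c powr r)"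
    using assms by (subst nn_integral_has_integral_lebesgue') auto
  moreover have "(\<integral>\<^sup>+l. ennreal (r * l powr (r - 1)) * indicator {0<..<c} l \<partial>lborel)
     = (\<integral>\<^sup>+l. ennreal (r * l powr (r - 1)) * indicator {0..c} l \<partial>lborel)"
  proof (intro nn_integral_cong_AE)
    show "AE l in lborel. ennreal (r * l powr (r - 1)) * indicator {0<..<c} l = ennreal (r * l powr (r - 1)) * indicator {0..c} l"
      using AE_lborel_singleton[of 0] AE_lborel_singleton[of c]
      by eventually_elim (auto simp: indicator_def)
  qed
  ultimately show ?thesis by simp
qed

lemma (in sigma_finite_measure) layer_cake_powr:
  assumes [measurable]: "g \<in> borel_measurable M" and r: "0 < r"
  shows "(\<integral>\<^sup>+l\<in>{0<..}. ennreal (r * l powr (r - 1)) * superlevel M g l \<partial>lborel) = moment M r g"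
proof -
  interpret pair_sigma_finite lborel M ..
  have "(\<integral>\<^sup>+l\<in>{0<..}. ennreal (r * l powr (r - 1)) * superlevel M g l \<partial>lborel)
    = (\<integral>\<^sup>+l. \<integral>\<^sup>+x. ennreal (r * l powr (r - 1)) * indicator {0<..<\<bar>g x\<bar>} l \<partial>M \<partial>lborel)"
  proof (intro nn_integral_cong)
    fix l :: real
    have "(\<integral>\<^sup>+x. ennreal (r * l powr (r - 1)) * indicator {0<..<\<bar>g x\<bar>} l \<partial>M)
       = (\<integral>\<^sup>+x. (ennreal (r * l powr (r - 1)) * indicator {0<..} l) * indicator {x \<in> space M. l < \<bar>g x\<bar>} x \<partial>M)"
      by (intro nn_integral_cong) (auto simp: indicator_def)
    also have "\<dots> = (ennreal (r * l powr (r - 1)) * indicator {0<..} l) * superlevel M g l"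
      unfolding superlevel_def by (subst nn_integral_cmult_indicator) auto
    finally show "ennreal (r * l powr (r - 1)) * superlevel M g l * indicator {0<..} l
      = (\<integral>\<^sup>+x. ennreal (r * l powr (r - 1)) * indicator {0<..<\<bar>g x\<bar>} l \<partial>M)" by (simp add: mult_ac)
  qed
  also have "\<dots> = (\<integral>\<^sup>+x. \<integral>\<^sup>+l. ennreal (r * l powr (r - 1)) * indicator {0<..<\<bar>g x\<bar>} l \<partial>lborel \<partial>M)"
  proof (rule Fubini'[symmetric])
    have "(\<lambda>(l, x). ennreal (r * l powr (r - 1)) * (if 0 < l \<and> l < \<bar>g x\<bar> then 1 else 0)) \<in> borel_measurable (lborel \<Otimes>\<^sub>M M)"
      by measurable
    then show "(\<lambda>(l, x). ennreal (r * l powr (r - 1)) * indicator {0<..<\<bar>g x\<bar>} l) \<in> borel_measurable (lborel \<Otimes>\<^sub>M M)"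
      by (simp add: indicator_def)
  qed
  also have "\<dots> = moment M r g"
    unfolding moment_def
  proof (intro nn_integral_cong)
    fix x
    show "(\<integral>\<^sup>+l. ennreal (r * l powr (r - 1)) * indicator {0<..<\<bar>g x\<bar>} l \<partial>lborel) = ennreal (\<bar>g x\<bar> powr r)"
      by (rule nn_integral_powr_deriv) (use r in auto)
  qed
  finally show ?thesis .
qed

lemma rearrangement_set_measurable [measurable]:
  assumes "superlevel M g \<in> borel_measurable borel"
  shows "exceeding M g u \<in> sets borel"
proof -
  note [measurable] = assms
  have "{l \<in> space borel. 0 < l \<and> ennreal u < superlevel M g l} \<in> sets borel" by measurable
  then show ?thesis by (simp add: exceeding_def)
qed

lemma (in sigma_finite_measure) rearrangement_measurable [measurable]:
  assumes [measurable]: "g \<in> borel_measurable M"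
  shows "rearrangement M g \<in> borel_measurable borel"
proof -
  have "(\<lambda>u. enn2real (\<integral>\<^sup>+l. (if 0 < l \<and> ennreal u < superlevel M g l then 1 else 0) \<partial>lborel)) \<in> borel_measurable borel"
    by measurable
  also have "(\<lambda>u. enn2real (\<integral>\<^sup>+l. (if 0 < l \<and> ennreal u < superlevel M g l then 1 else 0) \<partial>lborel)) = rearrangement M g"
  proof
    fix u
    have "(\<integral>\<^sup>+l. (if 0 < l \<and> ennreal u < superlevel M g l then 1 else 0) \<partial>lborel)
       = (\<integral>\<^sup>+l. indicator (exceeding M g u) l \<partial>lborel)"
      by (intro nn_integral_cong) (simp add: indicator_def exceeding_def)
    then show "enn2real (\<integral>\<^sup>+l. (if 0 < l \<and> ennreal u < superlevel M g l then 1 else 0) \<partial>lborel) = rearrangement M g u"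
      by (simp add: rearrangement_def)
  qed
  finally show ?thesis .
qed

lemma rearrangement_nonneg: "0 \<le> rearrangement M g u"
  by (simp add: rearrangement_def)

context
  fixes M :: "'a measure" and g :: "'a \<Rightarrow> real" and r N :: real
  assumes sf: "sigma_finite_measure M"
    and g [measurable]: "g \<in> borel_measurable M" and r: "1 \<le> r"
    and N: "0 \<le> N" "moment M r g \<le> ennreal N"
begin

interpretation sigma_finite_measure M by (rule sf)

lemma superlevel_finite: "0 < l \<Longrightarrow> superlevel M g l < \<infinity>"
proof -
  assume l: "0 < l"
  have "ennreal (l powr r) * superlevel M g l \<le> ennreal N"
    using superlevel_chebyshev[OF g l, of r] r N by (auto intro: order_trans)
  then have "ennreal (l powr r) * superlevel M g l < \<infinity>"
    by (auto simp: less_top[symmetric] top_unique)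
  then show ?thesis using l by (auto simp: ennreal_mult_less_top)
qed

lemma rearrangement_subset:
  assumes u: "0 < u"
  shows "exceeding M g u \<subseteq> {0..(N / u) powr (1 / r)}"
proof
  fix l assume "l \<in> exceeding M g u"
  then have l: "0 < l" and ul: "ennreal u < superlevel M g l" by (simp_all add: exceeding_def)
  have "ennreal (l powr r * u) = ennreal (l powr r) * ennreal u" using u by (simp add: ennreal_mult)
  also have "\<dots> \<le> ennreal (l powr r) * superlevel M g l" using ul by (intro mult_left_mono) auto
  also have "\<dots> \<le> ennreal N"
    using superlevel_chebyshev[OF g l, of r] r N by (auto intro: order_trans)
  finally have "l powr r * u \<le> N" using N by simp
  then have "l powr r \<le> N / u" using u by (simp add: field_simps)
  then have "(l powr r) powr (1 / r) \<le> (N / u) powr (1 / r)" using r by (intro powr_mono2) auto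
  then show "l \<in> {0..(N / u) powr (1 / r)}" using l r by (simp add: powr_powr)
qed

lemma emeasure_rearrangement_set:
  assumes u: "0 < u"
  shows "emeasure lborel (exceeding M g u) = ennreal (rearrangement M g u)"
    and "rearrangement M g u \<le> (N / u) powr (1 / r)"
proof -
  have le: "emeasure lborel (exceeding M g u) \<le> ennreal ((N / u) powr (1 / r))"
    using emeasure_mono[OF rearrangement_subset[OF u], of lborel] by simp
  then have "emeasure lborel (exceeding M g u) < \<infinity>"
    by (auto simp: less_top[symmetric] top_unique)
  then show *: "emeasure lborel (exceeding M g u) = ennreal (rearrangement M g u)"
    by (simp add: rearrangement_def)
  show "rearrangement M g u \<le> (N / u) powr (1 / r)" using le unfolding * by simp
qed

text \<open>Chebyshev's inequality, read for the rearrangement.\<close>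

lemma rearrangement_weak:
  assumes u: "0 < u"
  shows "rearrangement M g u powr r * u \<le> N"
proof -
  have "rearrangement M g u powr r \<le> ((N / u) powr (1 / r)) powr r"
    using emeasure_rearrangement_set(2)[OF u] r by (intro powr_mono2) (auto simp: rearrangement_nonneg)
  also have "\<dots> = N / u" using r N u by (simp add: powr_powr)
  finally show ?thesis using u by (simp add: field_simps)
qed

lemma rearrangement_lower:
  assumes u: "0 < u" and l: "0 < l" "l < rearrangement M g u"
  shows "ennreal u < superlevel M g l"
proof (rule ccontr)
  assume n: "\<not> ennreal u < superlevel M g l"
  have "exceeding M g u \<subseteq> {0..l}"
  proof
    fix l' assume "l' \<in> exceeding M g u"
    then have "0 < l'" "ennreal u < superlevel M g l'" by (simp_all add: exceeding_def)
    then have "superlevel M g l < superlevel M g l'" using n by (auto simp: not_less)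
    then have "l' \<le> l" using superlevel_antimono[OF g, of l l'] by (metis leD linear)
    then show "l' \<in> {0..l}" using \<open>0 < l'\<close> by simp
  qed
  from emeasure_mono[OF this, of lborel] have "ennreal (rearrangement M g u) \<le> ennreal l"
    using l by (simp add: emeasure_rearrangement_set(1)[OF u])
  then show False using l by simp
qed

lemma nn_integral_below_superlevel:
  "emeasure lborel {u. 0 < u \<and> ennreal u < superlevel M g l} \<le> superlevel M g l"
proof (cases "superlevel M g l")
  case (real c)
  have "{u. 0 < u \<and> ennreal u < superlevel M g l} = {0<..<c}" using real by (auto simp: ennreal_less_iff)
  then show ?thesis using real by simp
qed simp

text \<open>Equimeasurability: the \<open>r\<close>-th power of the rearrangement at \<open>u\<close> is at most the integral of \<open>r l\<^sup>r\<^sup>-\<^sup>1\<close>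
over the levels \<open>l\<close> exceeding \<open>u\<close>, and exchanging the integrals in \<open>u\<close> and \<open>l\<close> gives the layer cake formula of \<open>g\<close>.\<close>

lemma rearrangement_moment:
  "(\<integral>\<^sup>+u\<in>{0<..}. ennreal (rearrangement M g u powr r) \<partial>lborel) \<le> ennreal N"
proof -
  have [measurable]: "(\<lambda>(u, l). indicator {u. 0 < u \<and> ennreal u < superlevel M g l} u :: ennreal) \<in> borel_measurable (borel \<Otimes>\<^sub>M borel)"
  proof -
    have "(\<lambda>(u, l). (if 0 < u \<and> ennreal u < superlevel M g l then 1 else 0) :: ennreal) \<in> borel_measurable (borel \<Otimes>\<^sub>M borel)"
      by measurable
    then show ?thesis by (simp add: indicator_def)
  qed
  have "(\<integral>\<^sup>+u\<in>{0<..}. ennreal (rearrangement M g u powr r) \<partial>lborel)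
    \<le> (\<integral>\<^sup>+u. \<integral>\<^sup>+l. (ennreal (r * l powr (r - 1)) * indicator {0<..} l) * indicator {u. 0 < u \<and> ennreal u < superlevel M g l} u \<partial>lborel \<partial>lborel)"
  proof (intro nn_integral_mono)
    fix u :: real
    show "ennreal (rearrangement M g u powr r) * indicator {0<..} u
      \<le> (\<integral>\<^sup>+l. (ennreal (r * l powr (r - 1)) * indicator {0<..} l) * indicator {u. 0 < u \<and> ennreal u < superlevel M g l} u \<partial>lborel)"
    proof (cases "0 < u")
      case True
      have "ennreal (rearrangement M g u powr r) = (\<integral>\<^sup>+l. ennreal (r * l powr (r - 1)) * indicator {0<..<rearrangement M g u} l \<partial>lborel)"
        using r by (intro nn_integral_powr_deriv[symmetric]) (auto simp: rearrangement_nonneg)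
      also have "\<dots> \<le> (\<integral>\<^sup>+l. (ennreal (r * l powr (r - 1)) * indicator {0<..} l) * indicator {u. 0 < u \<and> ennreal u < superlevel M g l} u \<partial>lborel)"
        using True rearrangement_lower[OF True] by (intro nn_integral_mono) (auto simp: indicator_def)
      finally show ?thesis using True by simp
    qed simp
  qed
  also have "\<dots> = (\<integral>\<^sup>+l. \<integral>\<^sup>+u. (ennreal (r * l powr (r - 1)) * indicator {0<..} l) * indicator {u. 0 < u \<and> ennreal u < superlevel M g l} u \<partial>lborel \<partial>lborel)"
    by (rule lborel_pair.Fubini') measurable
  also have "\<dots> \<le> (\<integral>\<^sup>+l. (ennreal (r * l powr (r - 1)) * indicator {0<..} l) * superlevel M g l \<partial>lborel)"
    by (intro nn_integral_mono, subst nn_integral_cmult)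
      (auto intro!: mult_left_mono nn_integral_below_superlevel)
  also have "\<dots> = moment M r g"
    using layer_cake_powr[OF g, of r] r by (simp add: mult_ac)
  finally show ?thesis using N by simp
qed

end

section \<open>Smoothing estimate for one kernel\<close>

definition level :: "('a \<Rightarrow> real) \<Rightarrow> real \<Rightarrow> 'a \<Rightarrow> real" where
  "level g l y = (if l < \<bar>g y\<bar> then 1 else 0)"

lemma level_measurable [measurable (raw)]:
  assumes [measurable]: "g \<in> borel_measurable M" "l \<in> borel_measurable N" "y \<in> N \<rightarrow>\<^sub>M M"
  shows "(\<lambda>w. level g (l w) (y w)) \<in> borel_measurable N"
  unfolding level_def by measurable

lemma (in contractive_kernel) kernel_op_layer_cake:
  assumes [measurable]: "g \<in> borel_measurable M"
  shows "kernel_op M k (\<lambda>y. \<bar>g y\<bar>) x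
    = (\<integral>l. kernel_op M k (level g l) x * indicator {0<..} l \<partial>lborel)"
proof -
  interpret P: pair_sigma_finite lborel M ..
  have meas: "(\<lambda>(l, y). ennreal (k x y) * (if 0 < l \<and> l < \<bar>g y\<bar> then 1 else 0)) \<in> borel_measurable (lborel \<Otimes>\<^sub>M M)"
    by measurable
  have "kernel_op M k (\<lambda>y. \<bar>g y\<bar>) x = enn2real (\<integral>\<^sup>+y. ennreal (k x y * \<bar>g y\<bar>) \<partial>M)"
    unfolding kernel_op_def using kernel_nonneg by (intro integral_eq_nn_integral) auto
  also have "(\<integral>\<^sup>+y. ennreal (k x y * \<bar>g y\<bar>) \<partial>M)
      = (\<integral>\<^sup>+y. \<integral>\<^sup>+l. ennreal (k x y) * (if 0 < l \<and> l < \<bar>g y\<bar> then 1 else 0) \<partial>lborel \<partial>M)"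
  proof (intro nn_integral_cong)
    fix y
    have "(\<integral>\<^sup>+l. ennreal (k x y) * (if 0 < l \<and> l < \<bar>g y\<bar> then 1 else 0) \<partial>lborel)
        = (\<integral>\<^sup>+l. ennreal (k x y) * indicator {0<..<\<bar>g y\<bar>} l \<partial>lborel)"
      by (intro nn_integral_cong) (simp add: indicator_def)
    then show "ennreal (k x y * \<bar>g y\<bar>) = (\<integral>\<^sup>+l. ennreal (k x y) * (if 0 < l \<and> l < \<bar>g y\<bar> then 1 else 0) \<partial>lborel)"
      using kernel_nonneg by (simp add: nn_integral_cmult_indicator ennreal_mult)
  qed
  also have "\<dots> = (\<integral>\<^sup>+l. \<integral>\<^sup>+y. ennreal (k x y) * (if 0 < l \<and> l < \<bar>g y\<bar> then 1 else 0) \<partial>M \<partial>lborel)"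
    by (rule P.Fubini'[OF meas])
  also have "\<dots> = (\<integral>\<^sup>+l. ennreal (kernel_op M k (level g l) x * indicator {0<..} l) \<partial>lborel)"
  proof (intro nn_integral_cong)
    fix l :: real
    have int: "integrable M (\<lambda>y. k x y * level g l y)"
    proof (rule integrableI_bounded)
      have "(\<integral>\<^sup>+y. ennreal (norm (k x y * level g l y)) \<partial>M) \<le> (\<integral>\<^sup>+y. ennreal (k x y) \<partial>M)"
        using kernel_nonneg by (intro nn_integral_mono) (auto simp: level_def)
      also have "\<dots> < \<infinity>" using row_le[of x] by (auto simp: less_top[symmetric] top_unique)
      finally show "(\<integral>\<^sup>+y. ennreal (norm (k x y * level g l y)) \<partial>M) < \<infinity>" .
    qed measurable
    have "ennreal (kernel_op M k (level g l) x)
       = (\<integral>\<^sup>+y. ennreal (k x y * level g l y) \<partial>M)"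
      unfolding kernel_op_def using kernel_nonneg by (intro nn_integral_eq_integral[symmetric] int) (auto simp: level_def)
    also have "\<dots> = (\<integral>\<^sup>+y. ennreal (k x y) * (if l < \<bar>g y\<bar> then 1 else 0) \<partial>M)"
      by (intro nn_integral_cong) (auto simp: level_def)
    finally show "(\<integral>\<^sup>+y. ennreal (k x y) * (if 0 < l \<and> l < \<bar>g y\<bar> then 1 else 0) \<partial>M)
      = ennreal (kernel_op M k (level g l) x * indicator {0<..} l)"
      by (cases "0 < l") (simp_all add: indicator_def)
  qed
  also have "enn2real \<dots> = (\<integral>l. kernel_op M k (level g l) x * indicator {0<..} l \<partial>lborel)"
  proof (rule integral_eq_nn_integral[symmetric])
    show "(\<lambda>l. kernel_op M k (level g l) x * indicator {0<..} l) \<in> borel_measurable lborel"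
      unfolding kernel_op_def by measurable
    show "AE l in lborel. 0 \<le> kernel_op M k (level g l) x * indicator {0<..} l"
      unfolding kernel_op_def using kernel_nonneg by (auto simp: level_def intro!: integral_nonneg_AE)
  qed
  finally show ?thesis .
qed

text \<open>A superlevel set of measure \<open>m\<close> has an image of \<open>L\<^sup>p\<close> norm at most \<open>m\<^sup>1\<^sup>/\<^sup>p\<close> by contraction and at most
\<open>B\<^sup>1\<^sup>-\<^sup>1\<^sup>/\<^sup>p m\<close> by smoothing from \<open>L\<^sup>1\<close>. With \<open>w u = min (u\<^sup>1\<^sup>/\<^sup>p\<^sup>-\<^sup>1) (t\<^sup>-\<^sup>b\<^sup>(\<^sup>1\<^sup>-\<^sup>1\<^sup>/\<^sup>p\<^sup>))\<close> the smaller of the two is at most a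
multiple of \<open>m w(m)\<close>, hence of the integral of the decreasing function \<open>w\<close> over \<open>(0, m)\<close>. The integral of
the latter over all levels is the integral of \<open>w\<close> against the rearrangement. Replacing \<open>A\<close> by a number that
is at least 1 makes one factor \<open>c\<close> serve both bounds.\<close>

lemma (in contractive_kernel) kernel_op_le_hardy_mean:
  assumes g [measurable]: "g \<in> borel_measurable M" and r: "1 \<le> r" and N: "0 \<le> N" "moment M r g \<le> ennreal N"
    and p: "1 < p" and t: "0 < t" and A: "1 \<le> A" and B: "B \<le> A * t powr (- b)"
    and fin: "hardy_mean p b (rearrangement M g) t < \<infinity>"
  shows "moment M p (kernel_op M k g) \<le> ennreal ((A powr (1 - 1/p) * enn2real (hardy_mean p b (rearrangement M g) t)) powr p)"
proof -
  interpret P: pair_sigma_finite lborel M ..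
  note props = sigma_finite_measure_axioms g r N
  define w where "w u = min (u powr (1/p - 1)) (t powr (- b * (1 - 1/p)))" for u :: real
  have [measurable]: "w \<in> borel_measurable borel" unfolding w_def by measurable
  have w0: "0 \<le> w u" for u by (simp add: w_def)
  define c where "c = A powr (1 - 1/p)"
  have c: "1 \<le> c" using A p by (simp add: c_def ge_one_powr_ge_zero)
  define m where "m l = enn2real (superlevel M g l)" for l
  have m: "superlevel M g l = ennreal (m l)" if "0 < l" for l
    using superlevel_finite[OF props that] by (simp add: m_def)
  have m0: "0 \<le> m l" for l by (simp add: m_def)
  have [measurable]: "m \<in> borel_measurable borel" unfolding m_def by measurable
  define V where "V l = m l * w (m l) * indicator {0<..} l" for l
  have V0: "0 \<le> V l" for l using m0 w0 by (simp add: V_def)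
  have [measurable]: "V \<in> borel_measurable borel" unfolding V_def by measurable
  define \<phi> where "\<phi> l x = kernel_op M k (level g l) x * indicator {0<..} l" for l x
  have \<phi>meas [measurable]: "(\<lambda>(l, x). \<phi> l x) \<in> borel_measurable (borel \<Otimes>\<^sub>M M)"
    unfolding \<phi>_def kernel_op_def by measurable
  have moment_ind: "moment M s (level g l) = superlevel M g l" for s l
  proof -
    have "moment M s (level g l) = (\<integral>\<^sup>+y. indicator {x \<in> space M. l < \<bar>g x\<bar>} y \<partial>M)"
      unfolding moment_def by (intro nn_integral_cong) (auto simp: indicator_def level_def)
    then show ?thesis by (simp add: superlevel_def)
  qed
  \<comment> \<open>the norm of the image of a superlevel set, by contraction or by smoothing from \<open>L\<^sup>1\<close>\<close>
  have \<phi>p: "moment M p (\<phi> l) \<le> ennreal ((c * V l) powr p)" for l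
  proof (cases "0 < l")
    case True
    let ?f = "level g l"
    have eq: "moment M p (\<phi> l) = moment M p (kernel_op M k ?f)"
      using True by (simp add: \<phi>_def moment_def)
    have 1: "moment M p (kernel_op M k ?f) \<le> ennreal (m l)"
      using kernel_op_moment_le[of ?f p] p by (simp add: moment_ind m[OF True])
    have 2: "moment M p (kernel_op M k ?f) \<le> ennreal (B powr (p - 1) * m l powr p)"
      using kernel_op_improves[of ?f 1 p "m l"] p by (simp add: moment_ind m[OF True] m0)
    have m_le: "m l = (m l powr (1/p)) powr p" using m0[of l] p by (simp add: powr_powr)
    have "B powr (p - 1) * m l powr p \<le> (A * t powr (- b)) powr (p - 1) * m l powr p"
      using B kernel_bound_nonneg p by (intro mult_right_mono powr_mono2) auto
    also have "\<dots> = (c * (t powr (- b * (1 - 1/p)) * m l)) powr p"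
    proof -
      have "c powr p = A powr (p - 1)" using p by (simp add: c_def powr_powr algebra_simps)
      moreover have "(t powr (- b * (1 - 1/p))) powr p = (t powr (- b)) powr (p - 1)"
        using p by (simp add: powr_powr algebra_simps)
      ultimately show ?thesis by (simp add: powr_mult)
    qed
    finally have 3: "B powr (p - 1) * m l powr p \<le> (c * (t powr (- b * (1 - 1/p)) * m l)) powr p" .
    have 4: "m l \<le> (c * m l powr (1/p)) powr p"
      using m_le c p by (metis mult_le_cancel_right1 powr_ge_zero powr_mono2 less_imp_le less_trans not_less zero_less_one)
    have "V l = m l powr (1/p) \<or> V l = t powr (- b * (1 - 1/p)) * m l"
    proof -
      have "m l * m l powr (1/p - 1) = m l powr (1/p)" using m0[of l] p
        by (cases "m l = 0") (simp_all add: powr_diff)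
      then show ?thesis using True by (auto simp: V_def w_def min_def)
    qed
    then show ?thesis
    proof
      assume "V l = m l powr (1/p)"
      then show ?thesis unfolding eq using 1 4 by (metis ennreal_leI order_trans)
    next
      assume "V l = t powr (- b * (1 - 1/p)) * m l"
      then show ?thesis unfolding eq using 2 3 by (metis ennreal_leI order_trans)
    qed
  next
    case False
    then show ?thesis by (simp add: \<phi>_def moment_def)
  qed
  have \<phi>0: "\<phi> l x = 0" if "V l = 0" for l x
  proof (cases "0 < l")
    case True
    have "m l = 0" using that True t by (auto simp: V_def w_def min_def split: if_splits)
    then have "emeasure M {x \<in> space M. l < \<bar>g x\<bar>} = 0" using m[OF True] by (simp add: superlevel_def)
    then have "AE y in M. \<not> l < \<bar>g y\<bar>" by (subst AE_iff_measurable[OF _ refl]) auto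
    then have "(\<integral>y. k x y * level g l y \<partial>M) = (\<integral>y. 0 \<partial>M)"
      by (intro integral_cong_AE) (auto simp: level_def elim: eventually_mono)
    then show ?thesis by (simp add: \<phi>_def kernel_op_def)
  qed (simp add: \<phi>_def)
  define hit :: "real \<Rightarrow> real \<Rightarrow> ennreal"
    where "hit l u = (if 0 < l \<and> 0 < u \<and> ennreal u < superlevel M g l then 1 else 0)" for l u
  have [measurable]: "(\<lambda>(l, u). hit l u) \<in> borel_measurable (borel \<Otimes>\<^sub>M borel)"
    unfolding hit_def by measurable
  define S where "S = c * enn2real (hardy_mean p b (rearrangement M g) t)"
  have S0: "0 \<le> S" using c by (simp add: S_def)
  \<comment> \<open>the layer norms add up to at most the integral of the rearrangement against \<open>w\<close>\<close>
  have VS: "(\<integral>\<^sup>+l. ennreal (c * V l) \<partial>lborel) \<le> ennreal S"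
  proof -
    have "(\<integral>\<^sup>+l. ennreal (V l) \<partial>lborel)
      \<le> (\<integral>\<^sup>+l. \<integral>\<^sup>+u. ennreal (w u) * hit l u \<partial>lborel \<partial>lborel)"
    proof (intro nn_integral_mono)
      fix l :: real
      show "ennreal (V l) \<le> (\<integral>\<^sup>+u. ennreal (w u) * hit l u \<partial>lborel)"
      proof (cases "0 < l")
        case True
        have "ennreal (V l) = (\<integral>\<^sup>+u. ennreal (w (m l)) * indicator {0<..<m l} u \<partial>lborel)"
          using True m0 w0 by (simp add: V_def nn_integral_cmult_indicator ennreal_mult[symmetric] mult.commute)
        also have "\<dots> \<le> (\<integral>\<^sup>+u. ennreal (w u) * hit l u \<partial>lborel)"
        proof (intro nn_integral_mono)
          fix u :: real
          have "w (m l) \<le> w u" if "0 < u" "u < m l"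
          proof -
            have "m l powr (1/p - 1) \<le> u powr (1/p - 1)"
              using that p by (intro powr_mono2') (auto simp: field_simps)
            then show ?thesis by (simp add: w_def min_le_iff_disj)
          qed
          then show "ennreal (w (m l)) * indicator {0<..<m l} u \<le> ennreal (w u) * hit l u"
            using True m[OF True] by (auto simp: hit_def indicator_def ennreal_less_iff intro: ennreal_leI)
        qed
        finally show ?thesis .
      qed (simp add: V_def)
    qed
    also have "\<dots> = (\<integral>\<^sup>+u. \<integral>\<^sup>+l. ennreal (w u) * hit l u \<partial>lborel \<partial>lborel)"
      by (rule lborel_pair.Fubini'[symmetric]) measurable
    also have "\<dots> = (\<integral>\<^sup>+u\<in>{0<..}. ennreal (rearrangement M g u * w u) \<partial>lborel)"
    proof (intro nn_integral_cong)
      fix u :: real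
      show "(\<integral>\<^sup>+l. ennreal (w u) * hit l u \<partial>lborel)
         = ennreal (rearrangement M g u * w u) * indicator {0<..} u"
      proof (cases "0 < u")
        case True
        have "(\<integral>\<^sup>+l. ennreal (w u) * hit l u \<partial>lborel)
          = (\<integral>\<^sup>+l. ennreal (w u) * indicator (exceeding M g u) l \<partial>lborel)"
          using True by (intro nn_integral_cong) (simp add: hit_def exceeding_def indicator_def)
        also have "\<dots> = ennreal (w u) * ennreal (rearrangement M g u)"
          by (subst nn_integral_cmult_indicator) (auto simp: emeasure_rearrangement_set(1)[OF props True])
        finally show ?thesis using True w0 by (simp add: ennreal_mult[symmetric] rearrangement_nonneg mult.commute)
      qed (simp add: hit_def)
    qed
    also have "\<dots> = hardy_mean p b (rearrangement M g) t" by (simp add: hardy_mean_def w_def)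
    finally have "(\<integral>\<^sup>+l. ennreal (V l) \<partial>lborel) \<le> ennreal (enn2real (hardy_mean p b (rearrangement M g) t))"
      using fin by simp
    then have "ennreal c * (\<integral>\<^sup>+l. ennreal (V l) \<partial>lborel) \<le> ennreal c * ennreal (enn2real (hardy_mean p b (rearrangement M g) t))"
      by (rule mult_left_mono) simp
    moreover have "(\<integral>\<^sup>+l. ennreal (c * V l) \<partial>lborel) = ennreal c * (\<integral>\<^sup>+l. ennreal (V l) \<partial>lborel)"
      using c by (subst nn_integral_cmult[symmetric]) (auto simp: ennreal_mult' intro!: nn_integral_cong)
    ultimately show ?thesis using c by (simp add: S_def ennreal_mult)
  qed
  \<comment> \<open>Minkowski's integral inequality over the layers, as Jensen's inequality for the weight \<open>c * V\<close>\<close>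
  have pt: "ennreal (\<bar>kernel_op M k g x\<bar> powr p)
     \<le> ennreal (S powr (p - 1)) * (\<integral>\<^sup>+l. ennreal (c * V l * \<bar>\<phi> l x / (c * V l)\<bar> powr p) \<partial>lborel)" for x
  proof -
    have "(\<lambda>l. \<phi> l x) \<in> borel_measurable borel"
      unfolding \<phi>_def kernel_op_def by measurable
    note [measurable] = this
    have "\<bar>kernel_op M k g x\<bar> \<le> (\<integral>l. \<phi> l x \<partial>lborel)"
      using kernel_op_abs_le[of g x] kernel_op_layer_cake[OF g, of x] by (simp add: \<phi>_def)
    also have "(\<integral>l. \<phi> l x \<partial>lborel) = (\<integral>l. c * V l * (\<phi> l x / (c * V l)) \<partial>lborel)"
      using \<phi>0 c by (intro Bochner_Integration.integral_cong) auto
    finally have "\<bar>kernel_op M k g x\<bar> powr p \<le> \<bar>\<integral>l. c * V l * (\<phi> l x / (c * V l)) \<partial>lborel\<bar> powr p"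
      using p by (intro powr_mono2) auto
    then have "ennreal (\<bar>kernel_op M k g x\<bar> powr p) \<le> ennreal (\<bar>\<integral>l. c * V l * (\<phi> l x / (c * V l)) \<partial>lborel\<bar> powr p)"
      by (rule ennreal_leI)
    also have "\<dots> \<le> ennreal (S powr (p - 1)) * (\<integral>\<^sup>+l. ennreal (c * V l * \<bar>\<phi> l x / (c * V l)\<bar> powr p) \<partial>lborel)"
      using V0 c VS p by (intro weighted_jensen) auto
    finally show ?thesis .
  qed
  have "moment M p (kernel_op M k g) \<le> (\<integral>\<^sup>+x. ennreal (S powr (p - 1)) * (\<integral>\<^sup>+l. ennreal (c * V l * \<bar>\<phi> l x / (c * V l)\<bar> powr p) \<partial>lborel) \<partial>M)"
    unfolding moment_def by (intro nn_integral_mono pt)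
  also have "\<dots> = ennreal (S powr (p - 1)) * (\<integral>\<^sup>+x. \<integral>\<^sup>+l. ennreal (c * V l * \<bar>\<phi> l x / (c * V l)\<bar> powr p) \<partial>lborel \<partial>M)"
    by (intro nn_integral_cmult) measurable
  also have "(\<integral>\<^sup>+x. \<integral>\<^sup>+l. ennreal (c * V l * \<bar>\<phi> l x / (c * V l)\<bar> powr p) \<partial>lborel \<partial>M)
     = (\<integral>\<^sup>+l. \<integral>\<^sup>+x. ennreal (c * V l * \<bar>\<phi> l x / (c * V l)\<bar> powr p) \<partial>M \<partial>lborel)"
    by (rule P.Fubini') measurable
  also have "ennreal (S powr (p - 1)) * \<dots> \<le> ennreal (S powr (p - 1)) * (\<integral>\<^sup>+l. ennreal (c * V l) \<partial>lborel)"
  proof (intro mult_left_mono nn_integral_mono)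
    fix l :: real
    have [measurable]: "\<phi> l \<in> borel_measurable M" unfolding \<phi>_def[abs_def] by measurable
    have cV: "0 \<le> c * V l" using c V0 by simp
    show "(\<integral>\<^sup>+x. ennreal (c * V l * \<bar>\<phi> l x / (c * V l)\<bar> powr p) \<partial>M) \<le> ennreal (c * V l)"
    proof (cases "c * V l = 0")
      case False
      have "(\<integral>\<^sup>+x. ennreal (c * V l * \<bar>\<phi> l x / (c * V l)\<bar> powr p) \<partial>M)
        = (\<integral>\<^sup>+x. ennreal (c * V l / (c * V l) powr p) * ennreal (\<bar>\<phi> l x\<bar> powr p) \<partial>M)"
        using cV by (intro nn_integral_cong)
          (simp add: ennreal_mult'[symmetric] abs_divide powr_divide abs_of_nonneg[OF cV] del: abs_mult)
      also have "\<dots> = ennreal (c * V l / (c * V l) powr p) * moment M p (\<phi> l)"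
        unfolding moment_def by (intro nn_integral_cmult) measurable
      also have "\<dots> \<le> ennreal (c * V l / (c * V l) powr p) * ennreal ((c * V l) powr p)"
        by (intro mult_left_mono \<phi>p) auto
      also have "\<dots> = ennreal (c * V l)"
        using cV False by (simp add: ennreal_mult'[symmetric] del: mult_eq_0_iff)
      finally show ?thesis .
    qed auto
  qed auto
  also have "\<dots> \<le> ennreal (S powr (p - 1)) * ennreal S"
    by (intro mult_left_mono VS) auto
  also have "\<dots> = ennreal (S powr p)"
    using S0 p by (cases "S = 0") (simp_all add: ennreal_mult[symmetric] powr_diff)
  finally show ?thesis by (simp add: S_def c_def)
qed

section \<open>Regularity in time of a heat kernel\<close>

text \<open>The smallest multiple of \<open>1/(n+1)\<close> that is not less than \<open>s\<close>. Approximation from above keeps the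
times positive.\<close>

abbreviation grid :: "nat \<Rightarrow> real \<Rightarrow> real" where
  "grid n s \<equiv> real_of_int \<lceil>real (Suc n) * s\<rceil> / real (Suc n)"

lemma ceiling_grid_ge: "s \<le> grid n s"
  using le_of_int_ceiling[of "real (Suc n) * s"] by (simp add: field_simps del: of_nat_Suc)

lemma ceiling_grid_tendsto: "(\<lambda>n. grid n s) \<longlonglongrightarrow> s"
proof (rule tendsto_sandwich)
  have upper: "grid n s \<le> s + 1 / real (Suc n)" for n
  proof -
    have "real_of_int \<lceil>real (Suc n) * s\<rceil> \<le> real (Suc n) * s + 1" by linarith
    then have "grid n s \<le> (real (Suc n) * s + 1) / real (Suc n)"
      by (rule divide_right_mono) simp
    then show ?thesis by (simp add: add_divide_distrib del: of_nat_Suc)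
  qed
  show "\<forall>\<^sub>F n in sequentially. grid n s \<le> s + 1 / real (Suc n)"
    using upper by simp
  show "\<forall>\<^sub>F n in sequentially. s \<le> grid n s"
    using ceiling_grid_ge by simp
  show "(\<lambda>n. s) \<longlonglongrightarrow> s" by simp
  have "(\<lambda>n. s + 1 / real (Suc n)) \<longlonglongrightarrow> s + 0"
    using LIMSEQ_inverse_real_of_nat by (intro tendsto_add) (simp_all add: inverse_eq_divide)
  then show "(\<lambda>n. s + 1 / real (Suc n)) \<longlonglongrightarrow> s" by simp
qed

text \<open>The order of quantifiers in the last two conditions matters: the exceptional \<open>y\<close> may depend on \<open>x\<close> but not on
the times, as needed to study the functions \<open>t \<mapsto> k t x y\<close>. There is no exceptional \<open>x\<close>; a general heat
kernel gets this form after it is set to 0 on a null set of rows and columns.\<close>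

locale symmetric_markov_family = sigma_finite_measure M for M :: "'a measure" +
  fixes k :: "real \<Rightarrow> 'a \<Rightarrow> 'a \<Rightarrow> real" and A \<gamma> :: real
  assumes space_UNIV: "space M = UNIV"
    and k_measurable: "\<And>t. (\<lambda>(x, y). k t x y) \<in> borel_measurable (M \<Otimes>\<^sub>M M)"
    and k_nonneg: "\<And>t x y. 0 < t \<Longrightarrow> 0 \<le> k t x y"
    and k_le: "\<And>t x y. 0 < t \<Longrightarrow> k t x y \<le> A * t powr (- \<gamma>)"
    and k_row: "\<And>t x. 0 < t \<Longrightarrow> (\<integral>\<^sup>+y. ennreal (k t x y) \<partial>M) \<le> 1"
    and k_sym: "\<And>x. AE y in M. \<forall>t>0. k t x y = k t y x"
    and k_chapman: "\<And>x. AE y in M. \<forall>s>0. \<forall>t>0. ennreal (k (s + t) x y) = (\<integral>\<^sup>+z. ennreal (k s x z * k t z y) \<partial>M)"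
begin

lemma k_row_measurable [measurable]: "k t x \<in> borel_measurable M"
  using measurable_compose[OF measurable_Pair1' k_measurable, of x] by (simp add: space_UNIV)

lemma k_compose_measurable [measurable (raw)]:
  assumes "x \<in> N \<rightarrow>\<^sub>M M" "y \<in> N \<rightarrow>\<^sub>M M"
  shows "(\<lambda>w. k t (x w) (y w)) \<in> borel_measurable N"
  using measurable_compose[OF measurable_Pair[OF assms] k_measurable] by simp

lemma in_space [simp]: "x \<in> space M" by (simp add: space_UNIV)

lemma k_contractive:
  assumes t: "0 < t"
  shows "contractive_kernel M (k t) (A * t powr (- \<gamma>))"
proof
  interpret pair_sigma_finite M M ..
  show "(\<integral>\<^sup>+x. \<integral>\<^sup>+y. ennreal (k t x y) * g y \<partial>M \<partial>M) \<le> (\<integral>\<^sup>+y. g y \<partial>M)"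
    if [measurable]: "g \<in> borel_measurable M" for g
  proof -
    have "(\<integral>\<^sup>+x. \<integral>\<^sup>+y. ennreal (k t x y) * g y \<partial>M \<partial>M) = (\<integral>\<^sup>+y. \<integral>\<^sup>+x. ennreal (k t x y) * g y \<partial>M \<partial>M)"
      by (rule Fubini'[symmetric]) measurable
    also have "\<dots> = (\<integral>\<^sup>+y. (\<integral>\<^sup>+x. ennreal (k t x y) \<partial>M) * g y \<partial>M)"
      by (intro nn_integral_cong nn_integral_multc) measurable
    also have "\<dots> \<le> (\<integral>\<^sup>+y. 1 * g y \<partial>M)"
    proof (intro nn_integral_mono mult_right_mono)
      fix y
      have "(\<integral>\<^sup>+x. ennreal (k t x y) \<partial>M) = (\<integral>\<^sup>+x. ennreal (k t y x) \<partial>M)"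
        using k_sym[of y] t by (intro nn_integral_cong_AE) (auto elim: eventually_mono)
      then show "(\<integral>\<^sup>+x. ennreal (k t x y) \<partial>M) \<le> 1" using k_row[OF t, of y] by simp
    qed auto
    finally show ?thesis by simp
  qed
qed (use space_UNIV k_measurable k_nonneg[OF t] k_le[OF t] k_row[OF t] in auto)

abbreviation P :: "real \<Rightarrow> ('a \<Rightarrow> real) \<Rightarrow> 'a \<Rightarrow> real" where
  "P t \<equiv> kernel_op M (k t)"

lemma P_measurable [measurable]:
  assumes [measurable]: "f \<in> borel_measurable M"
  shows "P t f \<in> borel_measurable M"
  unfolding kernel_op_def by measurable

text \<open>The Chapman-Kolmogorov equation integrated against \<open>f\<close>. Fubini's theorem applies because the operator at time
\<open>t\<close> maps \<open>\<bar>f\<bar>\<close> again into \<open>L\<^sup>r\<close>.\<close>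

lemma P_semigroup:
  assumes f [measurable]: "f \<in> borel_measurable M" and r: "1 \<le> r" and fin: "moment M r f < \<infinity>"
    and s: "0 < s" and t: "0 < t"
  shows "P (s + t) f x = P s (P t f) x"
proof -
  interpret pair_sigma_finite M M ..
  interpret S: contractive_kernel M "k s" "A * s powr (- \<gamma>)" by (rule k_contractive[OF s])
  interpret T: contractive_kernel M "k t" "A * t powr (- \<gamma>)" by (rule k_contractive[OF t])
  have fin': "moment M r (P t (\<lambda>y. \<bar>f y\<bar>)) < \<infinity>"
    using T.kernel_op_moment_le[of "\<lambda>y. \<bar>f y\<bar>" r] r fin by auto
  have int: "integrable (M \<Otimes>\<^sub>M M) (\<lambda>(z, y). k s x z * (k t z y * f y))"
  proof (rule Fubini_integrable)
    have "integrable M (\<lambda>z. k s x z * P t (\<lambda>y. \<bar>f y\<bar>) z)"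
      by (rule S.kernel_integrable[OF _ r fin']) measurable
    then show "integrable M (\<lambda>z. \<integral>y. norm (case (z, y) of (z, y) \<Rightarrow> k s x z * (k t z y * f y)) \<partial>M)"
      using S.kernel_nonneg T.kernel_nonneg by (simp add: kernel_op_def abs_mult)
    show "AE z in M. integrable M (\<lambda>y. case (z, y) of (z, y) \<Rightarrow> k s x z * (k t z y * f y))"
      using T.kernel_integrable[OF f r fin] by simp
  qed measurable
  have "P s (P t f) x = (\<integral>z. \<integral>y. k s x z * (k t z y * f y) \<partial>M \<partial>M)"
    by (simp add: kernel_op_def)
  also have "\<dots> = (\<integral>y. \<integral>z. k s x z * (k t z y * f y) \<partial>M \<partial>M)"
    using Fubini_integral[OF int] by simp
  also have "\<dots> = (\<integral>y. k (s + t) x y * f y \<partial>M)"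
  proof (rule integral_cong_AE)
    show "AE y in M. (\<integral>z. k s x z * (k t z y * f y) \<partial>M) = k (s + t) x y * f y"
      using k_chapman[of x]
    proof eventually_elim
      case (elim y)
      have "(\<integral>z. k s x z * k t z y \<partial>M) = enn2real (\<integral>\<^sup>+z. ennreal (k s x z * k t z y) \<partial>M)"
        using S.kernel_nonneg T.kernel_nonneg by (intro integral_eq_nn_integral) auto
      also have "\<dots> = k (s + t) x y"
        using elim s t k_nonneg[of "s + t" x y] by (metis add_pos_pos enn2real_ennreal)
      finally show ?case by (simp flip: mult.assoc)
    qed
  qed measurable
  finally show ?thesis by (simp add: kernel_op_def)
qed

lemma k_row_moment:
  assumes s: "0 < s"
  shows "moment M 2 (k s x) < \<infinity>"
proof -
  have "moment M 1 (k s x) \<le> 1"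
    unfolding moment_def using k_row[OF s, of x] k_nonneg[OF s] by simp
  have "moment M 2 (k s x) \<le> ennreal ((A * s powr (- \<gamma>)) powr (2 - 1)) * moment M 1 (k s x)"
    using k_nonneg[OF s] k_le[OF s] by (intro moment_interpolate) auto
  also have "\<dots> < \<infinity>" using le_less_trans[OF \<open>moment M 1 (k s x) \<le> 1\<close>, of top]
    by (simp add: ennreal_mult_less_top)
  finally show ?thesis .
qed

text \<open>A row of the kernel is itself an orbit of the semigroup. The exceptional set does not depend on the times,
which is what allows pointwise conclusions below.\<close>

lemma k_row_evolution: "AE y in M. \<forall>s>0. \<forall>t>0. k (s + t) x y = P t (k s x) y"
  using k_chapman[of x]
proof eventually_elim
  case (elim y)
  show ?case
  proof (intro allI impI)
    fix s t :: real assume s: "0 < s" and t: "0 < t"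
    have "P t (k s x) y = enn2real (\<integral>\<^sup>+z. ennreal (k t y z * k s x z) \<partial>M)"
      unfolding kernel_op_def using k_nonneg s t by (intro integral_eq_nn_integral) auto
    also have "(\<integral>\<^sup>+z. ennreal (k t y z * k s x z) \<partial>M) = (\<integral>\<^sup>+z. ennreal (k s x z * k t z y) \<partial>M)"
      using k_sym[of y] t by (intro nn_integral_cong_AE) (auto elim!: eventually_mono simp: mult.commute)
    also have "\<dots> = ennreal (k (s + t) x y)" using elim s t by simp
    finally show "k (s + t) x y = P t (k s x) y" using k_nonneg[of "s + t" x y] s t by simp
  qed
qed

end

locale heat_family = symmetric_markov_family +
  assumes k_L2: "\<And>f. f \<in> borel_measurable M \<Longrightarrow> moment M 2 f < \<infinity> \<Longrightarrow>
      ((\<lambda>t. moment M 2 (\<lambda>x. kernel_op M (k t) f x - f x)) \<longlongrightarrow> 0) (at_right 0)"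
begin

text \<open>Rows at later times are images of the row at time \<open>s0\<close> under contractions that commute with the evolution, so
one modulus of continuity at \<open>s0\<close> serves for all later times.\<close>

lemma k_row_L2_modulus:
  assumes s0: "0 < s0" "s0 \<le> s" and h: "0 < h"
  shows "moment M 2 (\<lambda>y. k (s + h) x y - k s x y) \<le> moment M 2 (\<lambda>y. P h (k s0 x) y - k s0 x y)"
proof -
  have 0: "moment M 2 (\<lambda>y. k (s0 + h) x y - k s0 x y) = moment M 2 (\<lambda>y. P h (k s0 x) y - k s0 x y)"
    using k_row_evolution[of x] s0 h by (intro moment_cong_AE) (auto elim: eventually_mono)
  show ?thesis
  proof (cases "s = s0")
    case False
    define r where "r = s - s0"
    have r: "0 < r" using False s0 by (simp add: r_def)
    interpret R: contractive_kernel M "k r" "A * r powr (- \<gamma>)" by (rule k_contractive[OF r])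
    have "AE y in M. k (s + h) x y - k s x y = P r (\<lambda>y. k (s0 + h) x y - k s0 x y) y"
      using k_row_evolution[of x]
    proof eventually_elim
      case (elim y)
      have "k (s0 + r) x y = P r (k s0 x) y" using elim s0 r by simp
      moreover have "k (s0 + h + r) x y = P r (k (s0 + h) x) y" using elim s0 r h by simp
      moreover have "s0 + r = s" "s0 + h + r = s + h" by (simp_all add: r_def)
      moreover have "P r (\<lambda>y. k (s0 + h) x y - k s0 x y) y = P r (k (s0 + h) x) y - P r (k s0 x) y"
        using s0 h by (intro R.kernel_op_diff[of _ _ 2]) (auto intro!: k_row_moment[unfolded infinity_ennreal_def])
      ultimately show ?case by simp
    qed
    then have "moment M 2 (\<lambda>y. k (s + h) x y - k s x y) = moment M 2 (P r (\<lambda>y. k (s0 + h) x y - k s0 x y))"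
      by (rule moment_cong_AE)
    also have "\<dots> \<le> moment M 2 (\<lambda>y. k (s0 + h) x y - k s0 x y)"
      by (rule R.kernel_op_moment_le) auto
    finally show ?thesis unfolding 0 .
  qed (simp add: 0)
qed

text \<open>An additional time step \<open>t\<close> turns continuity of \<open>s \<mapsto> k s x\<close> in \<open>L\<^sup>2\<close> into pointwise continuity, because the
operator at time \<open>t\<close> maps \<open>L\<^sup>2\<close> into bounded functions.\<close>

lemma k_continuous_in_time: "AE y in M. continuous_on {0<..} (\<lambda>s. k s x y)"
  using k_row_evolution[of x]
proof eventually_elim
  case (elim y)
  have diff_le: "ennreal (\<bar>k (s + t) x y - k (s' + t) x y\<bar> powr 2)
      \<le> ennreal (A * t powr (- \<gamma>)) * moment M 2 (\<lambda>z. k s x z - k s' x z)"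
    if "0 < s" "0 < s'" "0 < t" for s s' t
  proof -
    interpret T: contractive_kernel M "k t" "A * t powr (- \<gamma>)" by (rule k_contractive) fact
    have "k (s + t) x y - k (s' + t) x y = P t (k s x) y - P t (k s' x) y"
      using elim that by simp
    also have "\<dots> = P t (\<lambda>z. k s x z - k s' x z) y"
      using that by (intro T.kernel_op_diff[symmetric, of _ _ 2]) (auto intro!: k_row_moment[unfolded infinity_ennreal_def])
    finally have "k (s + t) x y - k (s' + t) x y = P t (\<lambda>z. k s x z - k s' x z) y" .
    then show ?thesis using T.kernel_op_sup_le[of "\<lambda>z. k s x z - k s' x z" 2 y] by simp
  qed
  show ?case
    unfolding continuous_on_iff
  proof (intro ballI allI impI)
    fix s1 e :: real assume s1: "s1 \<in> {0<..}" and e: "0 < e"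
    \<comment> \<open>half of the time is spent in \<open>L\<^sup>2\<close>, the other half on smoothing; \<open>s1/4\<close> leaves room on both sides\<close>
    define t where "t = s1 / 2"
    define \<omega> where "\<omega> h = moment M 2 (\<lambda>y. P h (k (s1/4) x) y - k (s1/4) x y)" for h
    have "((\<lambda>h. ennreal (A * t powr (- \<gamma>)) * \<omega> h) \<longlongrightarrow> ennreal (A * t powr (- \<gamma>)) * 0) (at_right 0)"
      unfolding \<omega>_def using s1 by (intro ennreal_tendsto_cmult k_L2 k_row_moment) auto
    then have "\<forall>\<^sub>F h in at_right 0. ennreal (A * t powr (- \<gamma>)) * \<omega> h < ennreal (e powr 2)"
      using e by (intro order_tendstoD(2)) auto
    then obtain d where d: "0 < d" "\<And>h. 0 < h \<Longrightarrow> h < d \<Longrightarrow> ennreal (A * t powr (- \<gamma>)) * \<omega> h < ennreal (e powr 2)"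
      unfolding eventually_at_right_field by auto
    have small: "\<bar>k (s + h) x y - k s x y\<bar> < e" if s: "s1 / 4 + t \<le> s" and h: "0 < h" "h < d" for s h
    proof -
      have "ennreal (\<bar>k (s - t + h + t) x y - k (s - t + t) x y\<bar> powr 2)
        \<le> ennreal (A * t powr (- \<gamma>)) * moment M 2 (\<lambda>z. k (s - t + h) x z - k (s - t) x z)"
        using s h s1 by (intro diff_le) (auto simp: t_def)
      also have "\<dots> \<le> ennreal (A * t powr (- \<gamma>)) * \<omega> h"
        unfolding \<omega>_def using s h s1 by (intro mult_left_mono k_row_L2_modulus) auto
      also have "\<dots> < ennreal (e powr 2)" using d h by simp
      finally have "\<bar>k (s + h) x y - k s x y\<bar> powr 2 < e powr 2"
        by (simp add: algebra_simps ennreal_less_iff)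
      then show ?thesis using e by (metis abs_ge_zero less_imp_le not_less powr_mono2 zero_le_numeral)
    qed
    show "\<exists>d>0. \<forall>s2\<in>{0<..}. dist s2 s1 < d \<longrightarrow> dist (k s2 x y) (k s1 x y) < e"
    proof (intro exI[of _ "min d (s1/4)"] conjI ballI impI)
      fix s2 assume s2: "dist s2 s1 < min d (s1/4)"
      consider "s2 = s1" | "s1 < s2" | "s2 < s1" by linarith
      then show "dist (k s2 x y) (k s1 x y) < e"
      proof cases
        case 2
        then show ?thesis using small[of s1 "s2 - s1"] s2 s1 by (auto simp: dist_real_def t_def)
      next
        case 3
        then show ?thesis using small[of s2 "s1 - s2"] s2 s1 by (auto simp: dist_real_def t_def abs_minus_commute)
      qed (use e in auto)
    qed (use d s1 in auto)
  qed
qed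

text \<open>A version of the kernel that is jointly measurable in time and space: the limit of the kernels at the grid
times, clamped so that the bounds hold everywhere, also where the limit does not exist.\<close>

definition kreg :: "real \<Rightarrow> 'a \<Rightarrow> 'a \<Rightarrow> real" where
  "kreg s x y = (if 0 < s then max 0 (min (A * s powr (- \<gamma>))
     (lim (\<lambda>n. k (grid n s) x y))) else 0)"

lemma A_nonneg: "0 \<le> A"
  using k_nonneg[of 1 undefined undefined] k_le[of 1 undefined undefined] by simp

lemma kreg_nonneg: "0 \<le> kreg s x y" by (simp add: kreg_def)

lemma kreg_le: "0 < s \<Longrightarrow> kreg s x y \<le> A * s powr (- \<gamma>)" using A_nonneg by (simp add: kreg_def)

lemma kreg_measurable [measurable (raw)]:
  assumes [measurable]: "s \<in> borel_measurable N" "x \<in> N \<rightarrow>\<^sub>M M" "y \<in> N \<rightarrow>\<^sub>M M"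
  shows "(\<lambda>w. kreg (s w) (x w) (y w)) \<in> borel_measurable N"
proof -
  have [measurable]: "(\<lambda>w. k (grid n (s w)) (x w) (y w)) \<in> borel_measurable N" for n
    by (rule measurable_compose_countable[where f = "\<lambda>i w. k (real_of_int i / real (Suc n)) (x w) (y w)"]) measurable
  show ?thesis unfolding kreg_def by measurable
qed

lemma kreg_eq: "AE y in M. \<forall>s>0. kreg s x y = k s x y"
  using k_continuous_in_time[of x]
proof eventually_elim
  case (elim y)
  show ?case
  proof (intro allI impI)
    fix s :: real assume s: "0 < s"
    let ?s = "\<lambda>n. grid n s"
    have lower: "s \<le> ?s n" for n by (rule ceiling_grid_ge)
    have "?s \<longlonglongrightarrow> s" by (rule ceiling_grid_tendsto)
    then have "(\<lambda>n. k (?s n) x y) \<longlonglongrightarrow> k s x y"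
      using s lower by (intro continuous_on_tendsto_compose[OF elim]) (auto intro: less_le_trans)
    then have "lim (\<lambda>n. k (?s n) x y) = k s x y" by (rule limI)
    then show "kreg s x y = k s x y" using s k_nonneg[OF s, of x y] k_le[OF s, of x y] by (simp add: kreg_def)
  qed
qed

lemma P_kreg:
  assumes [measurable]: "f \<in> borel_measurable M" and s: "0 < s"
  shows "P s f x = kernel_op M (kreg s) f x"
  unfolding kernel_op_def using kreg_eq[of x] s
  by (intro integral_cong_AE) (auto elim: eventually_mono)

text \<open>The semigroup with the identity at time 0, so that continuity at 0 needs no separate treatment.\<close>

definition Q :: "real \<Rightarrow> ('a \<Rightarrow> real) \<Rightarrow> 'a \<Rightarrow> real" where
  "Q s f = (if 0 < s then P s f else f)"

lemma Q_measurable [measurable (raw)]: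
  assumes [measurable]: "f \<in> borel_measurable M" "s \<in> borel_measurable N" "x \<in> N \<rightarrow>\<^sub>M M"
  shows "(\<lambda>w. Q (s w) f (x w)) \<in> borel_measurable N"
proof -
  have "Q (s w) f (x w) = (if 0 < s w then (\<integral>y. kreg (s w) (x w) y * f y \<partial>M) else f (x w))" for w
    using P_kreg[OF assms(1), of "s w" "x w"] by (auto simp: Q_def kernel_op_def)
  then show ?thesis by simp
qed

end

section \<open>Strong continuity on Lebesgue spaces\<close>

lemma ennreal_positive_real_below:
  assumes "0 < (e::ennreal)"
  obtains e' where "0 < e'" "ennreal e' \<le> e"
proof (cases e)
  case (real x)
  then show ?thesis using assms by (intro that[of x]) auto
next
  case top
  then show ?thesis by (intro that[of 1]) auto
qed

text \<open>Small values are absorbed by the first power and large but bounded values by the square. This replaces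
interpolation of \<open>L\<^sup>r\<close> between \<open>L\<^sup>1\<close>, \<open>L\<^sup>2\<close> and \<open>L\<^sup>\<infinity>\<close>, uniformly in \<open>r > 1\<close>.\<close>

lemma powr_le_eps_abs_plus_square:
  fixes g d C r :: real
  assumes d: "0 < d" and r: "1 \<le> r" and g: "\<bar>g\<bar> \<le> C"
  shows "\<bar>g\<bar> powr r \<le> d powr (r - 1) * \<bar>g\<bar> powr 1 + C powr r * (1 / d) powr 2 * \<bar>g\<bar> powr 2"
proof (cases "\<bar>g\<bar> \<le> d")
  case True
  have "\<bar>g\<bar> powr r = \<bar>g\<bar> powr (r - 1) * \<bar>g\<bar> powr 1" by (metis powr_add diff_add_cancel)
  also have "\<dots> \<le> d powr (r - 1) * \<bar>g\<bar> powr 1" using True r by (intro mult_right_mono powr_mono2) auto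
  finally show ?thesis by (smt (verit) mult_nonneg_nonneg powr_ge_zero)
next
  case False
  then have "1 \<le> \<bar>g\<bar> / d" using d by simp
  then have 1: "1 \<le> (1 / d) powr 2 * \<bar>g\<bar> powr 2"
    using ge_one_powr_ge_zero[of "\<bar>g\<bar> / d" 2] d by (simp add: powr_divide)
  have "\<bar>g\<bar> powr r \<le> C powr r" using g r by (intro powr_mono2) auto
  also have "\<dots> \<le> C powr r * ((1 / d) powr 2 * \<bar>g\<bar> powr 2)"
    using 1 mult_left_mono[OF 1, of "C powr r"] by simp
  finally show ?thesis by (smt (verit) mult.assoc mult_nonneg_nonneg powr_ge_zero)
qed

text \<open>Cutting off both small and large values makes an \<open>L\<^sup>r\<close> function integrable and bounded.\<close>

definition truncate :: "nat \<Rightarrow> ('a \<Rightarrow> real) \<Rightarrow> 'a \<Rightarrow> real" where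
  "truncate n f x = (if 1 / real (Suc n) \<le> \<bar>f x\<bar> \<and> \<bar>f x\<bar> \<le> real (Suc n) then f x else 0)"

lemma truncate_measurable [measurable]:
  assumes [measurable]: "f \<in> borel_measurable M"
  shows "truncate n f \<in> borel_measurable M"
  unfolding truncate_def[abs_def] by measurable

lemma truncate_abs_le: "\<bar>truncate n f x\<bar> \<le> \<bar>f x\<bar>" "\<bar>truncate n f x\<bar> \<le> real (Suc n)"
  by (auto simp: truncate_def)

lemma truncate_moment_1:
  assumes [measurable]: "f \<in> borel_measurable M" and r: "1 \<le> r" and fin: "moment M r f < \<infinity>"
  shows "moment M 1 (truncate n f) < \<infinity>"
proof -
  have "moment M 1 (truncate n f) \<le> (\<integral>\<^sup>+x. ennreal (real (Suc n) powr (r - 1)) * ennreal (\<bar>f x\<bar> powr r) \<partial>M)"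
    unfolding moment_def
  proof (intro nn_integral_mono)
    fix x
    have "\<bar>truncate n f x\<bar> \<le> real (Suc n) powr (r - 1) * \<bar>f x\<bar> powr r"
    proof (cases "1 / real (Suc n) \<le> \<bar>f x\<bar>")
      case True
      then have f: "0 < \<bar>f x\<bar>" by (smt (verit) of_nat_0_less_iff zero_less_Suc zero_less_divide_1_iff)
      have "1 \<le> (real (Suc n) * \<bar>f x\<bar>) powr (r - 1)"
        using True r by (intro ge_one_powr_ge_zero) (auto simp: field_simps)
      then have "1 * \<bar>f x\<bar> \<le> (real (Suc n) powr (r - 1) * \<bar>f x\<bar> powr (r - 1)) * \<bar>f x\<bar>"
        by (intro mult_right_mono) (auto simp: powr_mult)
      also have "\<dots> = real (Suc n) powr (r - 1) * \<bar>f x\<bar> powr r"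
        using f by (simp add: powr_diff)
      finally show ?thesis using truncate_abs_le(1)[of n f x] by simp
    qed (simp add: truncate_def)
    then show "ennreal (\<bar>truncate n f x\<bar> powr 1) \<le> ennreal (real (Suc n) powr (r - 1)) * ennreal (\<bar>f x\<bar> powr r)"
      by (simp add: ennreal_mult[symmetric] ennreal_leI)
  qed
  also have "\<dots> = ennreal (real (Suc n) powr (r - 1)) * moment M r f"
    unfolding moment_def by (intro nn_integral_cmult) auto
  also have "\<dots> < \<infinity>" using fin by (simp add: ennreal_mult_less_top)
  finally show ?thesis .
qed

lemma truncate_approx:
  assumes [measurable]: "f \<in> borel_measurable M" and r: "1 \<le> r" and fin: "moment M r f < \<infinity>"
  shows "(\<lambda>n. moment M r (\<lambda>x. f x - truncate n f x)) \<longlonglongrightarrow> 0"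
proof -
  have "(\<lambda>n. \<integral>\<^sup>+x. ennreal (\<bar>f x - truncate n f x\<bar> powr r) \<partial>M) \<longlonglongrightarrow> (\<integral>\<^sup>+x. 0 \<partial>M)"
  proof (rule nn_integral_dominated_convergence[where w = "\<lambda>x. ennreal (\<bar>f x\<bar> powr r)"])
    show "(\<integral>\<^sup>+x. ennreal (\<bar>f x\<bar> powr r) \<partial>M) < \<infinity>" using fin by (simp add: moment_def)
    show "AE x in M. ennreal (\<bar>f x - truncate n f x\<bar> powr r) \<le> ennreal (\<bar>f x\<bar> powr r)" for n
      using r by (auto simp: truncate_def intro!: ennreal_leI powr_mono2)
    show "AE x in M. (\<lambda>n. ennreal (\<bar>f x - truncate n f x\<bar> powr r)) \<longlonglongrightarrow> 0"
    proof (intro AE_I2 tendsto_eventually)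
      fix x
      obtain m where m: "\<bar>f x\<bar> \<le> real m" using real_arch_simple by blast
      show "\<forall>\<^sub>F n in sequentially. ennreal (\<bar>f x - truncate n f x\<bar> powr r) = 0"
      proof (cases "f x = 0")
        case False
        obtain l where l: "inverse (real (Suc l)) < \<bar>f x\<bar>" using reals_Archimedean[of "\<bar>f x\<bar>"] False by auto
        show ?thesis
          using eventually_ge_at_top[of m] eventually_ge_at_top[of l]
        proof eventually_elim
          case (elim n)
          have "1 / real (Suc n) \<le> inverse (real (Suc l))" using elim by (simp add: field_simps)
          then have "truncate n f x = f x" using m l elim by (simp add: truncate_def)
          then show ?case by simp
        qed
      qed (simp add: truncate_def)
    qed
  qed measurable
  then show ?thesis by (simp add: moment_def)
qed

context heat_family
begin

lemma P_strongly_continuous_bounded: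
  assumes f [measurable]: "f \<in> borel_measurable M" and r: "1 < r"
    and C: "\<And>x. \<bar>f x\<bar> \<le> C" and fin: "moment M 1 f < \<infinity>"
  shows "((\<lambda>t. moment M r (\<lambda>x. P t f x - f x)) \<longlongrightarrow> 0) (at_right 0)"
proof (rule order_tendstoI)
  fix e :: ennreal assume "0 < e"
  then obtain e' where e': "0 < e'" "ennreal e' \<le> e" by (rule ennreal_positive_real_below)
  have fin2: "moment M 2 f < \<infinity>"
  proof -
    have "moment M 2 f \<le> ennreal (C powr (2 - 1)) * moment M 1 f"
      using C by (intro moment_interpolate) auto
    also have "\<dots> < \<infinity>" using fin by (simp add: ennreal_mult_less_top)
    finally show ?thesis .
  qed
  obtain N where N: "0 \<le> N" "moment M 1 f = ennreal N" using fin by (cases "moment M 1 f") auto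
  \<comment> \<open>chosen so that the first power contributes at most \<open>e'/2\<close>\<close>
  define d where "d = (e' / (2 * (4 * N + 1))) powr (1 / (r - 1))"
  have d: "0 < d" using e' N by (simp add: d_def)
  have dr: "d powr (r - 1) = e' / (2 * (4 * N + 1))" using r e' N by (simp add: d_def powr_powr)
  define K where "K = (2 * C) powr r * (1 / d) powr 2"
  have K: "0 \<le> K" by (simp add: K_def)
  have "((\<lambda>t. ennreal K * moment M 2 (\<lambda>x. P t f x - f x)) \<longlongrightarrow> ennreal K * 0) (at_right 0)"
    by (intro ennreal_tendsto_cmult k_L2 f fin2) auto
  then have "\<forall>\<^sub>F t in at_right 0. ennreal K * moment M 2 (\<lambda>x. P t f x - f x) < ennreal (e' / 2)"
    using e' by (intro order_tendstoD(2)) auto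
  moreover have "\<forall>\<^sub>F t in at_right 0. (0::real) < t" by (rule eventually_at_right_less)
  ultimately show "\<forall>\<^sub>F t in at_right 0. moment M r (\<lambda>x. P t f x - f x) < e"
  proof eventually_elim
    case (elim t)
    interpret T: contractive_kernel M "k t" "A * t powr (- \<gamma>)" by (rule k_contractive) fact
    have bd: "\<bar>P t f x - f x\<bar> \<le> 2 * C" for x
      using T.kernel_op_bounded[OF f C, of x] C[of x] by linarith
    have m1: "moment M 1 (\<lambda>x. P t f x - f x) \<le> ennreal (4 * N)"
    proof -
      have "moment M 1 (\<lambda>x. P t f x - f x) \<le> ennreal (2 powr 1) * (moment M 1 (P t f) + moment M 1 f)"
        by (rule moment_diff_le) auto
      also have "\<dots> \<le> ennreal (2 powr 1) * (moment M 1 f + moment M 1 f)"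
        by (intro mult_left_mono add_right_mono T.kernel_op_moment_le) auto
      also have "\<dots> = ennreal (2 powr 1) * ennreal (N + N)"
        using N by (simp only: N(2) ennreal_plus)
      also have "\<dots> = ennreal (2 powr 1 * (N + N))"
        using N by (intro ennreal_mult[symmetric]) auto
      also have "2 powr 1 * (N + N) = 4 * N" by simp
      finally show ?thesis .
    qed
    have "moment M r (\<lambda>x. P t f x - f x)
       \<le> (\<integral>\<^sup>+x. ennreal (d powr (r - 1)) * ennreal (\<bar>P t f x - f x\<bar> powr 1) + ennreal K * ennreal (\<bar>P t f x - f x\<bar> powr 2) \<partial>M)"
      unfolding moment_def
    proof (intro nn_integral_mono)
      fix x
      have "\<bar>P t f x - f x\<bar> powr r \<le> d powr (r - 1) * \<bar>P t f x - f x\<bar> powr 1 + K * \<bar>P t f x - f x\<bar> powr 2"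
        unfolding K_def using r by (intro powr_le_eps_abs_plus_square d bd) auto
      then have "ennreal (\<bar>P t f x - f x\<bar> powr r) \<le> ennreal (d powr (r - 1) * \<bar>P t f x - f x\<bar> powr 1 + K * \<bar>P t f x - f x\<bar> powr 2)"
        by (rule ennreal_leI)
      also have "\<dots> = ennreal (d powr (r - 1)) * ennreal (\<bar>P t f x - f x\<bar> powr 1) + ennreal K * ennreal (\<bar>P t f x - f x\<bar> powr 2)"
        using K by (subst ennreal_plus) (auto simp: ennreal_mult)
      finally show "ennreal (\<bar>P t f x - f x\<bar> powr r) \<le> ennreal (d powr (r - 1)) * ennreal (\<bar>P t f x - f x\<bar> powr 1) + ennreal K * ennreal (\<bar>P t f x - f x\<bar> powr 2)" .
    qed
    also have "\<dots> = ennreal (d powr (r - 1)) * moment M 1 (\<lambda>x. P t f x - f x) + ennreal K * moment M 2 (\<lambda>x. P t f x - f x)"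
      unfolding moment_def by (simp add: nn_integral_add nn_integral_cmult)
    also have "\<dots> \<le> ennreal (d powr (r - 1)) * ennreal (4 * N) + ennreal K * moment M 2 (\<lambda>x. P t f x - f x)"
      by (intro add_right_mono mult_left_mono m1) auto
    also have "\<dots> \<le> ennreal (e' / 2) + ennreal K * moment M 2 (\<lambda>x. P t f x - f x)"
    proof (rule add_right_mono)
      have "d powr (r - 1) * (4 * N) \<le> e' / 2" using e' N by (simp add: dr field_simps)
      then show "ennreal (d powr (r - 1)) * ennreal (4 * N) \<le> ennreal (e' / 2)"
        using N by (simp add: ennreal_mult[symmetric] ennreal_leI)
    qed
    also have "\<dots> < ennreal (e' / 2) + ennreal (e' / 2)"
      using elim by (subst ennreal_add_left_cancel_less) auto
    also have "\<dots> = ennreal e'" using e' by (simp add: ennreal_plus[symmetric] del: ennreal_plus)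
    finally show ?case using e' by simp
  qed
qed auto

text \<open>Truncations are dense, and contractivity makes the error of the truncation uniform in time.\<close>

lemma P_strongly_continuous:
  assumes f [measurable]: "f \<in> borel_measurable M" and r: "1 < r" and fin: "moment M r f < \<infinity>"
  shows "((\<lambda>t. moment M r (\<lambda>x. P t f x - f x)) \<longlongrightarrow> 0) (at_right 0)"
proof (rule order_tendstoI)
  fix e :: ennreal assume "0 < e"
  then obtain e' where e': "0 < e'" "ennreal e' \<le> e" by (rule ennreal_positive_real_below)
  define K where "K = (2::real) powr r"
  have K: "0 < K" by (simp add: K_def)
  have "(\<lambda>n. (ennreal K + ennreal (K * K)) * moment M r (\<lambda>x. f x - truncate n f x)) \<longlonglongrightarrow> (ennreal K + ennreal (K * K)) * 0"
    using r fin by (intro ennreal_tendsto_cmult truncate_approx f) auto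
  then have "\<forall>\<^sub>F n in sequentially. (ennreal K + ennreal (K * K)) * moment M r (\<lambda>x. f x - truncate n f x) < ennreal (e' / 2)"
    using e' by (intro order_tendstoD(2)) auto
  then obtain n where n: "(ennreal K + ennreal (K * K)) * moment M r (\<lambda>x. f x - truncate n f x) < ennreal (e' / 2)"
    by (auto simp: eventually_sequentially)
  define g where "g = truncate n f"
  have g [measurable]: "g \<in> borel_measurable M" by (simp add: g_def)
  have fing: "moment M r g < \<infinity>"
    using moment_mono[of r g f M] truncate_abs_le(1)[of n f] r fin by (auto simp: g_def)
  have "((\<lambda>t. moment M r (\<lambda>x. P t g x - g x)) \<longlongrightarrow> 0) (at_right 0)"
    unfolding g_def using truncate_abs_le(2)[of n f] r
    by (intro P_strongly_continuous_bounded[where C = "real (Suc n)"] truncate_moment_1[OF f _ fin]) auto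
  then have "((\<lambda>t. ennreal (K * K) * moment M r (\<lambda>x. P t g x - g x)) \<longlongrightarrow> ennreal (K * K) * 0) (at_right 0)"
    by (intro ennreal_tendsto_cmult) auto
  then have "\<forall>\<^sub>F t in at_right 0. ennreal (K * K) * moment M r (\<lambda>x. P t g x - g x) < ennreal (e' / 2)"
    using e' by (intro order_tendstoD(2)) auto
  moreover have "\<forall>\<^sub>F t in at_right 0. (0::real) < t" by (rule eventually_at_right_less)
  ultimately show "\<forall>\<^sub>F t in at_right 0. moment M r (\<lambda>x. P t f x - f x) < e"
  proof eventually_elim
    case (elim t)
    interpret T: contractive_kernel M "k t" "A * t powr (- \<gamma>)" by (rule k_contractive) fact
    define a where "a = moment M r (\<lambda>x. f x - g x)"
    have 1: "moment M r (\<lambda>x. P t f x - P t g x) \<le> a"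
    proof -
      have "(\<lambda>x. P t f x - P t g x) = P t (\<lambda>x. f x - g x)"
        using T.kernel_op_diff[OF f g _ fin fing] r by auto
      then show ?thesis unfolding a_def using T.kernel_op_moment_le[of "\<lambda>x. f x - g x" r] r by simp
    qed
    have 2: "moment M r (\<lambda>x. g x - f x) = a" by (simp add: a_def moment_def abs_minus_commute)
    have "moment M r (\<lambda>x. P t f x - f x) \<le> ennreal K * (moment M r (\<lambda>x. P t f x - P t g x) + moment M r (\<lambda>x. P t g x - f x))"
      unfolding K_def using r by (intro moment_triangle) auto
    also have "\<dots> \<le> ennreal K * (a + ennreal K * (moment M r (\<lambda>x. P t g x - g x) + a))"
      using moment_triangle[of "P t g" M g f r] r
      by (intro mult_left_mono add_mono 1) (auto simp: K_def 2)
    also have "\<dots> = (ennreal K + ennreal (K * K)) * a + ennreal (K * K) * moment M r (\<lambda>x. P t g x - g x)"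
      using K by (simp add: ennreal_mult distrib_left distrib_right mult_ac add_ac)
    also have "\<dots> < ennreal (e' / 2) + ennreal (e' / 2)"
      using n elim by (intro add_strict_mono) (auto simp: a_def g_def)
    also have "\<dots> = ennreal e'" using e' by (simp add: ennreal_plus[symmetric] del: ennreal_plus)
    finally show ?case using e' by simp
  qed
qed auto

lemma Q_moment_le:
  assumes [measurable]: "f \<in> borel_measurable M" and r: "1 \<le> r"
  shows "moment M r (Q s f) \<le> moment M r f"
  using contractive_kernel.kernel_op_moment_le[OF k_contractive assms] by (simp add: Q_def)

definition modulus :: "real \<Rightarrow> ('a \<Rightarrow> real) \<Rightarrow> real \<Rightarrow> ennreal" where
  "modulus r f h = moment M r (\<lambda>x. Q h f x - f x)"

lemma modulus_measurable [measurable]: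
  assumes [measurable]: "f \<in> borel_measurable M"
  shows "modulus r f \<in> borel_measurable borel"
  unfolding modulus_def[abs_def] moment_def by measurable

lemma modulus_tendsto:
  assumes f [measurable]: "f \<in> borel_measurable M" and r: "1 < r" and fin: "moment M r f < \<infinity>"
  shows "(modulus r f \<longlongrightarrow> 0) (at_right 0)"
proof (rule Lim_transform_eventually[OF P_strongly_continuous[OF assms]])
  show "\<forall>\<^sub>F t in at_right 0. moment M r (\<lambda>x. P t f x - f x) = modulus r f t"
    using eventually_at_right_less[of "0::real"] by eventually_elim (simp add: modulus_def Q_def)
qed

lemma modulus_le:
  assumes [measurable]: "f \<in> borel_measurable M" and r: "1 \<le> r"
  shows "modulus r f h \<le> ennreal (2 powr r) * (moment M r f + moment M r f)"
proof -
  have "modulus r f h \<le> ennreal (2 powr r) * (moment M r (Q h f) + moment M r f)"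
    unfolding modulus_def using r by (intro moment_diff_le) auto
  also have "\<dots> \<le> ennreal (2 powr r) * (moment M r f + moment M r f)"
    using r by (intro mult_left_mono add_right_mono Q_moment_le) auto
  finally show ?thesis .
qed

text \<open>The difference at two times is the image, under a contraction, of the difference at the times
\<open>\<bar>s - s'\<bar>\<close> and 0.\<close>

lemma Q_uniform_continuity:
  assumes f [measurable]: "f \<in> borel_measurable M" and r: "1 \<le> r" and fin: "moment M r f < \<infinity>"
    and s: "0 \<le> s" "0 \<le> s'"
  shows "moment M r (\<lambda>x. Q s f x - Q s' f x) \<le> modulus r f \<bar>s - s'\<bar>"
proof -
  have *: "moment M r (\<lambda>x. Q (s + h) f x - Q s f x) \<le> modulus r f h" if s: "0 \<le> s" and h: "0 \<le> h" for s h
  proof (cases "s = 0 \<or> h = 0")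
    case True
    then show ?thesis using h by (auto simp: modulus_def Q_def moment_def)
  next
    case False
    then have s: "0 < s" and h: "0 < h" using s h by auto
    interpret S: contractive_kernel M "k s" "A * s powr (- \<gamma>)" by (rule k_contractive[OF s])
    interpret H: contractive_kernel M "k h" "A * h powr (- \<gamma>)" by (rule k_contractive[OF h])
    have finh: "moment M r (P h f) < \<infinity>" using H.kernel_op_moment_le[OF f r] fin by auto
    have "(\<lambda>x. Q (s + h) f x - Q s f x) = P s (\<lambda>x. P h f x - f x)"
      using P_semigroup[OF f r fin s h] S.kernel_op_diff[OF _ f r finh fin] s h by (auto simp: Q_def)
    then show ?thesis using S.kernel_op_moment_le[of "\<lambda>x. P h f x - f x" r] r h
      by (simp add: modulus_def Q_def)
  qed
  show ?thesis
  proof (cases "s' \<le> s")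
    case True
    then show ?thesis using *[of s' "s - s'"] s by simp
  next
    case False
    have "moment M r (\<lambda>x. Q s f x - Q s' f x) = moment M r (\<lambda>x. Q s' f x - Q s f x)"
      by (simp add: moment_def abs_minus_commute)
    then show ?thesis using *[of s "s' - s"] s False by simp
  qed
qed

end

section \<open>Subordination\<close>

text \<open>A mixture of the heat semigroup over random times \<open>\<tau> z\<close>, where \<open>z\<close> has the distribution \<open>\<nu>\<close>. For the
stable subordinator the scaling of the density makes all times \<open>t\<close> of the fractional semigroup such
mixtures, with one \<open>\<nu>\<close>.\<close>

locale subordinated_heat_family = heat_family M k A \<gamma> + nu: prob_space \<nu>
  for M :: "'a measure" and k A \<gamma> and \<nu> :: "real measure" +
  fixes D :: real
  assumes nu_sets [measurable_cong]: "sets \<nu> = sets borel"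
    and nu_pos: "AE z in \<nu>. 0 < z"
    and nu_moment: "(\<integral>\<^sup>+z. ennreal (z powr (- \<gamma>)) \<partial>\<nu>) \<le> ennreal D"
    and D_nonneg: "0 \<le> D" and \<gamma>_pos: "0 < \<gamma>"
begin

sublocale nuM: pair_sigma_finite \<nu> M ..

lemma kreg_row: "(\<integral>\<^sup>+y. ennreal (kreg s x y) \<partial>M) \<le> 1"
proof (cases "0 < s")
  case True
  have "(\<integral>\<^sup>+y. ennreal (kreg s x y) \<partial>M) = (\<integral>\<^sup>+y. ennreal (k s x y) \<partial>M)"
    using kreg_eq[of x] True by (intro nn_integral_cong_AE) (auto elim: eventually_mono)
  then show ?thesis using k_row[OF True] by simp
qed (simp add: kreg_def)

lemma kreg_column:
  assumes [measurable]: "g \<in> borel_measurable M"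
  shows "(\<integral>\<^sup>+x. \<integral>\<^sup>+y. ennreal (kreg s x y) * g y \<partial>M \<partial>M) \<le> (\<integral>\<^sup>+y. g y \<partial>M)"
proof (cases "0 < s")
  case True
  have "(\<integral>\<^sup>+y. ennreal (kreg s x y) * g y \<partial>M) = (\<integral>\<^sup>+y. ennreal (k s x y) * g y \<partial>M)" for x
    using kreg_eq[of x] True by (intro nn_integral_cong_AE) (auto elim: eventually_mono)
  then show ?thesis using contractive_kernel.column_le[OF k_contractive[OF True] assms] by simp
qed (simp add: kreg_def)

definition Ksub :: "real \<Rightarrow> 'a \<Rightarrow> 'a \<Rightarrow> real" where
  "Ksub \<tau> x y = (\<integral>z. kreg (\<tau> * z) x y \<partial>\<nu>)"

definition T :: "real \<Rightarrow> ('a \<Rightarrow> real) \<Rightarrow> 'a \<Rightarrow> real" where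
  "T \<tau> g x = (\<integral>z. Q (\<tau> * z) g x \<partial>\<nu>)"

lemma T_zero: "T 0 g = g"
  by (simp add: T_def Q_def fun_eq_iff nu.prob_space)

lemma Ksub_nn_integral_le:
  assumes \<tau>: "0 < \<tau>"
  shows "(\<integral>\<^sup>+z. ennreal (kreg (\<tau> * z) x y) \<partial>\<nu>) \<le> ennreal (A * \<tau> powr (- \<gamma>) * D)"
proof -
  have "(\<integral>\<^sup>+z. ennreal (kreg (\<tau> * z) x y) \<partial>\<nu>) \<le> (\<integral>\<^sup>+z. ennreal (A * \<tau> powr (- \<gamma>)) * ennreal (z powr (- \<gamma>)) \<partial>\<nu>)"
  proof (rule nn_integral_mono_AE)
    show "AE z in \<nu>. ennreal (kreg (\<tau> * z) x y) \<le> ennreal (A * \<tau> powr (- \<gamma>)) * ennreal (z powr (- \<gamma>))"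
      using nu_pos
    proof eventually_elim
      case (elim z)
      have "kreg (\<tau> * z) x y \<le> A * \<tau> powr (- \<gamma>) * z powr (- \<gamma>)"
        using kreg_le[of "\<tau> * z" x y] \<tau> elim by (simp add: powr_mult)
      then show ?case using A_nonneg by (simp add: ennreal_mult[symmetric] ennreal_leI)
    qed
  qed
  also have "\<dots> = ennreal (A * \<tau> powr (- \<gamma>)) * (\<integral>\<^sup>+z. ennreal (z powr (- \<gamma>)) \<partial>\<nu>)"
    by (intro nn_integral_cmult) measurable
  also have "\<dots> \<le> ennreal (A * \<tau> powr (- \<gamma>)) * ennreal D"
    by (intro mult_left_mono nu_moment) auto
  also have "\<dots> = ennreal (A * \<tau> powr (- \<gamma>) * D)" using A_nonneg D_nonneg by (simp add: ennreal_mult)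
  finally show ?thesis .
qed

lemma Ksub_integrable:
  assumes \<tau>: "0 < \<tau>"
  shows "integrable \<nu> (\<lambda>z. kreg (\<tau> * z) x y)"
proof (rule integrableI_bounded)
  show "(\<integral>\<^sup>+z. ennreal (norm (kreg (\<tau> * z) x y)) \<partial>\<nu>) < \<infinity>"
    using le_less_trans[OF Ksub_nn_integral_le[OF \<tau>, of x y], of top] kreg_nonneg by simp
qed measurable

lemma Ksub_nn:
  assumes \<tau>: "0 < \<tau>"
  shows "ennreal (Ksub \<tau> x y) = (\<integral>\<^sup>+z. ennreal (kreg (\<tau> * z) x y) \<partial>\<nu>)"
  unfolding Ksub_def using kreg_nonneg by (intro nn_integral_eq_integral[symmetric] Ksub_integrable \<tau>) auto

lemma Ksub_contractive:
  assumes \<tau>: "0 < \<tau>"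
  shows "contractive_kernel M (Ksub \<tau>) (A * \<tau> powr (- \<gamma>) * D)"
proof
  show "(\<lambda>(x, y). Ksub \<tau> x y) \<in> borel_measurable (M \<Otimes>\<^sub>M M)"
    unfolding Ksub_def by measurable
  show "0 \<le> Ksub \<tau> x y" for x y unfolding Ksub_def using kreg_nonneg by simp
  show "Ksub \<tau> x y \<le> A * \<tau> powr (- \<gamma>) * D" for x y
    using Ksub_nn_integral_le[OF \<tau>, of x y] A_nonneg D_nonneg unfolding Ksub_nn[OF \<tau>, symmetric] by simp
  show "(\<integral>\<^sup>+y. ennreal (Ksub \<tau> x y) \<partial>M) \<le> 1" for x
  proof -
    have "(\<integral>\<^sup>+y. ennreal (Ksub \<tau> x y) \<partial>M) = (\<integral>\<^sup>+z. \<integral>\<^sup>+y. ennreal (kreg (\<tau> * z) x y) \<partial>M \<partial>\<nu>)"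
      unfolding Ksub_nn[OF \<tau>] by (rule nuM.Fubini') measurable
    also have "\<dots> \<le> (\<integral>\<^sup>+z. 1 \<partial>\<nu>)" by (intro nn_integral_mono kreg_row)
    finally show ?thesis by (simp add: nu.emeasure_space_1)
  qed
  show "(\<integral>\<^sup>+x. \<integral>\<^sup>+y. ennreal (Ksub \<tau> x y) * g y \<partial>M \<partial>M) \<le> (\<integral>\<^sup>+y. g y \<partial>M)"
    if [measurable]: "g \<in> borel_measurable M" for g
  proof -
    have "(\<integral>\<^sup>+x. \<integral>\<^sup>+y. ennreal (Ksub \<tau> x y) * g y \<partial>M \<partial>M)
        = (\<integral>\<^sup>+x. \<integral>\<^sup>+y. \<integral>\<^sup>+z. ennreal (kreg (\<tau> * z) x y) * g y \<partial>\<nu> \<partial>M \<partial>M)"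
      unfolding Ksub_nn[OF \<tau>] by (intro nn_integral_cong nn_integral_multc[symmetric]) measurable
    also have "\<dots> = (\<integral>\<^sup>+x. \<integral>\<^sup>+z. \<integral>\<^sup>+y. ennreal (kreg (\<tau> * z) x y) * g y \<partial>M \<partial>\<nu> \<partial>M)"
      by (intro nn_integral_cong nuM.Fubini') measurable
    also have "\<dots> = (\<integral>\<^sup>+z. \<integral>\<^sup>+x. \<integral>\<^sup>+y. ennreal (kreg (\<tau> * z) x y) * g y \<partial>M \<partial>M \<partial>\<nu>)"
      by (rule nuM.Fubini') measurable
    also have "\<dots> \<le> (\<integral>\<^sup>+z. (\<integral>\<^sup>+y. g y \<partial>M) \<partial>\<nu>)" by (intro nn_integral_mono kreg_column that)
    finally show ?thesis by (simp add: nu.emeasure_space_1)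
  qed
qed (rule space_UNIV)

context
  fixes g :: "'a \<Rightarrow> real" and r :: real
  assumes g [measurable]: "g \<in> borel_measurable M" and r: "1 \<le> r" and fin: "moment M r g < \<infinity>"
begin

lemma subordination_integrable:
  assumes \<tau>: "0 < \<tau>"
  shows "integrable (\<nu> \<Otimes>\<^sub>M M) (\<lambda>(z, y). kreg (\<tau> * z) x y * g y)"
proof (rule integrableI_bounded)
  interpret K: contractive_kernel M "Ksub \<tau>" "A * \<tau> powr (- \<gamma>) * D" by (rule Ksub_contractive[OF \<tau>])
  show "(\<lambda>(z, y). kreg (\<tau> * z) x y * g y) \<in> borel_measurable (\<nu> \<Otimes>\<^sub>M M)" by measurable
  have "(\<integral>\<^sup>+w. ennreal (norm (case w of (z, y) \<Rightarrow> kreg (\<tau> * z) x y * g y)) \<partial>(\<nu> \<Otimes>\<^sub>M M))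
      = (\<integral>\<^sup>+y. \<integral>\<^sup>+z. ennreal (norm (kreg (\<tau> * z) x y * g y)) \<partial>\<nu> \<partial>M)"
    by (subst nuM.nn_integral_snd[symmetric]) (simp_all add: case_prod_beta)
  also have "\<dots> = (\<integral>\<^sup>+y. ennreal (norm (Ksub \<tau> x y * g y)) \<partial>M)"
  proof (intro nn_integral_cong)
    fix y
    have "(\<integral>\<^sup>+z. ennreal (norm (kreg (\<tau> * z) x y * g y)) \<partial>\<nu>) = (\<integral>\<^sup>+z. ennreal (kreg (\<tau> * z) x y) * ennreal \<bar>g y\<bar> \<partial>\<nu>)"
      using kreg_nonneg by (intro nn_integral_cong) (simp add: abs_mult ennreal_mult)
    also have "\<dots> = ennreal (Ksub \<tau> x y) * ennreal \<bar>g y\<bar>"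
      unfolding Ksub_nn[OF \<tau>] by (intro nn_integral_multc) measurable
    finally show "(\<integral>\<^sup>+z. ennreal (norm (kreg (\<tau> * z) x y * g y)) \<partial>\<nu>) = ennreal (norm (Ksub \<tau> x y * g y))"
      using K.kernel_nonneg by (simp add: abs_mult ennreal_mult)
  qed
  also have "\<dots> < \<infinity>"
    using K.kernel_integrable[OF g r fin, of x] by (simp add: integrable_iff_bounded)
  finally show "(\<integral>\<^sup>+w. ennreal (norm (case w of (z, y) \<Rightarrow> kreg (\<tau> * z) x y * g y)) \<partial>(\<nu> \<Otimes>\<^sub>M M)) < \<infinity>" .
qed

lemma Q_eq_kreg: "0 < s \<Longrightarrow> Q s g x = (\<integral>y. kreg s x y * g y \<partial>M)"
  using P_kreg[OF g, of s x] by (simp add: Q_def kernel_op_def)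

text \<open>Fubini's theorem, with the absolute convergence supplied by the subordinated kernel acting on \<open>\<bar>g\<bar>\<close>.\<close>

lemma T_eq_kernel_op:
  assumes \<tau>: "0 < \<tau>"
  shows "T \<tau> g x = kernel_op M (Ksub \<tau>) g x"
proof -
  have "T \<tau> g x = (\<integral>z. \<integral>y. kreg (\<tau> * z) x y * g y \<partial>M \<partial>\<nu>)"
    unfolding T_def
  proof (rule integral_cong_AE)
    show "AE z in \<nu>. Q (\<tau> * z) g x = (\<integral>y. kreg (\<tau> * z) x y * g y \<partial>M)"
      using nu_pos by eventually_elim (use \<tau> in \<open>simp add: Q_eq_kreg\<close>)
  qed measurable
  also have "\<dots> = (\<integral>y. \<integral>z. kreg (\<tau> * z) x y * g y \<partial>\<nu> \<partial>M)"
    by (rule nuM.Fubini_integral[OF subordination_integrable[OF \<tau>], symmetric])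
  finally show ?thesis by (simp add: kernel_op_def Ksub_def)
qed

lemma Q_scaled_integrable:
  assumes \<tau>: "0 \<le> \<tau>"
  shows "integrable \<nu> (\<lambda>z. Q (\<tau> * z) g x)"
proof (cases "\<tau> = 0")
  case False
  then have \<tau>: "0 < \<tau>" using assms by simp
  have "integrable \<nu> (\<lambda>z. \<integral>y. kreg (\<tau> * z) x y * g y \<partial>M)"
    using nuM.integrable_fst[OF subordination_integrable[OF \<tau>]] by simp
  moreover have "AE z in \<nu>. Q (\<tau> * z) g x = (\<integral>y. kreg (\<tau> * z) x y * g y \<partial>M)"
    using nu_pos by eventually_elim (use \<tau> in \<open>simp add: Q_eq_kreg\<close>)
  ultimately show ?thesis
    by (subst integrable_cong_AE) (auto dest: borel_measurable_integrable)
qed (simp add: Q_def)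

lemma T_measurable [measurable (raw)]:
  assumes [measurable]: "\<tau> \<in> borel_measurable N" "x \<in> N \<rightarrow>\<^sub>M M"
  shows "(\<lambda>w. T (\<tau> w) g (x w)) \<in> borel_measurable N"
  unfolding T_def by measurable

lemma moment_T_measurable [measurable]: "(\<lambda>\<tau>. moment M p (T \<tau> g)) \<in> borel_measurable borel"
  unfolding moment_def by measurable

lemma T_moment_le:
  assumes \<tau>: "0 \<le> \<tau>"
  shows "moment M r (T \<tau> g) \<le> moment M r g"
proof (cases "\<tau> = 0")
  case False
  then have \<tau>: "0 < \<tau>" using assms by simp
  have "T \<tau> g = kernel_op M (Ksub \<tau>) g" using T_eq_kernel_op[OF \<tau>] by auto
  then show ?thesis using contractive_kernel.kernel_op_moment_le[OF Ksub_contractive[OF \<tau>] g r] by simp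
qed (simp add: T_zero)

lemma T_sup_le:
  assumes \<tau>: "0 < \<tau>" and N: "0 \<le> N" "moment M r g \<le> ennreal N"
  shows "\<bar>T \<tau> g x\<bar> \<le> (A * \<tau> powr (- \<gamma>) * D * N) powr (1 / r)"
  using contractive_kernel.kernel_op_sup_real[OF Ksub_contractive[OF \<tau>] g r N(2,1)] T_eq_kernel_op[OF \<tau>] by simp

lemma T_moment_improves:
  assumes \<tau>: "0 < \<tau>" and N: "0 \<le> N" "moment M r g \<le> ennreal N" and p: "r \<le> p"
  shows "moment M p (T \<tau> g) \<le> ennreal ((A * \<tau> powr (- \<gamma>) * D) powr ((p - r) / r) * N powr (p / r))"
proof -
  have "T \<tau> g = kernel_op M (Ksub \<tau>) g" using T_eq_kernel_op[OF \<tau>] by auto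
  then show ?thesis
    using contractive_kernel.kernel_op_improves[OF Ksub_contractive[OF \<tau>] g r p N(2,1)] by simp
qed

text \<open>Jensen's inequality for \<open>\<nu>\<close>. The identity \<open>\<tau> z - \<tau>' z = (\<tau> - \<tau>') z\<close> lets the modulus of the heat semigroup
bound the difference.\<close>

lemma T_difference_le:
  assumes \<tau>: "0 \<le> \<tau>" "0 \<le> \<tau>'"
  shows "moment M r (\<lambda>x. T \<tau> g x - T \<tau>' g x) \<le> (\<integral>\<^sup>+z. modulus r g (\<bar>\<tau> - \<tau>'\<bar> * z) \<partial>\<nu>)"
proof -
  have "moment M r (\<lambda>x. T \<tau> g x - T \<tau>' g x)
     \<le> (\<integral>\<^sup>+x. \<integral>\<^sup>+z. ennreal (\<bar>Q (\<tau> * z) g x - Q (\<tau>' * z) g x\<bar> powr r) \<partial>\<nu> \<partial>M)"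
    unfolding moment_def
  proof (intro nn_integral_mono)
    fix x
    have "T \<tau> g x - T \<tau>' g x = (\<integral>z. 1 * (Q (\<tau> * z) g x - Q (\<tau>' * z) g x) \<partial>\<nu>)"
      unfolding T_def using Q_scaled_integrable \<tau> by simp
    then show "ennreal (\<bar>T \<tau> g x - T \<tau>' g x\<bar> powr r) \<le> (\<integral>\<^sup>+z. ennreal (\<bar>Q (\<tau> * z) g x - Q (\<tau>' * z) g x\<bar> powr r) \<partial>\<nu>)"
      using weighted_jensen[of "\<lambda>_. 1" \<nu> "\<lambda>z. Q (\<tau> * z) g x - Q (\<tau>' * z) g x" 1 r] r nu.emeasure_space_1
      by simp
  qed
  also have "\<dots> = (\<integral>\<^sup>+z. moment M r (\<lambda>x. Q (\<tau> * z) g x - Q (\<tau>' * z) g x) \<partial>\<nu>)"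
    unfolding moment_def by (rule nuM.Fubini') measurable
  also have "\<dots> \<le> (\<integral>\<^sup>+z. modulus r g (\<bar>\<tau> - \<tau>'\<bar> * z) \<partial>\<nu>)"
  proof (rule nn_integral_mono_AE)
    show "AE z in \<nu>. moment M r (\<lambda>x. Q (\<tau> * z) g x - Q (\<tau>' * z) g x) \<le> modulus r g (\<bar>\<tau> - \<tau>'\<bar> * z)"
      using nu_pos
    proof eventually_elim
      case (elim z)
      have "\<bar>\<tau> * z - \<tau>' * z\<bar> = \<bar>\<tau> - \<tau>'\<bar> * z"
        using elim by (simp add: abs_mult flip: left_diff_distrib)
      then show ?case using Q_uniform_continuity[OF g r fin, of "\<tau> * z" "\<tau>' * z"] elim \<tau> by simp
    qed
  qed
  finally show ?thesis .
qed

lemma T_continuous: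
  assumes \<tau>: "0 \<le> \<tau>" and r1: "1 < r"
  shows "((\<lambda>\<tau>'. moment M r (\<lambda>x. T \<tau>' g x - T \<tau> g x)) \<longlongrightarrow> 0) (at \<tau> within {0..})"
proof -
  define \<Omega> where "\<Omega> h = (\<integral>\<^sup>+z. modulus r g (h * z) \<partial>\<nu>)" for h
  have \<Omega>: "(\<Omega> \<longlongrightarrow> 0) (at_right 0)"
  proof (subst tendsto_at_iff_sequentially, intro allI impI)
    fix X :: "nat \<Rightarrow> real" assume X: "\<forall>i. X i \<in> {0<..} - {0}" "X \<longlonglongrightarrow> 0"
    have "(\<lambda>i. \<Omega> (X i)) \<longlonglongrightarrow> (\<integral>\<^sup>+z. 0 \<partial>\<nu>)"
      unfolding \<Omega>_def
    proof (rule nn_integral_dominated_convergence[where w = "\<lambda>_. ennreal (2 powr r) * (moment M r g + moment M r g)"])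
      show "AE z in \<nu>. modulus r g (X i * z) \<le> ennreal (2 powr r) * (moment M r g + moment M r g)" for i
        using modulus_le[OF g r] by simp
      show "(\<integral>\<^sup>+z. ennreal (2 powr r) * (moment M r g + moment M r g) \<partial>\<nu>) < \<infinity>"
        using fin by (simp add: nu.emeasure_space_1 ennreal_mult_less_top)
      show "AE z in \<nu>. (\<lambda>i. modulus r g (X i * z)) \<longlonglongrightarrow> 0"
        using nu_pos
      proof eventually_elim
        case (elim z)
        have "(\<lambda>i. X i * z) \<longlonglongrightarrow> 0 * z" by (intro tendsto_mult X tendsto_const)
        then have "filterlim (\<lambda>i. X i * z) (at_right 0) sequentially"
          using X elim by (intro filterlim_at_withinI) auto
        then show ?case by (rule filterlim_compose[OF modulus_tendsto[OF g r1 fin]])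
      qed
    qed measurable
    then show "(\<Omega> \<circ> X) \<longlonglongrightarrow> 0" by (simp add: comp_def)
  qed
  show ?thesis
  proof (rule tendsto_sandwich[OF _ _ tendsto_const])
    show "\<forall>\<^sub>F \<tau>' in at \<tau> within {0..}. moment M r (\<lambda>x. T \<tau>' g x - T \<tau> g x) \<le> \<Omega> \<bar>\<tau>' - \<tau>\<bar>"
      using T_difference_le \<tau> by (auto simp: eventually_at_filter \<Omega>_def)
    have "filterlim (\<lambda>\<tau>'. \<bar>\<tau>' - \<tau>\<bar>) (at_right 0) (at \<tau> within {0..})"
    proof (rule filterlim_at_withinI)
      have "((\<lambda>\<tau>'. \<bar>\<tau>' - \<tau>\<bar>) \<longlongrightarrow> \<bar>\<tau> - \<tau>\<bar>) (at \<tau> within {0..})" by (intro tendsto_intros)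
      then show "((\<lambda>\<tau>'. \<bar>\<tau>' - \<tau>\<bar>) \<longlongrightarrow> 0) (at \<tau> within {0..})" by simp
      show "\<forall>\<^sub>F \<tau>' in at \<tau> within {0..}. \<bar>\<tau>' - \<tau>\<bar> \<in> {0<..} - {0}"
        by (auto simp: eventually_at_filter)
    qed
    then show "((\<lambda>\<tau>'. \<Omega> \<bar>\<tau>' - \<tau>\<bar>) \<longlongrightarrow> 0) (at \<tau> within {0..})"
      by (rule filterlim_compose[OF \<Omega>])
  qed auto
qed

text \<open>Near a positive \<open>\<tau>\<close> the functions are uniformly bounded, so convergence in \<open>L\<^sup>r\<close> implies convergence in
\<open>L\<^sup>p\<close>.\<close>

lemma T_continuous_improved:
  assumes \<tau>: "0 < \<tau>" and r1: "1 < r" and p: "r \<le> p"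
  shows "((\<lambda>\<tau>'. moment M p (\<lambda>x. T \<tau>' g x - T \<tau> g x)) \<longlongrightarrow> 0) (at \<tau> within {0..})"
proof -
  obtain N where N: "0 \<le> N" "moment M r g = ennreal N" using fin by (cases "moment M r g") auto
  define S where "S = 2 * (A * (\<tau> / 2) powr (- \<gamma>) * D * N) powr (1 / r)"
  have sup: "\<bar>T \<tau>' g x\<bar> \<le> S / 2" if \<tau>': "\<tau> / 2 \<le> \<tau>'" for \<tau>' x
  proof -
    have pos: "0 < \<tau>'" using \<tau> \<tau>' by simp
    have "\<tau>' powr (- \<gamma>) \<le> (\<tau> / 2) powr (- \<gamma>)"
      using powr_mono2'[of "- \<gamma>" "\<tau> / 2" \<tau>'] \<gamma>_pos \<tau> \<tau>' by simp
    then have "A * \<tau>' powr (- \<gamma>) * D * N \<le> A * (\<tau> / 2) powr (- \<gamma>) * D * N"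
      using A_nonneg D_nonneg N by (intro mult_right_mono mult_left_mono) auto
    then have "(A * \<tau>' powr (- \<gamma>) * D * N) powr (1 / r) \<le> (A * (\<tau> / 2) powr (- \<gamma>) * D * N) powr (1 / r)"
      using A_nonneg D_nonneg N r by (intro powr_mono2) auto
    then show ?thesis using T_sup_le[OF pos, of N x] N by (simp add: S_def)
  qed
  have "((\<lambda>\<tau>'. ennreal (S powr (p - r)) * moment M r (\<lambda>x. T \<tau>' g x - T \<tau> g x)) \<longlongrightarrow> ennreal (S powr (p - r)) * 0) (at \<tau> within {0..})"
    using \<tau> r1 by (intro ennreal_tendsto_cmult T_continuous) auto
  then have lim: "((\<lambda>\<tau>'. ennreal (S powr (p - r)) * moment M r (\<lambda>x. T \<tau>' g x - T \<tau> g x)) \<longlongrightarrow> 0) (at \<tau> within {0..})"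
    by simp
  show ?thesis
  proof (rule tendsto_sandwich[OF _ _ tendsto_const lim])
    have "\<forall>\<^sub>F \<tau>' in at \<tau> within {0..}. \<tau> / 2 < \<tau>'"
      by (rule order_tendstoD(1)[OF tendsto_ident_at]) (use \<tau> in simp)
    then show "\<forall>\<^sub>F \<tau>' in at \<tau> within {0..}. moment M p (\<lambda>x. T \<tau>' g x - T \<tau> g x)
       \<le> ennreal (S powr (p - r)) * moment M r (\<lambda>x. T \<tau>' g x - T \<tau> g x)"
    proof eventually_elim
      case (elim \<tau>')
      have "\<bar>T \<tau>' g x - T \<tau> g x\<bar> \<le> S" for x
        using sup[of \<tau>' x] sup[of \<tau> x] elim \<tau> by auto
      then show ?case using r p by (intro moment_interpolate) auto
    qed
  qed auto
qed

end

text \<open>The one-kernel estimate by a Hardy mean holds for each time with the same rearrangement, so the Hardy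
inequality integrates it in time.\<close>

lemma T_spacetime_estimate:
  assumes r: "1 < r" "r < p" "r \<le> q" and a: "0 < a" and q: "1 / q = (a * \<gamma>) * (1 / r - 1 / p)"
  shows "\<exists>C>0. \<forall>g N. g \<in> borel_measurable M \<longrightarrow> 0 \<le> N \<longrightarrow> moment M r g \<le> ennreal N \<longrightarrow>
      (\<integral>\<^sup>+t\<in>{0<..}. ennreal (enn2real (moment M p (T (t powr a) g)) powr (q / p)) \<partial>lborel)
        \<le> ennreal (C * N powr (q / r))"
proof -
  define b where "b = a * \<gamma>"
  have b: "0 < b" using a \<gamma>_pos by (simp add: b_def)
  define A1 where "A1 = max 1 (A * D)"
  define c where "c = A1 powr (1 - 1/p)"
  have c: "0 < c" by (simp add: c_def A1_def)
  from hardy_inequality[OF r b q[folded b_def]] obtain C where C: "0 < C" and hardy: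
    "\<forall>f N. f \<in> borel_measurable borel \<longrightarrow> (\<forall>u. 0 \<le> f u) \<longrightarrow> 0 \<le> N \<longrightarrow>
     (\<forall>u>0. f u powr r * u \<le> N) \<longrightarrow>
     (\<integral>\<^sup>+u\<in>{0<..}. ennreal (f u powr r) \<partial>lborel) \<le> ennreal N \<longrightarrow>
     (\<forall>t>0. hardy_mean p b f t < \<infinity>) \<and>
     (\<integral>\<^sup>+t\<in>{0<..}. ennreal (enn2real (hardy_mean p b f t) powr q) \<partial>lborel)
       \<le> ennreal (C * N powr (q / r))"
    by (elim exE conjE)
  show ?thesis
  proof (intro exI[of _ "c powr q * C"] conjI allI impI)
    show "0 < c powr q * C" using c C by simp
  next
    fix g :: "'a \<Rightarrow> real" and N :: real
    assume g [measurable]: "g \<in> borel_measurable M" and N: "0 \<le> N" "moment M r g \<le> ennreal N"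
    have r1: "1 \<le> r" using r by simp
    have fin: "moment M r g < \<infinity>" using N le_less_trans[OF N(2), of top] by simp
    note props = sigma_finite_measure_axioms g r1 N
    have H: "(\<forall>t>0. hardy_mean p b (rearrangement M g) t < \<infinity>) \<and>
       (\<integral>\<^sup>+t\<in>{0<..}. ennreal (enn2real (hardy_mean p b (rearrangement M g) t) powr q) \<partial>lborel)
         \<le> ennreal (C * N powr (q / r))"
      by (intro hardy[rule_format] rearrangement_weak[OF props] rearrangement_moment[OF props] rearrangement_nonneg N(1)) measurable
    have [measurable]: "hardy_mean p b (rearrangement M g) \<in> borel_measurable borel"
      unfolding hardy_mean_def[abs_def] by measurable
    have "(\<integral>\<^sup>+t\<in>{0<..}. ennreal (enn2real (moment M p (T (t powr a) g)) powr (q / p)) \<partial>lborel)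
      \<le> (\<integral>\<^sup>+t. ennreal (c powr q) * (ennreal (enn2real (hardy_mean p b (rearrangement M g) t) powr q) * indicator {0<..} t) \<partial>lborel)"
    proof (intro nn_integral_mono)
      fix t :: real
      show "ennreal (enn2real (moment M p (T (t powr a) g)) powr (q / p)) * indicator {0<..} t
        \<le> ennreal (c powr q) * (ennreal (enn2real (hardy_mean p b (rearrangement M g) t) powr q) * indicator {0<..} t)"
      proof (cases "0 < t")
        case True
        define h where "h = enn2real (hardy_mean p b (rearrangement M g) t)"
        have h: "0 \<le> h" by (simp add: h_def)
        have \<tau>: "0 < t powr a" using True by simp
        have B: "A * (t powr a) powr (- \<gamma>) * D \<le> A1 * t powr (- b)"
        proof -
          have "(t powr a) powr (- \<gamma>) = t powr (- b)" by (simp add: powr_powr b_def)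
          moreover have "(A * D) * t powr (- b) \<le> A1 * t powr (- b)"
            by (intro mult_right_mono) (auto simp: A1_def)
          ultimately show ?thesis by (simp add: mult_ac)
        qed
        have "T (t powr a) g = kernel_op M (Ksub (t powr a)) g"
          using T_eq_kernel_op[OF g r1 fin \<tau>] by auto
        moreover have "moment M p (kernel_op M (Ksub (t powr a)) g) \<le> ennreal ((c * h) powr p)"
          unfolding c_def h_def
        proof (rule contractive_kernel.kernel_op_le_hardy_mean[OF Ksub_contractive[OF \<tau>] g r1 N _ True _ B])
          show "hardy_mean p b (rearrangement M g) t < \<infinity>" using H True by blast
        qed (use r in \<open>auto simp: A1_def\<close>)
        ultimately have "moment M p (T (t powr a) g) \<le> ennreal ((c * h) powr p)" by simp
        then have "enn2real (moment M p (T (t powr a) g)) \<le> (c * h) powr p"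
          by (rule enn2real_leI[rotated]) simp
        then have "enn2real (moment M p (T (t powr a) g)) powr (q / p) \<le> ((c * h) powr p) powr (q / p)"
          using r by (intro powr_mono2) auto
        also have "\<dots> = c powr q * h powr q"
          using r by (simp add: powr_powr powr_mult)
        finally show ?thesis using True by (simp add: h_def ennreal_mult[symmetric] ennreal_leI)
      qed simp
    qed
    also have "\<dots> = ennreal (c powr q) * (\<integral>\<^sup>+t\<in>{0<..}. ennreal (enn2real (hardy_mean p b (rearrangement M g) t) powr q) \<partial>lborel)"
      by (intro nn_integral_cmult) measurable
    also have "\<dots> \<le> ennreal (c powr q) * ennreal (C * N powr (q / r))"
      using H by (intro mult_left_mono) auto
    also have "\<dots> = ennreal (c powr q * C * N powr (q / r))"
      using C by (simp add: ennreal_mult[symmetric] mult_ac)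
    finally show "(\<integral>\<^sup>+t\<in>{0<..}. ennreal (enn2real (moment M p (T (t powr a) g)) powr (q / p)) \<partial>lborel)
        \<le> ennreal (c powr q * C * N powr (q / r))" .
  qed
qed

end

section \<open>Representatives modulo null sets\<close>

lemma borel_measurable_completion_AE:
  fixes f g :: "'a \<Rightarrow> real"
  assumes fg: "AE x in M. f x = g x" and g: "g \<in> borel_measurable M"
  shows "f \<in> borel_measurable (completion M)"
proof (rule measurableI)
  fix B :: "real set" assume B: "B \<in> sets borel"
  show "f -` B \<inter> space (completion M) \<in> sets (completion M)"
  proof (rule completion.in_sets_AE)
    show "AE x in completion M. (x \<in> g -` B \<inter> space M) = (x \<in> f -` B \<inter> space (completion M))"
      using AE_completion[OF fg] by eventually_elim simp
    show "g -` B \<inter> space M \<in> sets (completion M)"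
      using measurable_sets[OF g B] by simp
  qed auto
qed simp

lemma integral_completion_AE:
  fixes f g :: "'a \<Rightarrow> real"
  assumes fg: "AE x in M. f x = g x" and g: "g \<in> borel_measurable M"
  shows "(\<integral>x. f x \<partial>completion M) = (\<integral>x. g x \<partial>M)"
proof -
  have "(\<integral>x. f x \<partial>completion M) = (\<integral>x. g x \<partial>completion M)"
    using borel_measurable_completion_AE[OF fg g] AE_completion[OF fg] measurable_completion[OF g]
    by (intro integral_cong_AE)
  then show ?thesis by (simp add: integral_completion[OF g])
qed

lemma Lp_norm_AE:
  assumes fg: "AE x in M. f x = g x" and g [measurable]: "g \<in> borel_measurable M"
  shows "Lp_norm M p f = enn2real (moment M p g) powr (1 / p)"
proof -
  have "AE x in M. \<bar>f x\<bar> powr p = \<bar>g x\<bar> powr p" using fg by eventually_elim simp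
  then have "(\<integral>x. \<bar>f x\<bar> powr p \<partial>completion M) = (\<integral>x. \<bar>g x\<bar> powr p \<partial>M)"
    by (rule integral_completion_AE) measurable
  also have "\<dots> = enn2real (moment M p g)"
    unfolding moment_def by (rule integral_eq_nn_integral) auto
  finally show ?thesis by (simp add: Lp_norm_def)
qed

lemma Lp_space_AE:
  assumes fg: "AE x in M. f x = g x" and g [measurable]: "g \<in> borel_measurable M"
  shows "f \<in> Lp_space M p \<longleftrightarrow> moment M p g < \<infinity>"
proof -
  note f [measurable] = borel_measurable_completion_AE[OF fg g]
  have "integrable (completion M) (\<lambda>x. \<bar>f x\<bar> powr p) \<longleftrightarrow> (\<integral>\<^sup>+x. ennreal (\<bar>f x\<bar> powr p) \<partial>completion M) < \<infinity>"
    by (simp add: integrable_iff_bounded)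
  also have "(\<integral>\<^sup>+x. ennreal (\<bar>f x\<bar> powr p) \<partial>completion M) = moment M p f"
    by (simp add: moment_def nn_integral_completion)
  also have "moment M p f = moment M p g" by (rule moment_cong_AE[OF fg])
  finally show ?thesis by (simp add: Lp_space_def)
qed

text \<open>The estimates are carried out for Borel functions; membership in \<open>L\<^sup>p\<close> and norms depend only on the class
modulo null sets.\<close>

lemma Lp_space_representative:
  assumes "f \<in> Lp_space M p"
  obtains g where "g \<in> borel_measurable M" "AE x in M. f x = g x" "moment M p g < \<infinity>"
proof -
  obtain g where g: "g \<in> borel_measurable M" "AE x in M. f x = g x"
    using assms completion_ex_borel_measurable_real[of f M] by (auto simp: Lp_space_def)
  then show ?thesis using Lp_space_AE[OF g(2,1), of p] assms by (intro that) auto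
qed

section \<open>Strong measurability of continuous orbits\<close>

lemma AE_lebesgue_on_nonzero:
  assumes I: "I \<in> sets lebesgue"
  shows "AE t in lebesgue_on I. t \<in> I \<and> t \<noteq> (0::real)"
proof -
  have "AE t in lebesgue. t \<noteq> (0::real)" by (rule AE_completion[OF AE_lborel_singleton])
  then show ?thesis using I by (subst AE_restrict_space_iff) (auto elim: eventually_mono)
qed

text \<open>The approximation is constant between grid points and vanishes beyond time \<open>n\<close>, so it takes finitely many
values. The orbit is defined for all positive times, hence the grid point to the right of \<open>t\<close> need not lie
in \<open>I\<close>.\<close>

lemma strongly_measurable_on_continuous:
  fixes u :: "real \<Rightarrow> 'v::minus"
  assumes I: "I \<in> sets lebesgue" "I \<subseteq> {0..}" and X: "\<And>t. 0 < t \<Longrightarrow> u t \<in> X" and z: "z \<in> X"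
    and N0: "\<And>t. 0 < t \<Longrightarrow> N (u t - u t) = 0"
    and cont: "\<And>t. 0 < t \<Longrightarrow> ((\<lambda>s. N (u s - u t)) \<longlongrightarrow> 0) (at t within {0..})"
  shows "strongly_measurable_on I X N u"
proof -
  define g where "g n t = (if 0 < t \<and> t \<le> real n then u (grid n t) else z)"
    for n :: nat and t :: real
  define h where "h n t = (if 0 < t \<and> t \<le> real n then \<lceil>real (Suc n) * t\<rceil> else 0)" for n :: nat and t :: real
  have ceil_pos: "0 < \<lceil>real (Suc n) * t\<rceil>" if "0 < t" for n t using that by simp
  have gh: "g n t = (if 0 < h n t then u (real_of_int (h n t) / real (Suc n)) else z)" for n t
    using ceil_pos by (auto simp: g_def h_def)
  have hmeas: "h n \<in> borel \<rightarrow>\<^sub>M count_space UNIV" for n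
    unfolding h_def[abs_def] by measurable
  show ?thesis
    unfolding strongly_measurable_on_def
  proof (intro exI[of _ g] conjI allI)
    fix n
    have "h n t \<in> {0..\<lceil>real (Suc n) * real n\<rceil>}" for t
    proof -
      define x y where "x = real (Suc n) * t" and "y = real (Suc n) * real n"
      have y: "0 \<le> y" by (simp add: y_def)
      have "0 < t \<Longrightarrow> 0 \<le> x" "t \<le> real n \<Longrightarrow> x \<le> y"
        unfolding x_def y_def by (simp, intro mult_left_mono) simp_all
      then have "(if 0 < t \<and> t \<le> real n then \<lceil>x\<rceil> else 0) \<in> {0..\<lceil>y\<rceil>}"
        using y by (auto intro: ceiling_mono)
      then show ?thesis by (simp only: h_def x_def y_def)
    qed
    then have "g n ` I \<subseteq> (\<lambda>i. if 0 < i then u (real_of_int i / real (Suc n)) else z) ` {0..\<lceil>real (Suc n) * real n\<rceil>}"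
      unfolding gh by blast
    then show "finite (g n ` I)" by (rule finite_subset) simp
    have "0 < t \<Longrightarrow> 0 < grid n t" for t
      using ceil_pos[of t n] by (intro divide_pos_pos) auto
    then show "g n ` I \<subseteq> X" using X z by (auto simp: g_def)
    fix v
    have "{t \<in> I. g n t = v} = I \<inter> (h n -` {i. (if 0 < i then u (real_of_int i / real (Suc n)) else z) = v} \<inter> space borel)"
      by (auto simp: gh)
    moreover have "h n -` {i. (if 0 < i then u (real_of_int i / real (Suc n)) else z) = v} \<inter> space borel \<in> sets lebesgue"
      by (rule sets_completionI_sets, rule subst[where P = "\<lambda>S. _ \<in> S", OF sets_lborel[symmetric]],
          rule measurable_sets[OF hmeas]) simp
    ultimately show "{t \<in> I. g n t = v} \<in> sets lebesgue"
      using I(1) by (simp only: sets.Int)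
  next
    show "AE t in lebesgue_on I. (\<lambda>n. N (g n t - u t)) \<longlonglongrightarrow> 0"
      using AE_lebesgue_on_nonzero[OF I(1)]
    proof eventually_elim
      case (elim t)
      then have t: "0 < t" using I(2) by force
      define F where "F s = N (u s - u t)" for s
      have "F t = 0" using N0[OF t] by (simp add: F_def)
      then have "continuous (at t within {0..}) F"
        using cont[OF t] by (simp add: continuous_within F_def[abs_def])
      moreover have "0 \<le> grid n t" for n
        using ceiling_grid_ge[of t n] t by linarith
      ultimately have "(\<lambda>n. F (grid n t)) \<longlonglongrightarrow> F t"
        using ceiling_grid_tendsto[of t] by (auto simp: continuous_within_sequentially comp_def)
      moreover obtain m where m: "t \<le> real m" using real_arch_simple by blast
      have "\<forall>\<^sub>F n in sequentially. F (grid n t) = N (g n t - u t)"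
        using eventually_ge_at_top[of m] by eventually_elim (use t m in \<open>simp add: F_def g_def\<close>)
      ultimately show ?case
        unfolding \<open>F t = 0\<close> by (rule Lim_transform_eventually)
    qed
  qed
qed

section \<open>Orbits of the subordinated semigroup\<close>

lemma ennreal_reciprocal_cases:
  fixes q :: ennreal and d :: real
  assumes "1 / q = ennreal d" "0 \<le> d"
  shows "d = 0 \<and> q = \<infinity> \<or> 0 < d \<and> q = ennreal (1 / d)"
proof (cases q)
  case (real x)
  show ?thesis
  proof (cases "x = 0")
    case True
    then show ?thesis using assms real by (simp add: divide_ennreal_def)
  next
    case False
    then have "ennreal (1 / x) = ennreal d" using assms real divide_ennreal[of 1 x] by simp
    then have "1 / x = d" using assms real by simp
    then show ?thesis using False real by auto
  qed
next
  case top
  then show ?thesis using assms by simp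
qed

text \<open>The orbit \<open>u\<close> is given only up to null sets of the space, separately for each time, as is natural for a
semigroup on classes of functions. Time \<open>t\<close> corresponds to \<open>\<tau> = t\<^sup>a\<close>, with \<open>a = 1/\<alpha>\<close> for the fractional
semigroup.\<close>

context subordinated_heat_family
begin

context
  fixes u :: "real \<Rightarrow> 'a \<Rightarrow> real" and g \<phi> :: "'a \<Rightarrow> real" and a r :: real
  assumes g [measurable]: "g \<in> borel_measurable M" and r: "1 < r" and fin: "moment M r g < \<infinity>"
    and a: "0 < a" and \<phi>: "AE x in M. \<phi> x = g x"
    and u: "\<And>t. 0 \<le> t \<Longrightarrow> AE x in M. u t x = T (t powr a) g x"
begin

lemma r1: "1 \<le> r" using r by simp

lemma T_orbit_measurable [measurable]: "T \<tau> g \<in> borel_measurable M"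
  using T_measurable[OF g r1 fin, where \<tau> = "\<lambda>_. \<tau>" and x = "\<lambda>x. x" and N = M] by simp

lemma norm_phi: "Lp_norm M p \<phi> = enn2real (moment M p g) powr (1 / p)"
  by (rule Lp_norm_AE[OF \<phi> g])

lemma moment_g: "moment M r g \<le> ennreal (enn2real (moment M r g))"
  using fin by simp

lemma u_norm: "0 \<le> t \<Longrightarrow> Lp_norm M p (u t) = enn2real (moment M p (T (t powr a) g)) powr (1 / p)"
  by (rule Lp_norm_AE[OF u]) measurable

lemma u_space: "0 \<le> t \<Longrightarrow> u t \<in> Lp_space M p \<longleftrightarrow> moment M p (T (t powr a) g) < \<infinity>"
  by (rule Lp_space_AE[OF u]) measurable

lemma u_diff_norm:
  assumes "0 \<le> s" "0 \<le> t"
  shows "Lp_norm M p (u s - u t)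
    = enn2real (moment M p (\<lambda>x. T (s powr a) g x - T (t powr a) g x)) powr (1 / p)"
proof (rule Lp_norm_AE)
  show "AE x in M. (u s - u t) x = T (s powr a) g x - T (t powr a) g x"
    using u[OF assms(1)] u[OF assms(2)] by eventually_elim simp
qed measurable

lemma u_tendsto:
  assumes t: "0 \<le> t" and p: "0 < p" and I: "I \<subseteq> {0..}"
    and lim: "((\<lambda>\<tau>. moment M p (\<lambda>x. T \<tau> g x - T (t powr a) g x)) \<longlongrightarrow> 0) (at (t powr a) within {0..})"
  shows "((\<lambda>s. Lp_norm M p (u s - u t)) \<longlongrightarrow> 0) (at t within I)"
proof -
  define F where "F \<tau> = moment M p (\<lambda>x. T \<tau> g x - T (t powr a) g x)" for \<tau>
  have F0: "F (t powr a) = 0" by (simp add: F_def moment_def)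
  have nonneg: "\<forall>\<^sub>F s in at t within I. 0 \<le> s"
  proof (rule eventually_mono)
    show "\<forall>\<^sub>F s in at t within I. s \<in> I" by (simp add: eventually_at_filter)
  qed (use I in auto)
  have "continuous (at (t powr a) within {0..}) F"
    using lim F0 by (simp add: continuous_within F_def[abs_def])
  then have "continuous (at (t powr a) within (\<lambda>s. s powr a) ` I) F"
    by (rule continuous_within_subset) auto
  moreover have "continuous (at t within I) (\<lambda>s. s powr a)"
    unfolding continuous_within using a nonneg by (intro tendsto_powr' tendsto_ident_at tendsto_const) auto
  ultimately have "continuous (at t within I) (\<lambda>s. F (s powr a))"
    by (rule continuous_within_compose2[where f = "\<lambda>s. s powr a" and g = F, rotated])
  then have "((\<lambda>s. F (s powr a)) \<longlongrightarrow> ennreal 0) (at t within I)"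
    by (simp add: continuous_within F0)
  then have "((\<lambda>s. enn2real (F (s powr a))) \<longlongrightarrow> 0) (at t within I)"
    by (rule tendsto_enn2real) simp
  then have "((\<lambda>s. enn2real (F (s powr a)) powr (1 / p)) \<longlongrightarrow> 0) (at t within I)"
    using p by (intro tendsto_zero_powrI[OF _ tendsto_const]) auto
  moreover have "\<forall>\<^sub>F s in at t within I. enn2real (F (s powr a)) powr (1 / p) = Lp_norm M p (u s - u t)"
    using nonneg by eventually_elim (use t in \<open>simp add: u_diff_norm F_def\<close>)
  ultimately show ?thesis by (rule Lim_transform_eventually)
qed

lemma u_contraction:
  assumes t: "0 \<le> t"
  shows "u t \<in> Lp_space M r" "Lp_norm M r (u t) \<le> Lp_norm M r \<phi>"
proof -
  have le: "moment M r (T (t powr a) g) \<le> moment M r g"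
    by (rule T_moment_le[OF g r1 fin]) simp
  show "u t \<in> Lp_space M r" unfolding u_space[OF t] using le fin by simp
  show "Lp_norm M r (u t) \<le> Lp_norm M r \<phi>"
    unfolding u_norm[OF t] norm_phi using r1 le fin
    by (intro powr_mono2 enn2real_mono) auto
qed

lemma u_Cb_space:
  assumes I: "I \<subseteq> {0..}"
  shows "u \<in> Cb_space I (Lp_space M r) (Lp_norm M r)"
proof -
  have "u t \<in> Lp_space M r \<and> ((\<lambda>s. Lp_norm M r (u s - u t)) \<longlongrightarrow> 0) (at t within I)" if "t \<in> I" for t
  proof
    have t: "0 \<le> t" using that I by auto
    show "u t \<in> Lp_space M r" by (rule u_contraction(1)[OF t])
    show "((\<lambda>s. Lp_norm M r (u s - u t)) \<longlongrightarrow> 0) (at t within I)"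
      using r by (intro u_tendsto t I T_continuous[OF g r1 fin _ r]) auto
  qed
  moreover have "Lp_norm M r (u t) \<le> Lp_norm M r \<phi>" if "t \<in> I" for t
    using u_contraction(2)[of t] that I by auto
  ultimately show ?thesis unfolding Cb_space_def C_space_def by blast
qed

text \<open>The norm from \<open>L\<^sup>r\<close> to \<open>L\<^sup>p\<close> is the kernel bound to the power \<open>1/r - 1/p\<close>, which is \<open>t\<close> to the power
\<open>-1/q\<close> for generalized admissible exponents.\<close>

lemma u_decay:
  assumes t: "0 < t" and p: "r \<le> p"
  shows "u t \<in> Lp_space M p"
    "Lp_norm M p (u t) \<le> (A * D) powr (1/r - 1/p) * t powr (- (a * \<gamma> * (1/r - 1/p))) * Lp_norm M r \<phi>"
proof -
  define N where "N = enn2real (moment M r g)"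
  have N: "0 \<le> N" by (simp add: N_def)
  have \<tau>: "0 < t powr a" using t by simp
  have le: "moment M p (T (t powr a) g) \<le> ennreal ((A * (t powr a) powr (- \<gamma>) * D) powr ((p - r) / r) * N powr (p / r))"
    unfolding N_def by (intro T_moment_improves[OF g r1 fin \<tau> _ moment_g p]) simp
  show "u t \<in> Lp_space M p" using u_space[of t p] t le_less_trans[OF le, of top] by simp
  have "Lp_norm M p (u t) \<le> ((A * (t powr a) powr (- \<gamma>) * D) powr ((p - r) / r) * N powr (p / r)) powr (1 / p)"
    using u_norm[of t p] t p r le by (simp add: powr_mono2 enn2real_leI)
  also have "\<dots> = (A * (t powr a) powr (- \<gamma>) * D) powr (1/r - 1/p) * N powr (1 / r)"
  proof -
    have e1: "(p - r) / r * (1 / p) = 1/r - 1/p" using p r by (simp add: field_simps)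
    have e2: "p / r * (1 / p) = 1 / r" using p r by simp
    have "(X powr ((p - r) / r) * N powr (p / r)) powr (1 / p) = X powr ((p - r) / r * (1 / p)) * N powr (p / r * (1 / p))" for X
      by (subst powr_mult, subst powr_powr, subst powr_powr) (rule refl)
    then have "(X powr ((p - r) / r) * N powr (p / r)) powr (1 / p) = X powr (1/r - 1/p) * N powr (1 / r)" for X
      unfolding e1 e2 .
    then show ?thesis .
  qed
  also have "A * (t powr a) powr (- \<gamma>) * D = (A * D) * t powr (- (a * \<gamma>))"
    by (simp add: powr_powr mult_ac)
  also have "((A * D) * t powr (- (a * \<gamma>))) powr (1/r - 1/p) = (A * D) powr (1/r - 1/p) * t powr (- (a * \<gamma> * (1/r - 1/p)))"
    by (simp add: powr_mult powr_powr)
  finally show "Lp_norm M p (u t) \<le> (A * D) powr (1/r - 1/p) * t powr (- (a * \<gamma> * (1/r - 1/p))) * Lp_norm M r \<phi>"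
    by (simp add: norm_phi N_def)
qed

lemma u_continuous_positive:
  assumes t: "0 < t" and p: "r \<le> p" and I: "I \<subseteq> {0..}"
  shows "((\<lambda>s. Lp_norm M p (u s - u t)) \<longlongrightarrow> 0) (at t within I)"
  using t p r by (intro u_tendsto I T_continuous_improved[OF g r1 fin]) auto

lemma u_Csigma_space:
  assumes p: "r \<le> p" and q: "1 / q = ennreal (a * \<gamma> * (1/r - 1/p))"
    and J: "J \<subseteq> {0..}" "J \<noteq> {}" "0 \<in> J \<Longrightarrow> \<phi> \<in> Lp_space M p"
  shows "u \<in> Csigma_space q J (Lp_space M p) (Lp_norm M p)"
    "Csigma_norm q J (Lp_norm M p) u \<le> ((A * D) powr (1/r - 1/p) + 1) * Lp_norm M r \<phi>"
proof -
  define d where "d = a * \<gamma> * (1/r - 1/p)"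
  have d: "0 \<le> d" using a \<gamma>_pos p r by (simp add: d_def field_simps)
  have cases: "d = 0 \<and> q = \<infinity> \<or> 0 < d \<and> q = ennreal (1 / d)"
    using q d by (intro ennreal_reciprocal_cases) (simp_all add: d_def)
  have w: "time_weight q t = (if d = 0 then 1 else t powr d)" for t
    using cases by (auto simp: time_weight_def)
  have p1: "1 < p" using p r by simp
  have bound: "time_weight q t * Lp_norm M p (u t) \<le> ((A * D) powr (1/r - 1/p) + 1) * Lp_norm M r \<phi>"
    if t: "0 \<le> t" for t
  proof (cases "t = 0")
    case True
    show ?thesis
    proof (cases "d = 0")
      case d0: True
      then have "p = r" using a \<gamma>_pos p1 r by (auto simp: d_def)
      have "Lp_norm M r (u t) \<le> 1 * Lp_norm M r \<phi>" using u_contraction(2)[OF t] by simp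
      also have "\<dots> \<le> ((A * D) powr (1/r - 1/p) + 1) * Lp_norm M r \<phi>"
        by (intro mult_right_mono) (auto simp: Lp_norm_def)
      finally show ?thesis using d0 \<open>p = r\<close> by (simp add: w)
    next
      case False
      then show ?thesis using True by (simp add: w Lp_norm_def)
    qed
  next
    case False
    then have t: "0 < t" using t by simp
    have wt: "time_weight q t = t powr d" using t by (simp add: w)
    have "time_weight q t * Lp_norm M p (u t)
       \<le> t powr d * ((A * D) powr (1/r - 1/p) * t powr (- d) * Lp_norm M r \<phi>)"
      unfolding wt using u_decay(2)[OF t p] by (intro mult_left_mono) (auto simp: d_def)
    also have "\<dots> = (A * D) powr (1/r - 1/p) * Lp_norm M r \<phi>"
      using t by (simp add: powr_minus)
    also have "\<dots> \<le> ((A * D) powr (1/r - 1/p) + 1) * Lp_norm M r \<phi>"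
      by (intro mult_right_mono) (auto simp: Lp_norm_def)
    finally show ?thesis .
  qed
  have "u t \<in> Lp_space M p \<and> ((\<lambda>s. Lp_norm M p (u s - u t)) \<longlongrightarrow> 0) (at t within J)" if tJ: "t \<in> J" for t
  proof (cases "t = 0")
    case True
    have "moment M p g < \<infinity>" using Lp_space_AE[OF \<phi> g] J(3) tJ True by auto
    then have "((\<lambda>\<tau>. moment M p (\<lambda>x. T \<tau> g x - T (t powr a) g x)) \<longlongrightarrow> 0) (at (t powr a) within {0..})"
      using p1 by (intro T_continuous[OF g]) auto
    moreover have "u t \<in> Lp_space M p"
      using u_space[of t p] True \<open>moment M p g < \<infinity>\<close> by (simp add: T_zero)
    ultimately show ?thesis using True p1 J(1) by (auto intro!: u_tendsto)
  next
    case False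
    then have "0 < t" using tJ J(1) by force
    then show ?thesis using u_decay(1)[OF _ p] u_continuous_positive[OF _ p J(1)] by auto
  qed
  moreover have "bdd_above ((\<lambda>t. time_weight q t * Lp_norm M p (u t)) ` J)"
    using bound J(1) by (intro bdd_aboveI2) auto
  ultimately show "u \<in> Csigma_space q J (Lp_space M p) (Lp_norm M p)"
    by (simp add: Csigma_space_def C_space_def)
  show "Csigma_norm q J (Lp_norm M p) u \<le> ((A * D) powr (1/r - 1/p) + 1) * Lp_norm M r \<phi>"
    unfolding Csigma_norm_def using bound J by (intro cSUP_least) auto
qed

text \<open>Joint measurability in time and space makes the norm measurable in time by Tonelli's theorem.\<close>

lemma u_norm_measurable:
  assumes I: "I \<in> sets lebesgue" "I \<subseteq> {0..}"
  shows "(\<lambda>t. Lp_norm M p (u t)) \<in> borel_measurable (lebesgue_on I)"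
proof -
  have [measurable]: "(\<lambda>\<tau>. moment M p (T \<tau> g)) \<in> borel_measurable borel"
    by (rule moment_T_measurable[OF g r1 fin])
  have "(\<lambda>t. enn2real (moment M p (T (t powr a) g)) powr (1 / p)) \<in> borel_measurable lborel"
    by measurable
  then have "(\<lambda>t. enn2real (moment M p (T (t powr a) g)) powr (1 / p)) \<in> borel_measurable (lebesgue_on I)"
    by (intro measurable_restrict_space1 measurable_completion)
  moreover have "Lp_norm M p (u t) = enn2real (moment M p (T (t powr a) g)) powr (1 / p)" if "t \<in> space (lebesgue_on I)" for t
    using that I by (intro u_norm) auto
  ultimately show ?thesis by (subst measurable_cong)
qed

lemma u_strongly_measurable:
  assumes I: "I \<in> sets lebesgue" "I \<subseteq> {0..}" and p: "r \<le> p"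
  shows "strongly_measurable_on I (Lp_space M p) (Lp_norm M p) u"
proof (rule strongly_measurable_on_continuous[OF I, where z = "\<lambda>_. 0"])
  show "u t \<in> Lp_space M p" if "0 < t" for t by (rule u_decay(1)[OF that p])
  show "(\<lambda>_. 0) \<in> Lp_space M p" by (simp add: Lp_space_def)
  show "Lp_norm M p (u t - u t) = 0" for t by (simp add: Lp_norm_def)
  show "((\<lambda>s. Lp_norm M p (u s - u t)) \<longlongrightarrow> 0) (at t within {0..})" if "0 < t" for t
    by (rule u_continuous_positive[OF that p]) simp
qed

lemma u_AE_Lp_space:
  assumes I: "I \<in> sets lebesgue" "I \<subseteq> {0..}" and p: "r \<le> p"
  shows "AE t in lebesgue_on I. u t \<in> Lp_space M p"
  using AE_lebesgue_on_nonzero[OF I(1)]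
proof eventually_elim
  case (elim t)
  then have "0 < t" using I(2) by force
  then show ?case by (rule u_decay(1)[OF _ p])
qed

lemma u_Lq_space_infinite:
  assumes I: "I \<in> sets lebesgue" "I \<subseteq> {0..}"
  shows "u \<in> Lq_space \<infinity> I (Lp_space M r) (Lp_norm M r)"
    "Lq_norm \<infinity> I (Lp_norm M r) u \<le> 1 * Lp_norm M r \<phi>"
proof -
  have "esssup (lebesgue_on I) (\<lambda>t. ennreal (Lp_norm M r (u t))) \<le> ennreal (Lp_norm M r \<phi>)"
  proof (rule esssup_I)
    show "(\<lambda>t. ennreal (Lp_norm M r (u t))) \<in> borel_measurable (lebesgue_on I)"
      using u_norm_measurable[OF I] by measurable
    show "AE t in lebesgue_on I. ennreal (Lp_norm M r (u t)) \<le> ennreal (Lp_norm M r \<phi>)"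
      using I by (intro AE_I2 ennreal_leI u_contraction) auto
  qed
  moreover from this have "esssup (lebesgue_on I) (\<lambda>t. ennreal (Lp_norm M r (u t))) < \<infinity>"
    using le_less_trans[of _ "ennreal (Lp_norm M r \<phi>)" top] by simp
  ultimately show "u \<in> Lq_space \<infinity> I (Lp_space M r) (Lp_norm M r)"
    "Lq_norm \<infinity> I (Lp_norm M r) u \<le> 1 * Lp_norm M r \<phi>"
    using u_AE_Lp_space[OF I] u_strongly_measurable[OF I]
    by (auto simp: Lq_space_def Lq_norm_def Lp_norm_def intro!: enn2real_leI)
qed

lemma u_Lq_space_finite:
  assumes I: "I \<in> sets lebesgue" "I \<subseteq> {0..}" and p: "r \<le> p" and q: "0 < q" and C: "0 < C"
    and est: "(\<integral>\<^sup>+t\<in>{0<..}. ennreal (enn2real (moment M p (T (t powr a) g)) powr (q / p)) \<partial>lborel)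
        \<le> ennreal (C * enn2real (moment M r g) powr (q / r))"
  shows "u \<in> Lq_space (ennreal q) I (Lp_space M p) (Lp_norm M p)"
    "Lq_norm (ennreal q) I (Lp_norm M p) u \<le> C powr (1 / q) * Lp_norm M r \<phi>"
proof -
  define f where "f t = Lp_norm M p (u t) powr q" for t
  have [measurable]: "f \<in> borel_measurable (lebesgue_on I)"
    unfolding f_def[abs_def] using u_norm_measurable[OF I] by measurable
  have "(\<integral>\<^sup>+t. ennreal (f t) \<partial>lebesgue_on I) = (\<integral>\<^sup>+t. ennreal (f t) * indicator I t \<partial>lebesgue)"
    using I by (intro nn_integral_restrict_space) simp
  also have "\<dots> \<le> (\<integral>\<^sup>+t. ennreal (enn2real (moment M p (T (t powr a) g)) powr (q / p)) * indicator {0<..} t \<partial>lebesgue)"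
  proof (rule nn_integral_mono_AE)
    have "AE t in lebesgue. t \<noteq> (0::real)" by (rule AE_completion[OF AE_lborel_singleton])
    then show "AE t in lebesgue. ennreal (f t) * indicator I t
        \<le> ennreal (enn2real (moment M p (T (t powr a) g)) powr (q / p)) * indicator {0<..} t"
    proof eventually_elim
      case (elim t)
      show ?case
      proof (cases "t \<in> I")
        case True
        then have "0 < t" using I elim by force
        then show ?thesis using True p r by (simp add: f_def u_norm powr_powr)
      qed simp
    qed
  qed
  also have "\<dots> \<le> ennreal (C * enn2real (moment M r g) powr (q / r))"
    using est by (simp add: nn_integral_completion)
  finally have le: "(\<integral>\<^sup>+t. ennreal (f t) \<partial>lebesgue_on I) \<le> ennreal (C * enn2real (moment M r g) powr (q / r))" .
  have f0: "0 \<le> f t" for t by (simp add: f_def)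
  have int: "integrable (lebesgue_on I) f"
    using le_less_trans[OF le, of top] f0 by (intro integrableI_bounded) auto
  show "u \<in> Lq_space (ennreal q) I (Lp_space M p) (Lp_norm M p)"
    using int q u_AE_Lp_space[OF I p] u_strongly_measurable[OF I p]
    by (auto simp: Lq_space_def f_def[abs_def])
  have "(\<integral>t. f t \<partial>lebesgue_on I) = enn2real (\<integral>\<^sup>+t. ennreal (f t) \<partial>lebesgue_on I)"
    using f0 by (intro integral_eq_nn_integral) auto
  also have "\<dots> \<le> C * enn2real (moment M r g) powr (q / r)"
    using le C by (intro enn2real_leI) auto
  finally have "(\<integral>t. f t \<partial>lebesgue_on I) powr (1 / q) \<le> (C * enn2real (moment M r g) powr (q / r)) powr (1 / q)"
    using q f0 by (intro powr_mono2) auto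
  also have "\<dots> = C powr (1 / q) * Lp_norm M r \<phi>"
    using q by (simp add: powr_mult powr_powr norm_phi)
  finally show "Lq_norm (ennreal q) I (Lp_norm M p) u \<le> C powr (1 / q) * Lp_norm M r \<phi>"
    using q by (simp add: Lq_norm_def f_def)
qed

end

end

section \<open>The heat kernel and the stable subordinator\<close>

text \<open>A ball of infinite measure would make the upper bound 0, against positivity of the kernel.\<close>

lemma upper_bound_finite_balls:
  fixes \<mu> :: "'a::metric_space measure"
  assumes k: "\<And>s x y. 0 < s \<Longrightarrow> 0 < k s x y \<and>
      ennreal (k s x y) \<le> ennreal (c * exp (- C * (dist x y)\<^sup>2 / s)) / emeasure \<mu> (ball x (sqrt s))"
    and r: "0 < r"
  shows "emeasure \<mu> (ball x r) < \<infinity>"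
proof (rule ccontr)
  assume "\<not> emeasure \<mu> (ball x r) < \<infinity>"
  then have "emeasure \<mu> (ball x (sqrt (r\<^sup>2))) = top" using r by (simp add: not_less top_unique)
  then have "ennreal (k (r\<^sup>2) x x) \<le> 0" using k[of "r\<^sup>2" x x] r by simp
  then show False using k[of "r\<^sup>2" x x] r by (simp add: ennreal_eq_0_iff)
qed

lemma volume_lower_bound:
  fixes \<mu> :: "'a::metric_space measure"
  assumes "(INF (x, r) \<in> UNIV \<times> {0<..}. emeasure \<mu> (ball x r) / ennreal (r powr \<beta>)) > 0"
  shows "\<exists>v>0. \<forall>x. \<forall>r>0. ennreal (v * r powr \<beta>) \<le> emeasure \<mu> (ball x r)"
proof -
  obtain v where v: "0 < v"
    "ennreal v \<le> (INF (x, r) \<in> UNIV \<times> {0<..}. emeasure \<mu> (ball x r) / ennreal (r powr \<beta>))"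
    using assms by (rule ennreal_positive_real_below)
  show ?thesis
  proof (intro exI[of _ v] conjI allI impI)
    show "0 < v" by (rule v(1))
    fix x :: 'a and r :: real assume r: "0 < r"
    have "ennreal v \<le> emeasure \<mu> (ball x r) / ennreal (r powr \<beta>)"
      by (rule order_trans[OF v(2)], rule INF_lower2[of "(x, r)"]) (use r in auto)
    then have "ennreal v * ennreal (r powr \<beta>) \<le> emeasure \<mu> (ball x r) / ennreal (r powr \<beta>) * ennreal (r powr \<beta>)"
      by (rule mult_right_mono) simp
    also have "\<dots> = emeasure \<mu> (ball x r)"
      using r by (simp add: ennreal_divide_times)
    finally show "ennreal (v * r powr \<beta>) \<le> emeasure \<mu> (ball x r)"
      using v(1) by (simp add: ennreal_mult)
  qed
qed

text \<open>The Gaussian factor is at most 1; the volume of the ball of radius \<open>\<surd>s\<close> gives the power of \<open>s\<close>.\<close>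

lemma on_diagonal_bound:
  fixes \<mu> :: "'a::metric_space measure"
  assumes k: "\<And>s x y. 0 < s \<Longrightarrow> 0 < k s x y \<and>
      ennreal (k s x y) \<le> ennreal (c * exp (- C * (dist x y)\<^sup>2 / s)) / emeasure \<mu> (ball x (sqrt s))"
    and cC: "0 < c" "0 < C" and v: "0 < v" "\<And>x r. 0 < r \<Longrightarrow> ennreal (v * r powr \<beta>) \<le> emeasure \<mu> (ball x r)"
    and s: "0 < s"
  shows "k s x y \<le> c / v * s powr (- (\<beta> / 2))"
proof -
  have sq: "sqrt s powr \<beta> = s powr (\<beta> / 2)" using s by (simp add: powr_half_sqrt[symmetric] powr_powr)
  obtain e where e: "0 \<le> e" "emeasure \<mu> (ball x (sqrt s)) = ennreal e"
    using upper_bound_finite_balls[OF k, where x = x and r = "sqrt s"] s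
    by (cases "emeasure \<mu> (ball x (sqrt s))") auto
  have vs: "0 < v * s powr (\<beta> / 2)" "v * s powr (\<beta> / 2) \<le> e"
    using v(2)[of "sqrt s" x] v(1) s e by (auto simp: sq)
  have "ennreal (k s x y) \<le> ennreal (c * exp (- C * (dist x y)\<^sup>2 / s)) / ennreal e"
    using k[OF s, of x y] e by simp
  also have "\<dots> = ennreal (c * exp (- C * (dist x y)\<^sup>2 / s) / e)"
    using vs cC by (intro divide_ennreal) auto
  finally have "k s x y \<le> c * exp (- C * (dist x y)\<^sup>2 / s) / e"
    using e(1) cC by simp
  also have "\<dots> \<le> c / (v * s powr (\<beta> / 2))"
  proof (rule frac_le)
    have "- C * (dist x y)\<^sup>2 / s \<le> 0" using cC s by (intro divide_nonpos_pos) auto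
    then show "c * exp (- C * (dist x y)\<^sup>2 / s) \<le> c" using cC by simp
  qed (use vs cC in auto)
  also have "\<dots> = c / v * s powr (- (\<beta> / 2))" by (simp add: powr_minus field_simps)
  finally show ?thesis .
qed

lemma sigma_finite_balls:
  fixes \<mu> :: "'a::metric_space measure"
  assumes "sets \<mu> = sets borel" "\<And>x r. 0 < r \<Longrightarrow> emeasure \<mu> (ball x r) < \<infinity>"
  shows "sigma_finite_measure \<mu>"
proof
  define x :: 'a where "x = undefined"
  have sp: "space \<mu> = UNIV" using sets_eq_imp_space_eq[OF assms(1)] by simp
  show "\<exists>A. countable A \<and> A \<subseteq> sets \<mu> \<and> \<Union> A = space \<mu> \<and> (\<forall>a\<in>A. emeasure \<mu> a \<noteq> \<infinity>)"
  proof (intro exI[of _ "range (\<lambda>n::nat. ball x (real (Suc n)))"] conjI)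
    show "\<Union> (range (\<lambda>n::nat. ball x (real (Suc n)))) = space \<mu>"
    proof -
      have "\<exists>n::nat. dist x y < real (Suc n)" for y
      proof -
        obtain n :: nat where "dist x y < real n" using reals_Archimedean2 by blast
        then have "dist x y < real (Suc n)" by simp
        then show ?thesis by blast
      qed
      then show ?thesis by (auto simp: sp)
    qed
    show "\<forall>a\<in>range (\<lambda>n::nat. ball x (real (Suc n))). emeasure \<mu> a \<noteq> \<infinity>"
      using assms(2)[of "real (Suc n)" for n] by (auto simp: less_top)
  qed (auto simp: assms(1))
qed

text \<open>\<open>G\<close> consists of points whose row satisfies the heat kernel axioms at almost every \<open>y\<close>. Setting the other rows
and columns to 0 changes the kernel only on null sets. Measurability of the restriction needs \<open>G\<close> measurable,
so the exceptional set is enlarged to a measurable null set.\<close>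

lemma heat_kernel_regular_version:
  fixes \<mu> :: "'a::metric_space measure"
  assumes sets: "sets \<mu> = sets borel" and hk: "heat_kernel \<mu> k"
    and k: "\<And>s x y. 0 < s \<Longrightarrow> 0 < k s x y \<and>
      ennreal (k s x y) \<le> ennreal (c * exp (- C * (dist x y)\<^sup>2 / s)) / emeasure \<mu> (ball x (sqrt s))"
    and cC: "0 < c" "0 < C" and v: "0 < v" "\<And>x r. 0 < r \<Longrightarrow> ennreal (v * r powr \<beta>) \<le> emeasure \<mu> (ball x r)"
  obtains G where "G \<in> sets \<mu>" "AE x in \<mu>. x \<in> G"
    "heat_family \<mu> (\<lambda>t x y. if 0 < t \<and> x \<in> G \<and> y \<in> G then k t x y else 0) (c / v) (\<beta> / 2)"
proof -
  interpret sigma_finite_measure \<mu>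
    by (rule sigma_finite_balls[OF sets upper_bound_finite_balls[OF k]])
  have sp: "space \<mu> = UNIV" using sets_eq_imp_space_eq[OF sets] by simp
  have k0: "0 \<le> k t x y" if "0 < t" for t x y using k[OF that, of x y] by simp
  have km: "(\<lambda>(x, y). k t x y) \<in> borel_measurable (\<mu> \<Otimes>\<^sub>M \<mu>)" if "0 < t" for t
    using hk that by (simp add: heat_kernel_def)
  define \<Phi> where "\<Phi> x y \<longleftrightarrow> (\<forall>s>0. \<forall>t>0.
        0 \<le> k t x y \<and> (\<integral>\<^sup>+ z. ennreal (k t x z) \<partial>\<mu>) \<le> 1 \<and> k t x y = k t y x \<and>
        ennreal (k (s + t) x y) = (\<integral>\<^sup>+ z. ennreal (k s x z * k t z y) \<partial>\<mu>))" for x y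
  have "AE x in \<mu>. AE y in \<mu>. \<Phi> x y" using hk by (simp add: heat_kernel_def \<Phi>_def)
  then obtain N where N0: "{x \<in> space \<mu>. \<not> (AE y in \<mu>. \<Phi> x y)} \<subseteq> N" "emeasure \<mu> N = 0" "N \<in> sets \<mu>"
    by (rule AE_E)
  then have N: "\<And>x. x \<in> space \<mu> - N \<Longrightarrow> AE y in \<mu>. \<Phi> x y" "N \<in> null_sets \<mu>" by auto
  define G where "G = - N"
  have G: "G \<in> sets \<mu>" using sets.compl_sets[OF null_setsD2[OF N(2)]] sp by (simp add: G_def Compl_eq_Diff_UNIV)
  have AEG: "AE x in \<mu>. x \<in> G" using AE_not_in[OF N(2)] by (simp add: G_def)
  have \<Phi>: "AE y in \<mu>. \<Phi> x y" if "x \<in> G" for x using N(1)[of x] that sp by (simp add: G_def)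
  define K where "K = (\<lambda>t x y. if 0 < t \<and> x \<in> G \<and> y \<in> G then k t x y else 0)"
  \<comment> \<open>the row bound does not involve \<open>y\<close>, so it holds for good \<open>x\<close> because \<open>\<mu>\<close> is not the zero measure\<close>
  have row: "(\<integral>\<^sup>+z. ennreal (k t x z) \<partial>\<mu>) \<le> 1" if "x \<in> G" "0 < t" for x t
  proof (rule ccontr)
    assume n: "\<not> (\<integral>\<^sup>+z. ennreal (k t x z) \<partial>\<mu>) \<le> 1"
    have "AE y in \<mu>. False" using \<Phi>[OF that(1)]
      by eventually_elim (use n that(2) in \<open>auto simp: \<Phi>_def\<close>)
    then have "emeasure \<mu> (space \<mu>) = 0" by (subst (asm) AE_iff_measurable[OF _ refl]) auto
    then have "emeasure \<mu> (ball x 1) = 0"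
      using emeasure_mono[of "ball x 1" "space \<mu>" \<mu>] by (simp add: sp sets)
    then show False using v(2)[of 1 x] v(1) by simp
  qed
  interpret M: symmetric_markov_family \<mu> K "c / v" "\<beta> / 2"
  proof
    show "space \<mu> = UNIV" by (rule sp)
    show "(\<lambda>(x, y). K t x y) \<in> borel_measurable (\<mu> \<Otimes>\<^sub>M \<mu>)" for t
    proof (cases "0 < t")
      case True
      note [measurable] = km[OF True] G
      have "(\<lambda>w. if fst w \<in> G \<and> snd w \<in> G then case w of (x, y) \<Rightarrow> k t x y else 0) \<in> borel_measurable (\<mu> \<Otimes>\<^sub>M \<mu>)"
        by measurable
      then show ?thesis using True by (simp add: K_def case_prod_beta)
    qed (simp add: K_def)
    show "0 \<le> K t x y" if "0 < t" for t x y using k0[OF that] by (simp add: K_def)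
    show "K t x y \<le> c / v * t powr (- (\<beta> / 2))" if "0 < t" for t x y
      using on_diagonal_bound[OF k cC v that] cC v by (simp add: K_def)
    show "(\<integral>\<^sup>+y. ennreal (K t x y) \<partial>\<mu>) \<le> 1" if t: "0 < t" for t x
    proof (cases "x \<in> G")
      case True
      have "(\<integral>\<^sup>+y. ennreal (K t x y) \<partial>\<mu>) \<le> (\<integral>\<^sup>+y. ennreal (k t x y) \<partial>\<mu>)"
        using k0[OF t] by (intro nn_integral_mono) (auto simp: K_def)
      then show ?thesis using row[OF True t] by simp
    qed (simp add: K_def)
    show "AE y in \<mu>. \<forall>t>0. K t x y = K t y x" for x
    proof (cases "x \<in> G")
      case True
      show ?thesis using \<Phi>[OF True] by eventually_elim (auto simp: K_def \<Phi>_def)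
    qed (simp add: K_def)
    show "AE y in \<mu>. \<forall>s>0. \<forall>t>0. ennreal (K (s + t) x y) = (\<integral>\<^sup>+z. ennreal (K s x z * K t z y) \<partial>\<mu>)" for x
    proof (cases "x \<in> G")
      case True
      show ?thesis using \<Phi>[OF True] AEG
      proof eventually_elim
        case (elim y)
        show ?case
        proof (intro allI impI)
          fix s t :: real assume s: "0 < s" and t: "0 < t"
          have "(\<integral>\<^sup>+z. ennreal (K s x z * K t z y) \<partial>\<mu>) = (\<integral>\<^sup>+z. ennreal (k s x z * k t z y) \<partial>\<mu>)"
          proof (rule nn_integral_cong_AE)
            show "AE z in \<mu>. ennreal (K s x z * K t z y) = ennreal (k s x z * k t z y)"
              using AEG by eventually_elim (use True elim s t in \<open>simp add: K_def\<close>)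
          qed
          moreover have "ennreal (k (s + t) x y) = (\<integral>\<^sup>+z. ennreal (k s x z * k t z y) \<partial>\<mu>)"
            using elim(1) s t unfolding \<Phi>_def by blast
          moreover have "K (s + t) x y = k (s + t) x y" using elim True s t by (simp add: K_def)
          ultimately show "ennreal (K (s + t) x y) = (\<integral>\<^sup>+z. ennreal (K s x z * K t z y) \<partial>\<mu>)"
            by simp
        qed
      qed
    qed (simp add: K_def)
  qed
  have "heat_family \<mu> K (c / v) (\<beta> / 2)"
  proof
    fix f assume f [measurable]: "f \<in> borel_measurable \<mu>" and fin: "moment \<mu> 2 f < \<infinity>"
    have fL: "f \<in> Lp_space \<mu> 2" using Lp_space_AE[of f f \<mu> 2] fin by simp
    have lim: "((\<lambda>t. Lp_norm \<mu> 2 (heat_semigroup \<mu> k t f - f)) \<longlongrightarrow> 0) (at_right 0)"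
      by (rule hk[unfolded heat_kernel_def, THEN conjunct2, THEN conjunct2, rule_format, OF fL])
    have eq: "ennreal (Lp_norm \<mu> 2 (heat_semigroup \<mu> k t f - f) powr 2) = moment \<mu> 2 (\<lambda>x. kernel_op \<mu> (K t) f x - f x)"
      if t: "0 < t" for t
    proof -
      interpret T: contractive_kernel \<mu> "K t" "c / v * t powr (- (\<beta> / 2))" by (rule M.k_contractive[OF t])
      have "AE x in \<mu>. (heat_semigroup \<mu> k t f - f) x = kernel_op \<mu> (K t) f x - f x"
        using AEG
      proof eventually_elim
        case (elim x)
        have "AE y in \<mu>. k t x y * f y = K t x y * f y"
          using AEG by eventually_elim (use elim t in \<open>simp add: K_def\<close>)
        then have "heat_semigroup \<mu> k t f x = kernel_op \<mu> (K t) f x"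
          unfolding heat_semigroup_def kernel_op_def by (rule integral_completion_AE) measurable
        then show ?case by simp
      qed
      then have "Lp_norm \<mu> 2 (heat_semigroup \<mu> k t f - f) = enn2real (moment \<mu> 2 (\<lambda>x. kernel_op \<mu> (K t) f x - f x)) powr (1 / 2)"
        by (rule Lp_norm_AE) measurable
      moreover have "moment \<mu> 2 (\<lambda>x. kernel_op \<mu> (K t) f x - f x) < \<infinity>"
      proof -
        have "moment \<mu> 2 (\<lambda>x. kernel_op \<mu> (K t) f x - f x) \<le> ennreal (2 powr 2) * (moment \<mu> 2 (kernel_op \<mu> (K t) f) + moment \<mu> 2 f)"
          by (rule moment_diff_le) auto
        also have "\<dots> \<le> ennreal (2 powr 2) * (moment \<mu> 2 f + moment \<mu> 2 f)"
          by (intro mult_left_mono add_right_mono T.kernel_op_moment_le) auto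
        also have "\<dots> < \<infinity>" using fin by (simp add: ennreal_mult_less_top)
        finally show ?thesis .
      qed
      ultimately show ?thesis by (simp add: powr_powr)
    qed
    have "((\<lambda>t. Lp_norm \<mu> 2 (heat_semigroup \<mu> k t f - f) powr 2) \<longlongrightarrow> 0) (at_right 0)"
      using lim by (rule tendsto_zero_powrI[OF _ tendsto_const]) (auto simp: Lp_norm_def)
    then have "((\<lambda>t. ennreal (Lp_norm \<mu> 2 (heat_semigroup \<mu> k t f - f) powr 2)) \<longlongrightarrow> ennreal 0) (at_right 0)"
      by (rule tendsto_ennrealI)
    then have "((\<lambda>t. moment \<mu> 2 (\<lambda>x. kernel_op \<mu> (K t) f x - f x)) \<longlongrightarrow> ennreal 0) (at_right 0)"
    proof (rule Lim_transform_eventually)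
      show "\<forall>\<^sub>F t in at_right 0. ennreal (Lp_norm \<mu> 2 (heat_semigroup \<mu> k t f - f) powr 2) = moment \<mu> 2 (\<lambda>x. kernel_op \<mu> (K t) f x - f x)"
        using eventually_at_right_less[of "0::real"] by eventually_elim (rule eq)
    qed
    then show "((\<lambda>t. moment \<mu> 2 (\<lambda>x. kernel_op \<mu> (K t) f x - f x)) \<longlongrightarrow> 0) (at_right 0)"
      by simp
  qed
  then show ?thesis using that[OF G AEG] by (simp add: K_def)
qed

definition subordinator :: "(real \<Rightarrow> real \<Rightarrow> real) \<Rightarrow> real measure" where
  "subordinator \<eta> = density lborel (\<lambda>s. ennreal (indicator {0<..} s * \<eta> 1 s))"

text \<open>The conditions are split up because the scaling law, used as a rewrite rule, does not terminate.\<close>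

lemma subordination_density_facts:
  assumes "subordination_density \<alpha> \<eta>"
  shows "\<forall>t>0. continuous_on {0<..} (\<eta> t)" (is ?A)
    and "\<forall>t>0. \<forall>s>0. 0 \<le> \<eta> t s" (is ?B)
    and "\<forall>t>0. \<forall>\<xi>\<ge>0. (\<integral>\<^sup>+ s \<in> {0<..}. ennreal (exp (- \<xi> * s) * \<eta> t s) \<partial>lborel) = ennreal (exp (- t * \<xi> powr \<alpha>))" (is ?C)
    and "\<forall>t>0. \<forall>s>0. \<eta> t s = t powr (- 1 / \<alpha>) * \<eta> 1 (s / t powr (1 / \<alpha>))" (is ?D)
    and "\<forall>\<gamma>>0. (\<integral>\<^sup>+ s \<in> {0<..}. ennreal (s powr (- \<gamma>) * \<eta> 1 s) \<partial>lborel) < \<infinity>" (is ?E)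
proof -
  note d = assms[unfolded subordination_density_def]
  show ?A by (rule d[THEN conjunct1])
  show ?B by (rule d[THEN conjunct2, THEN conjunct1])
  show ?C by (rule d[THEN conjunct2, THEN conjunct2, THEN conjunct1])
  show ?D by (rule d[THEN conjunct2, THEN conjunct2, THEN conjunct2, THEN conjunct1])
  show ?E by (rule d[THEN conjunct2, THEN conjunct2, THEN conjunct2, THEN conjunct2, THEN conjunct2, THEN conjunct1])
qed

lemma subordinator_density:
  assumes "subordination_density \<alpha> \<eta>"
  shows "(\<lambda>s. indicator {0<..} s * \<eta> 1 s) \<in> borel_measurable borel"
    "0 \<le> indicator {0<..} s * \<eta> 1 s"
proof -
  note facts = subordination_density_facts[OF assms]
  have "(\<lambda>s. indicator {0<..} s *\<^sub>R \<eta> 1 s) \<in> borel_measurable borel"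
    using facts(1)[rule_format, of 1] by (intro borel_measurable_continuous_on_indicator) auto
  then show "(\<lambda>s. indicator {0<..} s * \<eta> 1 s) \<in> borel_measurable borel" by simp
  show "0 \<le> indicator {0<..} s * \<eta> 1 s"
    using facts(2)[rule_format, of 1 s] by (auto simp: indicator_def)
qed

text \<open>The total mass is the Laplace transform at 0.\<close>

lemma subordinator_properties:
  assumes \<eta>: "subordination_density \<alpha> \<eta>" and \<alpha>: "0 < \<alpha>" and \<gamma>: "0 < \<gamma>"
  shows "prob_space (subordinator \<eta>)" "AE s in subordinator \<eta>. 0 < s"
    "(\<integral>\<^sup>+s. ennreal (s powr (- \<gamma>)) \<partial>subordinator \<eta>) < \<infinity>"
proof -
  note [measurable] = subordinator_density(1)[OF \<eta>]
  have dens: "(\<lambda>s. ennreal (indicator {0<..} s * \<eta> 1 s)) \<in> borel_measurable lborel" by measurable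
  have "(\<integral>\<^sup>+ s \<in> {0<..}. ennreal (exp (- 0 * s) * \<eta> 1 s) \<partial>lborel) = ennreal (exp (- 1 * 0 powr \<alpha>))"
    by (rule subordination_density_facts(3)[OF \<eta>, rule_format]) simp_all
  then have "(\<integral>\<^sup>+ s. ennreal (\<eta> 1 s) * indicator {0<..} s \<partial>lborel) = 1" by simp
  moreover have "(\<integral>\<^sup>+ s. ennreal (\<eta> 1 s) * indicator {0<..} s \<partial>lborel) = (\<integral>\<^sup>+ s. ennreal (indicator {0<..} s * \<eta> 1 s) \<partial>lborel)"
    by (intro nn_integral_cong) (simp add: indicator_def)
  ultimately have "emeasure (subordinator \<eta>) (space (subordinator \<eta>)) = 1"
    unfolding subordinator_def by (simp add: emeasure_density)
  then show "prob_space (subordinator \<eta>)" by (rule prob_spaceI)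
  show "AE s in subordinator \<eta>. 0 < s"
    unfolding subordinator_def AE_density[OF dens] by (auto simp: indicator_def)
  have "(\<integral>\<^sup>+s. ennreal (s powr (- \<gamma>)) \<partial>subordinator \<eta>) = (\<integral>\<^sup>+ s \<in> {0<..}. ennreal (s powr (- \<gamma>) * \<eta> 1 s) \<partial>lborel)"
  proof -
    have "(\<integral>\<^sup>+s. ennreal (s powr (- \<gamma>)) \<partial>subordinator \<eta>)
        = (\<integral>\<^sup>+s. ennreal (indicator {0<..} s * \<eta> 1 s) * ennreal (s powr (- \<gamma>)) \<partial>lborel)"
      unfolding subordinator_def by (rule nn_integral_density[OF dens]) measurable
    also have "\<dots> = (\<integral>\<^sup>+ s \<in> {0<..}. ennreal (s powr (- \<gamma>) * \<eta> 1 s) \<partial>lborel)"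
      by (intro nn_integral_cong) (simp add: indicator_def ennreal_mult''[symmetric] mult.commute)
    finally show ?thesis .
  qed
  also have "\<dots> < \<infinity>" by (rule subordination_density_facts(5)[OF \<eta>, rule_format, OF \<gamma>])
  finally show "(\<integral>\<^sup>+s. ennreal (s powr (- \<gamma>)) \<partial>subordinator \<eta>) < \<infinity>" .
qed

text \<open>The substitution \<open>s = \<tau> z\<close> absorbs the scaling of the density.\<close>

lemma (in subordinated_heat_family) fractional_kernel_eq_Ksub:
  assumes \<eta>: "subordination_density \<alpha> \<eta>" and \<alpha>: "0 < \<alpha>" and \<nu>: "\<nu> = subordinator \<eta>"
    and t: "0 < t" and kk: "\<And>s. 0 < s \<Longrightarrow> kk s x y = kreg s x y"
  shows "fractional_kernel \<eta> kk t x y = Ksub (t powr (1 / \<alpha>)) x y"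
proof -
  define \<tau> where "\<tau> = t powr (1 / \<alpha>)"
  have \<tau>: "0 < \<tau>" using t by (simp add: \<tau>_def)
  have scaling: "\<tau> * \<eta> t (\<tau> * z) = \<eta> 1 z" if "0 < z" for z
  proof -
    have "\<eta> t (\<tau> * z) = t powr (- 1 / \<alpha>) * \<eta> 1 (\<tau> * z / t powr (1 / \<alpha>))"
      by (rule subordination_density_facts(4)[OF \<eta>, rule_format, OF t]) (use \<tau> that in simp)
    also have "\<tau> * z / t powr (1 / \<alpha>) = z" using \<tau> by (simp add: \<tau>_def)
    also have "t powr (- 1 / \<alpha>) = inverse \<tau>" by (simp add: \<tau>_def powr_minus)
    finally show ?thesis using \<tau> by simp
  qed
  have "fractional_kernel \<eta> kk t x y = (\<integral>s. indicator {0<..} s * (\<eta> t s * kreg s x y) \<partial>lborel)"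
    unfolding fractional_kernel_def set_lebesgue_integral_def
    by (intro Bochner_Integration.integral_cong) (auto simp: indicator_def kk)
  also have "\<dots> = \<bar>\<tau>\<bar> *\<^sub>R (\<integral>z. indicator {0<..} (0 + \<tau> * z) * (\<eta> t (0 + \<tau> * z) * kreg (0 + \<tau> * z) x y) \<partial>lborel)"
    using \<tau> by (intro lborel_integral_real_affine) simp
  also have "\<dots> = (\<integral>z. \<tau> * (indicator {0<..} (\<tau> * z) * (\<eta> t (\<tau> * z) * kreg (\<tau> * z) x y)) \<partial>lborel)"
    using \<tau> by simp
  also have "\<dots> = (\<integral>z. (indicator {0<..} z * \<eta> 1 z) *\<^sub>R kreg (\<tau> * z) x y \<partial>lborel)"
  proof (intro Bochner_Integration.integral_cong refl)
    fix z :: real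
    show "\<tau> * (indicator {0<..} (\<tau> * z) * (\<eta> t (\<tau> * z) * kreg (\<tau> * z) x y)) = (indicator {0<..} z * \<eta> 1 z) *\<^sub>R kreg (\<tau> * z) x y"
    proof (cases "0 < z")
      case True
      then have "0 < \<tau> * z" using \<tau> by simp
      then show ?thesis using True scaling[OF True, symmetric] by (simp add: mult_ac)
    next
      case False
      then have "\<not> 0 < \<tau> * z" using \<tau> by (simp add: zero_less_mult_iff)
      then show ?thesis using False by (simp add: indicator_def)
    qed
  qed
  also have "\<dots> = Ksub \<tau> x y"
    unfolding Ksub_def unfolding \<nu> subordinator_def
    using subordinator_density[OF \<eta>] by (intro integral_density[symmetric]) auto
  finally show ?thesis by (simp add: \<tau>_def)
qed

section \<open>Space-time estimates\<close>

lemma time_interval_props: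
  "time_interval T \<subseteq> {0..}" "time_interval T \<in> sets lebesgue"
  "0 < T \<Longrightarrow> 0 \<in> time_interval T" "0 < T \<Longrightarrow> time_interval T - {0} \<noteq> {}"
proof -
  show "time_interval T \<subseteq> {0..}" by (auto simp: time_interval_def)
  show "time_interval T \<in> sets lebesgue"
  proof (cases T)
    case (real x)
    then have "time_interval T = {0..<x}" by (auto simp: time_interval_def ennreal_less_iff)
    then show ?thesis by simp
  next
    case top
    then have "time_interval T = {0..}" by (auto simp: time_interval_def)
    then show ?thesis by simp
  qed
  show "0 < T \<Longrightarrow> 0 \<in> time_interval T" by (simp add: time_interval_def)
  show "time_interval T - {0} \<noteq> {}" if T: "0 < T"
  proof -
    obtain e where "0 < e" "ennreal e \<le> T" by (rule ennreal_positive_real_below[OF T])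
    then have "ennreal (e / 2) < ennreal e" by (simp add: ennreal_less_iff)
    then have "ennreal (e / 2) < T" using \<open>ennreal e \<le> T\<close> by (rule less_le_trans)
    then have "e / 2 \<in> time_interval T - {0}" using \<open>0 < e\<close> by (simp add: time_interval_def)
    then show ?thesis by blast
  qed
qed

theorem theorem3p4:
  fixes \<mu> :: "'a::metric_space measure"
    and k :: "real \<Rightarrow> 'a \<Rightarrow> 'a \<Rightarrow> real"
    and \<eta> :: "real \<Rightarrow> real \<Rightarrow> real"
    and \<alpha> \<beta> :: real
  assumes "locally_compact_space (euclidean :: 'a topology)"
    and "separable_space (euclidean :: 'a topology)"
    and "sets \<mu> = sets borel"
    and "0 < \<beta>" and "ennreal \<beta> \<le> hausdorff_dimension (UNIV :: 'a set)"
    and "0 < \<alpha>" and "\<alpha> < 1"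
    and "heat_kernel \<mu> k"
    and "subordination_density \<alpha> \<eta>"
    and "\<exists>c>0. \<exists>C>0. \<forall>s>0. \<forall>x y. 0 < k s x y \<and>
           ennreal (k s x y) \<le>
             ennreal (c * exp (- C * (dist x y)\<^sup>2 / s)) / emeasure \<mu> (ball x (sqrt s))"
    and "(INF (x, r) \<in> UNIV \<times> {0<..}. emeasure \<mu> (ball x r) / ennreal (r powr \<beta>)) > 0"
  shows
    "(\<forall>(q::ennreal) (p::real) (r::real). admissible \<beta> \<alpha> q p r \<longrightarrow>
        (\<exists>c>0. \<forall>T>0. \<forall>\<phi> \<in> Lp_space \<mu> r.
           let I = time_interval T;
               u = (\<lambda>t. fractional_heat_semigroup \<mu> \<eta> k t \<phi>)
           in u \<in> Cb_space I (Lp_space \<mu> r) (Lp_norm \<mu> r) \<and>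
              (ennreal r \<le> q \<longrightarrow>
                 u \<in> Lq_space q I (Lp_space \<mu> p) (Lp_norm \<mu> p) \<and>
                 Lq_norm q I (Lp_norm \<mu> p) u \<le> c * Lp_norm \<mu> r \<phi>)))
     \<and>
     (\<forall>(q::ennreal) (p::real) (r::real). generalized_admissible \<beta> \<alpha> q p r \<longrightarrow>
        (\<exists>c>0. \<forall>T>0. \<forall>\<phi> \<in> Lp_space \<mu> r.
           let I = time_interval T;
               J = (if \<phi> \<in> Lp_space \<mu> p then I else I - {0});
               u = (\<lambda>t. fractional_heat_semigroup \<mu> \<eta> k t \<phi>)
           in u \<in> Cb_space I (Lp_space \<mu> r) (Lp_norm \<mu> r) \<and>
              u \<in> Csigma_space q J (Lp_space \<mu> p) (Lp_norm \<mu> p) \<and>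
              Csigma_norm q J (Lp_norm \<mu> p) u \<le> c * Lp_norm \<mu> r \<phi>))"
proof -
  note sets = assms(3) and \<beta> = assms(4) and \<alpha> = assms(6) and hk = assms(8) and \<eta> = assms(9)
  obtain c C where cC: "0 < c" "0 < C" and k: "\<And>s x y. 0 < s \<Longrightarrow> 0 < k s x y \<and>
      ennreal (k s x y) \<le> ennreal (c * exp (- C * (dist x y)\<^sup>2 / s)) / emeasure \<mu> (ball x (sqrt s))"
    using assms(10) by auto
  obtain v where v: "0 < v" "\<And>x r. 0 < r \<Longrightarrow> ennreal (v * r powr \<beta>) \<le> emeasure \<mu> (ball x r)"
    using volume_lower_bound[OF assms(11)] by blast
  obtain G where G: "AE x in \<mu>. x \<in> G"
    and heat: "heat_family \<mu> (\<lambda>t x y. if 0 < t \<and> x \<in> G \<and> y \<in> G then k t x y else 0) (c / v) (\<beta> / 2)"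
    using heat_kernel_regular_version[OF sets hk k cC v] by blast
  define K where "K = (\<lambda>t x y. if 0 < t \<and> x \<in> G \<and> y \<in> G then k t x y else 0)"
  define D where "D = enn2real (\<integral>\<^sup>+s. ennreal (s powr (- (\<beta> / 2))) \<partial>subordinator \<eta>)"
  define a where "a = 1 / \<alpha>"
  have a: "0 < a" and \<gamma>: "0 < \<beta> / 2" using \<alpha> \<beta> by (simp_all add: a_def)
  note sub = subordinator_properties[OF \<eta> \<alpha> \<gamma>]
  interpret S: subordinated_heat_family \<mu> K "c / v" "\<beta> / 2" "subordinator \<eta>" D
  proof (rule subordinated_heat_family.intro)
    show "heat_family \<mu> K (c / v) (\<beta> / 2)" using heat by (simp add: K_def)
    show "prob_space (subordinator \<eta>)" by (rule sub)
    show "subordinated_heat_family_axioms (\<beta> / 2) (subordinator \<eta>) D"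
      by (rule subordinated_heat_family_axioms.intro) (use sub \<gamma> in \<open>simp_all add: subordinator_def D_def\<close>)
  qed
  have exponent: "a * (\<beta> / 2) * (1 / r - 1 / p) = \<beta> / (2 * \<alpha>) * (1 / r - 1 / p)" for r p
    by (simp add: a_def)
  define U where "U \<phi> = (\<lambda>t. fractional_heat_semigroup \<mu> \<eta> k t \<phi>)" for \<phi>
  have orbit: "AE x in \<mu>. U \<phi> t x = S.T (t powr a) g x"
    if g [measurable]: "g \<in> borel_measurable \<mu>" and \<phi>: "AE x in \<mu>. \<phi> x = g x"
      and r: "1 < r" and fin: "moment \<mu> r g < \<infinity>" and t: "0 \<le> t" for g \<phi> r t
  proof (cases "t = 0")
    case True
    then show ?thesis using \<phi> by (simp add: U_def fractional_heat_semigroup_def S.T_zero)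
  next
    case False
    then have t: "0 < t" using t by simp
    have \<tau>: "0 < t powr a" using t by simp
    interpret Ksub: contractive_kernel \<mu> "S.Ksub (t powr a)" "c / v * (t powr a) powr (- (\<beta> / 2)) * D"
      by (rule S.Ksub_contractive[OF \<tau>])
    show ?thesis
      using G
    proof eventually_elim
      case (elim x)
      have "AE y in \<mu>. fractional_kernel \<eta> k t x y * \<phi> y = S.Ksub (t powr a) x y * g y"
        using G S.kreg_eq[of x] \<phi>
      proof eventually_elim
        case (elim y)
        have "k s x y = S.kreg s x y" if "0 < s" for s
          using elim that \<open>x \<in> G\<close> by (simp add: K_def)
        then have "fractional_kernel \<eta> k t x y = S.Ksub (t powr (1 / \<alpha>)) x y"
          by (rule S.fractional_kernel_eq_Ksub[OF \<eta> \<alpha> refl t])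
        then show ?case using elim by (simp add: a_def)
      qed
      then have "(\<integral>y. fractional_kernel \<eta> k t x y * \<phi> y \<partial>completion \<mu>) = kernel_op \<mu> (S.Ksub (t powr a)) g x"
        unfolding kernel_op_def by (rule integral_completion_AE) measurable
      also have "\<dots> = S.T (t powr a) g x"
        using S.T_eq_kernel_op[OF g _ fin \<tau>] r by simp
      finally show ?case using t by (simp add: U_def fractional_heat_semigroup_def)
    qed
  qed
  have Lebesgue: "\<exists>c>0. \<forall>T>0. \<forall>\<phi>\<in>Lp_space \<mu> r.
      U \<phi> \<in> Cb_space (time_interval T) (Lp_space \<mu> r) (Lp_norm \<mu> r) \<and>
      (ennreal r \<le> q \<longrightarrow> U \<phi> \<in> Lq_space q (time_interval T) (Lp_space \<mu> p) (Lp_norm \<mu> p) \<and>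
         Lq_norm q (time_interval T) (Lp_norm \<mu> p) (U \<phi>) \<le> c * Lp_norm \<mu> r \<phi>)"
    if adm: "admissible \<beta> \<alpha> q p r" for q :: ennreal and p r :: real
  proof -
    have r: "1 < r" and p: "r \<le> p" and q: "1 / q = ennreal (\<beta> / (2 * \<alpha>) * (1 / r - 1 / p))"
      using adm by (auto simp: admissible_def)
    define d where "d = \<beta> / (2 * \<alpha>) * (1 / r - 1 / p)"
    have d: "0 \<le> d" using \<alpha> \<beta> r p by (simp add: d_def field_simps)
    have q_cases: "d = 0 \<and> q = \<infinity> \<or> 0 < d \<and> q = ennreal (1 / d)"
      using q d by (intro ennreal_reciprocal_cases) (simp_all add: d_def)
    have "\<exists>c0>0. \<forall>T \<phi> g. g \<in> borel_measurable \<mu> \<longrightarrow> (AE x in \<mu>. \<phi> x = g x) \<longrightarrow> moment \<mu> r g < \<infinity> \<longrightarrow> ennreal r \<le> q \<longrightarrow>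
        U \<phi> \<in> Lq_space q (time_interval T) (Lp_space \<mu> p) (Lp_norm \<mu> p) \<and>
        Lq_norm q (time_interval T) (Lp_norm \<mu> p) (U \<phi>) \<le> c0 * Lp_norm \<mu> r \<phi>"
    proof (cases "d = 0")
      case True
      then have q_inf: "q = \<infinity>" using q_cases by simp
      have pr: "p = r" using True \<alpha> \<beta> r p by (simp add: d_def)
      show ?thesis
      proof (intro exI[of _ "1::real"] conjI allI impI)
        fix T :: ennreal and \<phi> g :: "'a \<Rightarrow> real"
        assume g: "g \<in> borel_measurable \<mu>" and \<phi>: "AE x in \<mu>. \<phi> x = g x" and fin: "moment \<mu> r g < \<infinity>"
        note res = S.u_Lq_space_infinite[OF g r fin a \<phi> orbit[OF g \<phi> r fin] time_interval_props(2,1)]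
        show "U \<phi> \<in> Lq_space q (time_interval T) (Lp_space \<mu> p) (Lp_norm \<mu> p)"
          unfolding q_inf pr by (rule res(1))
        show "Lq_norm q (time_interval T) (Lp_norm \<mu> p) (U \<phi>)
          \<le> 1 * Lp_norm \<mu> r \<phi>"
          unfolding q_inf pr by (rule res(2))
      qed simp
    next
      case False
      then have dpos: "0 < d" and q': "q = ennreal (1 / d)" using q_cases d by auto
      have "p \<noteq> r" using dpos by (auto simp: d_def)
      then have rp: "r < p" using p by simp
      show ?thesis
      proof (cases "ennreal r \<le> q")
        case True
        then have rq: "r \<le> 1 / d" using q' dpos by simp
        have "1 / (1 / d) = d" by simp
        then have dq: "1 / (1 / d) = a * (\<beta> / 2) * (1 / r - 1 / p)" unfolding exponent d_def .
        obtain C0 where C0: "0 < C0" and est: "\<forall>g N. g \<in> borel_measurable \<mu> \<longrightarrow> 0 \<le> N \<longrightarrow> moment \<mu> r g \<le> ennreal N \<longrightarrow>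
          (\<integral>\<^sup>+t\<in>{0<..}. ennreal (enn2real (moment \<mu> p (S.T (t powr a) g)) powr ((1 / d) / p)) \<partial>lborel)
            \<le> ennreal (C0 * N powr ((1 / d) / r))"
          using S.T_spacetime_estimate[OF r rp rq a dq] by (elim exE conjE)
        show ?thesis
        proof (intro exI[of _ "C0 powr (1 / (1 / d))"] conjI allI impI)
          show "0 < C0 powr (1 / (1 / d))" using C0 by simp
          fix T :: ennreal and \<phi> g :: "'a \<Rightarrow> real"
          assume g: "g \<in> borel_measurable \<mu>" and \<phi>: "AE x in \<mu>. \<phi> x = g x" and fin: "moment \<mu> r g < \<infinity>"
          have e: "(\<integral>\<^sup>+t\<in>{0<..}. ennreal (enn2real (moment \<mu> p (S.T (t powr a) g)) powr ((1 / d) / p)) \<partial>lborel)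
            \<le> ennreal (C0 * enn2real (moment \<mu> r g) powr ((1 / d) / r))"
            using est g fin by simp
          have d': "0 < 1 / d" using dpos by simp
          note res = S.u_Lq_space_finite[OF g r fin a \<phi> orbit[OF g \<phi> r fin] time_interval_props(2,1) p d' C0 e]
          show "U \<phi> \<in> Lq_space q (time_interval T) (Lp_space \<mu> p) (Lp_norm \<mu> p)"
            unfolding q' by (rule res(1))
          show "Lq_norm q (time_interval T) (Lp_norm \<mu> p) (U \<phi>)
            \<le> C0 powr (1 / (1 / d)) * Lp_norm \<mu> r \<phi>"
            unfolding q' by (rule res(2))
        qed
      next
        case False
        then show ?thesis by (intro exI[of _ "1::real"]) simp
      qed
    qed
    then obtain c0 where c0: "0 < c0" and Lq: "\<And>T \<phi> g. g \<in> borel_measurable \<mu> \<Longrightarrow> (AE x in \<mu>. \<phi> x = g x) \<Longrightarrow> moment \<mu> r g < \<infinity> \<Longrightarrow> ennreal r \<le> q \<Longrightarrow>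
        U \<phi> \<in> Lq_space q (time_interval T) (Lp_space \<mu> p) (Lp_norm \<mu> p) \<and>
        Lq_norm q (time_interval T) (Lp_norm \<mu> p) (U \<phi>) \<le> c0 * Lp_norm \<mu> r \<phi>"
      by blast
    show ?thesis
    proof (intro exI[of _ c0] conjI[OF c0] allI impI ballI)
      fix T :: ennreal and \<phi> assume "\<phi> \<in> Lp_space \<mu> r"
      then obtain g where g: "g \<in> borel_measurable \<mu>" "AE x in \<mu>. \<phi> x = g x" "moment \<mu> r g < \<infinity>"
        by (rule Lp_space_representative)
      show "U \<phi> \<in> Cb_space (time_interval T) (Lp_space \<mu> r) (Lp_norm \<mu> r) \<and>
        (ennreal r \<le> q \<longrightarrow> U \<phi> \<in> Lq_space q (time_interval T) (Lp_space \<mu> p) (Lp_norm \<mu> p) \<and>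
           Lq_norm q (time_interval T) (Lp_norm \<mu> p) (U \<phi>) \<le> c0 * Lp_norm \<mu> r \<phi>)"
        using S.u_Cb_space[OF g(1) r g(3) a g(2) orbit[OF g(1,2) r g(3)] time_interval_props(1)] Lq[OF g] by blast
    qed
  qed
  define J where "J T \<phi> p = (if \<phi> \<in> Lp_space \<mu> p then time_interval T else time_interval T - {0})" for T \<phi> p
  have weighted: "\<exists>c>0. \<forall>T>0. \<forall>\<phi>\<in>Lp_space \<mu> r.
      U \<phi> \<in> Cb_space (time_interval T) (Lp_space \<mu> r) (Lp_norm \<mu> r) \<and>
      U \<phi> \<in> Csigma_space q (J T \<phi> p) (Lp_space \<mu> p) (Lp_norm \<mu> p) \<and>
      Csigma_norm q (J T \<phi> p) (Lp_norm \<mu> p) (U \<phi>) \<le> c * Lp_norm \<mu> r \<phi>"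
    if adm: "generalized_admissible \<beta> \<alpha> q p r" for q :: ennreal and p r :: real
  proof -
    have r: "1 < r" and p: "r \<le> p" using adm by (simp_all add: generalized_admissible_def)
    have q: "1 / q = ennreal (a * (\<beta> / 2) * (1 / r - 1 / p))"
      unfolding exponent by (rule adm[unfolded generalized_admissible_def, THEN conjunct1])
    define c0 where "c0 = (c / v * D) powr (1 / r - 1 / p) + 1"
    have c0: "0 < c0" by (simp add: c0_def add_nonneg_pos)
    show ?thesis
    proof (intro exI[of _ c0] conjI[OF c0] allI impI ballI)
      fix T :: ennreal and \<phi> assume T: "0 < T" and \<phi>: "\<phi> \<in> Lp_space \<mu> r"
      from \<phi> obtain g where g: "g \<in> borel_measurable \<mu>" "AE x in \<mu>. \<phi> x = g x" "moment \<mu> r g < \<infinity>"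
        by (rule Lp_space_representative)
      have J: "J T \<phi> p \<subseteq> {0..}" "J T \<phi> p \<noteq> {}" "0 \<in> J T \<phi> p \<Longrightarrow> \<phi> \<in> Lp_space \<mu> p"
        using time_interval_props[of T] T by (auto simp: J_def split: if_splits)
      note orb = orbit[OF g(1,2) r g(3)]
      show "U \<phi> \<in> Cb_space (time_interval T) (Lp_space \<mu> r) (Lp_norm \<mu> r) \<and>
        U \<phi> \<in> Csigma_space q (J T \<phi> p) (Lp_space \<mu> p) (Lp_norm \<mu> p) \<and>
        Csigma_norm q (J T \<phi> p) (Lp_norm \<mu> p) (U \<phi>) \<le> c0 * Lp_norm \<mu> r \<phi>"
        unfolding c0_def
        by (intro conjI S.u_Cb_space[OF g(1) r g(3) a g(2) orb time_interval_props(1)]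
            S.u_Csigma_space[OF g(1) r g(3) a g(2) orb p q J])
    qed
  qed
  show ?thesis
    using Lebesgue weighted unfolding Let_def U_def J_def by blast
qed

end
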